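(* Let $d\ge1$, $\alpha,\beta\in[1/2,\infty)^d$, and let $\mathbf{R}=(R_1,\ldots,R_d)$ be the vector of Riesz transforms for Jacobi function expansions with parameters $\alpha,\beta$ defined in the context. Then for every $1<p<\infty$ we have $$\|\mathbf{R}f\|_p\le48\,(p^*-1)\,\|f\|_p,\qquad f\in L^p((0,\pi)^d,dx),\quad p^*=\max\left(p,\frac p{p-1}\right).$$
   Context: All functions are real-valued, $\mathbb{N}=\{0,1,2,\ldots\}$. $L^p=L^p((0,\pi)^d,dx)$; for vector-valued functions $\|\mathbf{g}\|_p=\big(\int|\mathbf{g}|^p\,dx\big)^{1/p}$ with $|\cdot|$ the Euclidean norm. Let $\phi_k^{\alpha,\beta}=\phi_{k_1}^{\alpha_1,\beta_1}\otimes\cdots\otimes\phi_{k_d}^{\alpha_d,\beta_d}$, $k\in\mathbb{N}^d$, be the $L^2$-normalized Jacobi functions, $\phi_n^{a,b}(x)=c_n^{a,b}\,P_n^{a,b}(\cos x)\,\big(\sin\frac x2\big)^{a+1/2}\big(\cos\frac x2\big)^{b+1/2}$, $x\in(0,\pi)$, where $P_n^{a,b}$ is the classical Jacobi polynomial of degree $n$ and $c_n^{a,b}>0$ is chosen so that $\|\phi_n^{a,b}\|_{L^2((0,\pi),dx)}=1$. They form an orthonormal basis of $L^2$ of eigenfunctions of $L=-\Delta+\sum_{i=1}^d\Big(\frac{4\alpha_i^2-1}{16\sin^2\frac{x_i}2}+\frac{4\beta_i^2-1}{16\cos^2\frac{x_i}2}\Big)$ with eigenvalues $\lambda_k=\sum_{i=1}^d\big(k_i+\frac{\alpha_i+\beta_i+1}2\big)^2$.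 Let $\delta_i=\partial_{x_i}-\frac{2\alpha_i+1}4\cot\frac{x_i}2+\frac{2\beta_i+1}4\tan\frac{x_i}2$; then $\delta_i\phi_k^{\alpha,\beta}=-\sqrt{k_i(k_i+\alpha_i+\beta_i+1)}\,\phi_{k-e_i}^{\alpha+e_i,\beta+e_i}$ (zero if $k_i=0$). The Riesz transforms ($R_i=\delta_iL^{-1/2}$) are $R_if=\sum_{k\in\mathbb{N}^d}\lambda_k^{-1/2}\langle f,\phi_k^{\alpha,\beta}\rangle_{L^2}\,\delta_i\phi_k^{\alpha,\beta}$ for $f\in L^2$, and $\mathbf{R}f=(R_1f,\ldots,R_df)$. For $f\in L^p$, $\mathbf{R}f$ is understood as the continuous extension of $\mathbf{R}$ from the dense subspace $\mathrm{lin}\{\phi_k^{\alpha,\beta}\}$ (existence of the extension is part of the claim). *)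

theory Defs
  imports "HOL-Analysis.Analysis"
begin

section \<open>$L^p$ on the cube $(0,\pi)^d$\<close>

definition cube :: "(real ^ 'd) set" where
  "cube = {x. \<forall>i. 0 < x $ i \<and> x $ i < pi}"

abbreviation cube_measure :: "(real ^ 'd) measure" where
  "cube_measure \<equiv> lebesgue_on cube"

text \<open>The elements of \<open>Lp p\<close> are functions, not classes of functions modulo null sets;
  \<open>Lp_norm\<close> is a seminorm on them. The library integral of a non-integrable function is \<open>0\<close>,
  so \<open>Lp_norm p f\<close> is meaningful only for \<open>f \<in> Lp p\<close>.\<close>

definition Lp :: "real \<Rightarrow> (real ^ 'd \<Rightarrow> 'b::real_normed_vector) set" where
  "Lp p = {f. f \<in> borel_measurable cube_measure \<and>
              integrable cube_measure (\<lambda>x. norm (f x) powr p)}"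

definition Lp_norm :: "real \<Rightarrow> (real ^ 'd \<Rightarrow> 'b::real_normed_vector) \<Rightarrow> real" where
  "Lp_norm p f = (\<integral>x. norm (f x) powr p \<partial>cube_measure) powr (1 / p)"

definition L2_inner :: "(real ^ 'd \<Rightarrow> real) \<Rightarrow> (real ^ 'd \<Rightarrow> real) \<Rightarrow> real" where
  "L2_inner f g = (\<integral>x. f x * g x \<partial>cube_measure)"


section \<open>Jacobi functions\<close>

text \<open>The classical Jacobi polynomial $P_n^{a,b}$, normalised by
  $P_n^{a,b}(1) = \binom{n+a}{n}$.\<close>

definition jacobi_poly :: "real \<Rightarrow> real \<Rightarrow> nat \<Rightarrow> real \<Rightarrow> real" where
  "jacobi_poly a b n t =
     (\<Sum>s\<le>n. ((real n + a) gchoose (n - s)) * ((real n + b) gchoose s) *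
            ((t - 1) / 2) ^ s * ((t + 1) / 2) ^ (n - s))"

definition jacobi_unnormalized :: "real \<Rightarrow> real \<Rightarrow> nat \<Rightarrow> real \<Rightarrow> real" where
  "jacobi_unnormalized a b n x =
     jacobi_poly a b n (cos x) * sin (x / 2) powr (a + 1/2) * cos (x / 2) powr (b + 1/2)"

definition jacobi_const :: "real \<Rightarrow> real \<Rightarrow> nat \<Rightarrow> real" where
  "jacobi_const a b n =
     1 / sqrt (\<integral>x. (jacobi_unnormalized a b n x)\<^sup>2 \<partial>lebesgue_on {0<..<pi})"

definition jacobi_fun1 :: "real \<Rightarrow> real \<Rightarrow> nat \<Rightarrow> real \<Rightarrow> real" where
  "jacobi_fun1 a b n x = jacobi_const a b n * jacobi_unnormalized a b n x"

definition jacobi_fun ::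
  "real ^ 'd \<Rightarrow> real ^ 'd \<Rightarrow> nat ^ 'd \<Rightarrow> real ^ 'd \<Rightarrow> real" where
  "jacobi_fun \<alpha> \<beta> k x = (\<Prod>i\<in>UNIV. jacobi_fun1 (\<alpha> $ i) (\<beta> $ i) (k $ i) (x $ i))"

definition jacobi_eigenvalue :: "real ^ 'd \<Rightarrow> real ^ 'd \<Rightarrow> nat ^ 'd \<Rightarrow> real" where
  "jacobi_eigenvalue \<alpha> \<beta> k =
     (\<Sum>i\<in>UNIV. (real (k $ i) + (\<alpha> $ i + \<beta> $ i + 1) / 2)\<^sup>2)"

definition jacobi_span :: "real ^ 'd \<Rightarrow> real ^ 'd \<Rightarrow> (real ^ 'd \<Rightarrow> real) set" where
  "jacobi_span \<alpha> \<beta> =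
     {f. \<exists>K c. finite K \<and> f = (\<lambda>x. \<Sum>k\<in>K. c k * jacobi_fun \<alpha> \<beta> k x)}"


section \<open>Riesz transforms\<close>

definition partial_deriv :: "'d \<Rightarrow> (real ^ 'd \<Rightarrow> real) \<Rightarrow> real ^ 'd \<Rightarrow> real" where
  "partial_deriv i f x = deriv (\<lambda>t. f (\<chi> j. if j = i then t else x $ j)) (x $ i)"

definition jacobi_delta ::
  "real ^ 'd \<Rightarrow> real ^ 'd \<Rightarrow> 'd \<Rightarrow> (real ^ 'd \<Rightarrow> real) \<Rightarrow> real ^ 'd \<Rightarrow> real" where
  "jacobi_delta \<alpha> \<beta> i f x =
     partial_deriv i f x
     - (2 * \<alpha> $ i + 1) / 4 * cot (x $ i / 2) * f x
     + (2 * \<beta> $ i + 1) / 4 * tan (x $ i / 2) * f x"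

text \<open>\<open>has_riesz_transform \<alpha> \<beta> i f g\<close> means that \<open>f\<close> is in $L^2$ and $g = R_i f$ (up to a null
  set), that is, the series defining $R_i f$ converges (unconditionally) in $L^2$ to \<open>g\<close>.\<close>

definition has_riesz_transform ::
  "real ^ 'd \<Rightarrow> real ^ 'd \<Rightarrow> 'd \<Rightarrow> (real ^ 'd \<Rightarrow> real) \<Rightarrow> (real ^ 'd \<Rightarrow> real) \<Rightarrow> bool" where
  "has_riesz_transform \<alpha> \<beta> i f g \<longleftrightarrow>
     f \<in> Lp 2 \<and> g \<in> Lp 2 \<and>
     ((\<lambda>K. Lp_norm 2 (\<lambda>x. g x -
         (\<Sum>k\<in>K. jacobi_eigenvalue \<alpha> \<beta> k powr (- 1/2) * L2_inner f (jacobi_fun \<alpha> \<beta> k) *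
                jacobi_delta \<alpha> \<beta> i (jacobi_fun \<alpha> \<beta> k) x)))
      \<longlongrightarrow> 0) (finite_subsets_at_top UNIV)"

text \<open>\<open>T\<close> is a continuous extension to $L^p$ of the vector $(R_1,\dots,R_d)$ of Riesz transforms
  restricted to the span of the Jacobi functions. Applied to functions that agree almost
  everywhere, the continuity clause shows that \<open>T\<close> respects equality almost everywhere.\<close>

definition riesz_extension ::
  "real ^ 'd \<Rightarrow> real ^ 'd \<Rightarrow> real \<Rightarrow> ((real ^ 'd \<Rightarrow> real) \<Rightarrow> (real ^ 'd \<Rightarrow> real ^ 'd)) \<Rightarrow> bool" where
  "riesz_extension \<alpha> \<beta> p T \<longleftrightarrow>
     (\<forall>f \<in> Lp p. T f \<in> Lp p) \<and>
     (\<forall>F. \<forall>f \<in> Lp p. (\<forall>n::nat. F n \<in> Lp p) \<and>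
        (\<lambda>n. Lp_norm p (\<lambda>x. F n x - f x)) \<longlonglongrightarrow> 0 \<longrightarrow>
        (\<lambda>n. Lp_norm p (\<lambda>x. T (F n) x - T f x)) \<longlonglongrightarrow> 0) \<and>
     (\<forall>f \<in> jacobi_span \<alpha> \<beta>. \<forall>i. has_riesz_transform \<alpha> \<beta> i f (\<lambda>x. T f x $ i))"

end

theory Submission
  imports Defs
begin

text \<open>Let $u = e^{-tL^{1/2}} f$ and let $w_i = e^{-tM_i^{1/2}} g_i$ be the Poisson extensions, where $M_i$ is the operator
  with $\delta_i L = M_i \delta_i$. Then $\langle \mathbf{R} f, \mathbf{g} \rangle$ is $-4$ times the integral of
  $t \sum_i \delta_i u \, \partial_t w_i$ over $(0,\pi)^d \times (0,\infty)$. With $P = p^*$ and $Q = P/(P-1)$, let $b = B(u, |w|)$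
  where, up to a regularization, $B = X^P + Y^Q + \gamma X^2 (X^P + Y^Q)^{1-2/P}$, $X$ is the variable taken in $L^P$ and $Y$
  the one in $L^Q$. Since $\delta_i = \partial_i + q_i$ and the potential of $L$ does not dominate $\sum_i q_i^2$ (it vanishes
  for $\alpha = \beta = 1/2$), the Hessian of $B$ alone does not control $\delta_i u$. Adding the null Lagrangian
  $\sum_i \partial_i (q_i G(u, w))$, where $G$ is dominated by the potential term $u \, \partial_u B$, repairs this, and
  $\partial_t^2 b + \sum_i \partial_i (\partial_i b + q_i G) \ge 4 \gamma \, |\sum_i \delta_i u \, \partial_t w_i|$ holds pointwise.
  Integration over the cube removes the divergence, because the eigenfunctions vanish at the boundary, and a convexity argument
  in $t$ bounds $|\langle \mathbf{R} f, \mathbf{g} \rangle|$ by $17 (p^*-1) (\|f\|_p^p + \|\mathbf{g}\|_q^q)$. Testing with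
  $\mathbf{g}$ close to $|\mathbf{R} f|^{p-2} \mathbf{R} f$ gives the constant $34 (p^*-1)$ on the span of the Jacobi functions,
  which is dense in $L^p$.\<close>

section \<open>Bellman functions\<close>

text \<open>The two quadratic forms must be balanced: the time form has to dominate T |\<partial>_t
  w|^2 and the space form (c^2/4)/T times (\<xi> + q u)^2, with the same c at every point; then c
  |\<delta> u| |\<partial>_t w| is below their sum. X^P alone gives the weight X^(P-2), which
  degenerates where Y^Q dominates. The third term repairs this: with \<open>sig\<close> = (X^P +
  Y^Q)^(1-2/P) it contributes \<gamma> \<open>sig\<close> in the X direction, while Y^Q leaves about
  (Q-1) Y^(Q-2) \<ge> (Q-1)/\<open>sig\<close> in the Y direction, so the product of the weights
  stays of order \<gamma>^2. As Q - 1 = 1/(P-1), the choice \<gamma> = (Q-1)/16 leaves room for the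
  mixed derivatives and enlarges B only by the factor 1 + \<gamma> \<le> 17/16; this gives the 17.
  The function G depends on the slot of u. Up to regularization it is \<gamma> u^2
  \<open>sig\<close> when u is the L^P variable (p \<ge> 2) and (Q(Q-1)/2) |u|^Q when u is the L^Q
  variable (p < 2). The calculus uses m = X^2 and n = Y^2, so that the vector w enters only through
  |w|^2.\<close>

lemma has_real_derivative_powr_chain:
  fixes f :: "real \<Rightarrow> real"
  assumes "(f has_real_derivative D) (at x within S)" "0 < f x"
  shows "((\<lambda>t. f t powr r) has_real_derivative r * f x powr (r - 1) * D) (at x within S)"
  using DERIV_chain'[OF assms(1) has_real_derivative_powr[OF assms(2)]] by simp

lemma weighted_AMGM:
  fixes a b c x y :: real
  assumes "0 \<le> a" "0 \<le> c" "b\<^sup>2 \<le> 4 * a * c"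
  shows "0 \<le> a * x\<^sup>2 + b * x * y + c * y\<^sup>2"
proof -
  have "\<bar>b\<bar> \<le> 2 * sqrt a * sqrt c"
  proof -
    have "b\<^sup>2 \<le> (2 * sqrt a * sqrt c)\<^sup>2"
      using assms by (simp add: power_mult_distrib)
    then show ?thesis
      using assms(1,2) by (metis abs_le_square_iff abs_of_nonneg mult_nonneg_nonneg real_sqrt_ge_zero zero_le_numeral)
  qed
  then have "\<bar>b * x * y\<bar> \<le> 2 * sqrt a * sqrt c * (\<bar>x\<bar> * \<bar>y\<bar>)"
    using mult_right_mono[of "\<bar>b\<bar>" "2 * sqrt a * sqrt c" "\<bar>x\<bar> * \<bar>y\<bar>"] by (simp add: abs_mult mult.assoc)
  moreover have "0 \<le> (sqrt a * \<bar>x\<bar> - sqrt c * \<bar>y\<bar>)\<^sup>2" by simp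
  then have "2 * sqrt a * sqrt c * (\<bar>x\<bar> * \<bar>y\<bar>) \<le> a * x\<^sup>2 + c * y\<^sup>2"
    using assms(1,2) by (simp add: power2_diff power_mult_distrib algebra_simps)
  ultimately show ?thesis by linarith
qed

section \<open>The Bellman function in squared variables and its partial derivatives\<close>

locale bellman_exponent =
  fixes P :: real
  assumes P2: "2 \<le> P"
begin

definition Q :: real where "Q = P / (P - 1)"
definition kap :: real where "kap = 1 - 2 / P"
definition gam :: real where "gam = 1 / (16 * (P - 1))"
definition pm :: "real \<Rightarrow> real" where "pm m = m powr (P / 2 - 1)"
definition pn :: "real \<Rightarrow> real" where "pn n = n powr (Q / 2 - 1)"
definition s :: "real \<Rightarrow> real \<Rightarrow> real" where "s m n = m powr (P / 2) + n powr (Q / 2)"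
definition sig :: "real \<Rightarrow> real \<Rightarrow> real" where "sig m n = s m n powr kap"
definition B :: "real \<Rightarrow> real \<Rightarrow> real" where "B m n = s m n + gam * m * sig m n"
text \<open>The partial derivatives of \<open>B\<close> keep \<open>sig m n / s m n\<close> =
  s^(-2/P) as a unit, since the estimates below bound this ratio times powers of m and n.\<close>

definition Bm :: "real \<Rightarrow> real \<Rightarrow> real" where
  "Bm m n = P / 2 * pm m + gam * (sig m n + kap * m * (sig m n / s m n) * (P / 2 * pm m))"
definition Bn :: "real \<Rightarrow> real \<Rightarrow> real" where
  "Bn m n = Q / 2 * pn n * (1 + gam * kap * m * (sig m n / s m n))"
definition Bmm :: "real \<Rightarrow> real \<Rightarrow> real" where
  "Bmm m n = P / 2 * ((P / 2 - 1) * (pm m / m)) + gam * (kap * (sig m n / s m n) * (P / 2 * pm m)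
     + kap * ((sig m n / s m n) * (P / 2 * pm m)
              + m * ((kap - 1) * (sig m n / (s m n)\<^sup>2) * (P / 2 * pm m)) * (P / 2 * pm m)
              + m * (sig m n / s m n) * (P / 2 * ((P / 2 - 1) * (pm m / m)))))"
definition Bmn :: "real \<Rightarrow> real \<Rightarrow> real" where
  "Bmn m n = gam * (kap * (sig m n / s m n) * (Q / 2 * pn n)
     + kap * m * ((kap - 1) * (sig m n / (s m n)\<^sup>2) * (Q / 2 * pn n)) * (P / 2 * pm m))"
definition Bnn :: "real \<Rightarrow> real \<Rightarrow> real" where
  "Bnn m n = Q / 2 * ((Q / 2 - 1) * (pn n / n)) * (1 + gam * kap * m * (sig m n / s m n))
     + Q / 2 * pn n * (gam * kap * m * ((kap - 1) * (sig m n / (s m n)\<^sup>2) * (Q / 2 * pn n)))"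

lemma Q_bounds: "1 < Q" "Q \<le> 2" "0 < Q"
  using P2 by (auto simp: Q_def field_simps)

lemma Q_minus: "Q - 1 = 16 * gam" and gam_pos: "0 < gam" and gam_le: "gam \<le> 1 / 16"
  and P_gam: "P * gam = Q / 16"
  using P2 by (auto simp: Q_def gam_def field_simps)

lemma kap_bounds: "0 \<le> kap" "kap \<le> 1"
  using P2 by (auto simp: kap_def field_simps)

text \<open>Conjugacy gives Q/P = Q - 1, which makes every product of \<open>kap\<close> or
  \<open>kap - 1\<close> with an exponent linear in that exponent.\<close>

lemma kap_P: "kap * P = P - 2" and kap_Q: "kap * Q = 2 - Q"
  and kap1_P: "(kap - 1) * P = - 2" and kap1_Q: "(kap - 1) * Q = - 2 * (Q - 1)"
  using P2 by (auto simp: kap_def Q_def field_simps)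

lemma s_pos: "0 < m \<Longrightarrow> 0 < n \<Longrightarrow> 0 < s m n"
  by (simp add: s_def add_pos_pos)

lemma sig_pos: "0 < m \<Longrightarrow> 0 < n \<Longrightarrow> 0 < sig m n"
  using s_pos[of m n] by (simp add: sig_def)

lemma pm_pos: "0 < m \<Longrightarrow> 0 < pm m" and pn_pos: "0 < n \<Longrightarrow> 0 < pn n"
  by (simp_all add: pm_def pn_def)

lemma s_alt: "0 < m \<Longrightarrow> 0 < n \<Longrightarrow> s m n = m * pm m + n * pn n"
  using powr_mult_base[of m "P/2 - 1"] powr_mult_base[of n "Q/2 - 1"] by (simp add: s_def pm_def pn_def)

lemma deriv_pm:
  assumes "(m has_real_derivative m') (at t within S)" "0 < m t"
  shows "((\<lambda>t. pm (m t)) has_real_derivative ((P / 2 - 1) * (pm (m t) / m t)) * m') (at t within S)"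
  unfolding pm_def
  by (rule DERIV_cong[OF has_real_derivative_powr_chain[OF assms]])
     (use assms(2) powr_diff[of "m t" "P / 2 - 1" 1] in simp)

lemma deriv_pn:
  assumes "(n has_real_derivative n') (at t within S)" "0 < n t"
  shows "((\<lambda>t. pn (n t)) has_real_derivative ((Q / 2 - 1) * (pn (n t) / n t)) * n') (at t within S)"
  unfolding pn_def
  by (rule DERIV_cong[OF has_real_derivative_powr_chain[OF assms]])
     (use assms(2) powr_diff[of "n t" "Q / 2 - 1" 1] in simp)

context
  fixes m n :: "real \<Rightarrow> real" and m' n' t :: real and S :: "real set"
  assumes m: "(m has_real_derivative m') (at t within S)" "0 < m t"
    and n: "(n has_real_derivative n') (at t within S)" "0 < n t"
begin

lemma deriv_s:
  "((\<lambda>t. s (m t) (n t)) has_real_derivative P / 2 * pm (m t) * m' + Q / 2 * pn (n t) * n') (at t within S)"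
  unfolding s_def pm_def pn_def
  by (intro DERIV_add has_real_derivative_powr_chain m n)

lemma deriv_sig:
  "((\<lambda>t. sig (m t) (n t)) has_real_derivative
     kap * (sig (m t) (n t) / s (m t) (n t)) * (P / 2 * pm (m t) * m' + Q / 2 * pn (n t) * n')) (at t within S)"
proof -
  have "s (m t) (n t) powr (kap - 1) = sig (m t) (n t) / s (m t) (n t)"
    using s_pos[OF m(2) n(2)] by (simp add: sig_def powr_diff)
  then show ?thesis
    using has_real_derivative_powr_chain[OF deriv_s s_pos[OF m(2) n(2)], of kap]
    by (simp add: sig_def)
qed

lemma deriv_sig_div_s:
  "((\<lambda>t. sig (m t) (n t) / s (m t) (n t)) has_real_derivative
     (kap - 1) * (sig (m t) (n t) / (s (m t) (n t))\<^sup>2) * (P / 2 * pm (m t) * m' + Q / 2 * pn (n t) * n')) (at t within S)"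
  using s_pos[OF m(2) n(2)]
  by (auto intro!: derivative_eq_intros deriv_s deriv_sig simp: field_simps power2_eq_square)

lemma deriv_B:
  "((\<lambda>t. B (m t) (n t)) has_real_derivative Bm (m t) (n t) * m' + Bn (m t) (n t) * n') (at t within S)"
  unfolding B_def
  by (rule derivative_eq_intros deriv_s deriv_sig m refl)+ (simp add: Bm_def Bn_def algebra_simps)

lemma deriv_Bm:
  "((\<lambda>t. Bm (m t) (n t)) has_real_derivative Bmm (m t) (n t) * m' + Bmn (m t) (n t) * n') (at t within S)"
proof -
  define r where "r t = sig (m t) (n t) / s (m t) (n t)" for t
  have r: "(r has_real_derivative
     (kap - 1) * (sig (m t) (n t) / (s (m t) (n t))\<^sup>2) * (P / 2 * pm (m t) * m' + Q / 2 * pn (n t) * n')) (at t within S)"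
    unfolding r_def by (rule deriv_sig_div_s)
  show ?thesis
    unfolding Bm_def r_def[symmetric]
    by (rule derivative_eq_intros r deriv_sig deriv_pm m refl)+
       (simp add: Bmm_def Bmn_def r_def algebra_simps add_divide_distrib diff_divide_distrib)
qed

lemma deriv_Bn:
  "((\<lambda>t. Bn (m t) (n t)) has_real_derivative Bmn (m t) (n t) * m' + Bnn (m t) (n t) * n') (at t within S)"
proof -
  define r where "r t = sig (m t) (n t) / s (m t) (n t)" for t
  have r: "(r has_real_derivative
     (kap - 1) * (sig (m t) (n t) / (s (m t) (n t))\<^sup>2) * (P / 2 * pm (m t) * m' + Q / 2 * pn (n t) * n')) (at t within S)"
    unfolding r_def by (rule deriv_sig_div_s)
  show ?thesis
    unfolding Bn_def r_def[symmetric]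
    by (rule derivative_eq_intros r deriv_pn m n refl)+
       (simp add: Bmn_def Bnn_def r_def algebra_simps add_divide_distrib diff_divide_distrib)
qed

end

lemma continuous_on_B_derivs:
  assumes "continuous_on X m" "continuous_on X n" "\<And>x. x \<in> X \<Longrightarrow> 0 < m x" "\<And>x. x \<in> X \<Longrightarrow> 0 < n x"
  shows "continuous_on X (\<lambda>x. pm (m x))" "continuous_on X (\<lambda>x. pn (n x))"
    "continuous_on X (\<lambda>x. sig (m x) (n x))"
    "continuous_on X (\<lambda>x. sig (m x) (n x) / s (m x) (n x))"
    "continuous_on X (\<lambda>x. B (m x) (n x))"
    "continuous_on X (\<lambda>x. Bm (m x) (n x))" "continuous_on X (\<lambda>x. Bn (m x) (n x))"
    "continuous_on X (\<lambda>x. Bmm (m x) (n x))" "continuous_on X (\<lambda>x. Bmn (m x) (n x))"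
    "continuous_on X (\<lambda>x. Bnn (m x) (n x))"
proof -
  have pos: "m x \<noteq> 0" "n x \<noteq> 0" "s (m x) (n x) \<noteq> 0" if "x \<in> X" for x
    using assms(3,4)[OF that] s_pos[of "m x" "n x"] by auto
  show pm: "continuous_on X (\<lambda>x. pm (m x))" and pn: "continuous_on X (\<lambda>x. pn (n x))"
    unfolding pm_def pn_def using pos by (auto intro!: continuous_intros assms)
  have s: "continuous_on X (\<lambda>x. s (m x) (n x))"
    unfolding s_def using pos by (auto intro!: continuous_intros assms)
  show sig: "continuous_on X (\<lambda>x. sig (m x) (n x))"
    unfolding sig_def using pos by (auto intro!: continuous_intros assms s)
  show "continuous_on X (\<lambda>x. sig (m x) (n x) / s (m x) (n x))"
    using pos by (auto intro!: continuous_intros sig s)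
  show "continuous_on X (\<lambda>x. B (m x) (n x))" "continuous_on X (\<lambda>x. Bm (m x) (n x))"
    "continuous_on X (\<lambda>x. Bn (m x) (n x))" "continuous_on X (\<lambda>x. Bmm (m x) (n x))"
    "continuous_on X (\<lambda>x. Bmn (m x) (n x))" "continuous_on X (\<lambda>x. Bnn (m x) (n x))"
    unfolding B_def Bm_def Bn_def Bmm_def Bmn_def Bnn_def
    using pos by (auto intro!: continuous_intros sig s pm pn assms)
qed

section \<open>Pointwise bounds for the Bellman function\<close>

context
  fixes m n :: real
  assumes m: "0 < m" and n: "0 < n"
begin

lemma le_s: "m * pm m \<le> s m n" "n * pn n \<le> s m n"
  using s_alt[OF m n] m n pm_pos[OF m] pn_pos[OF n] by (simp_all add: less_imp_le)

text \<open>Drop m^(P/2) from \<open>s\<close>: then s^(-kap) is at most n^(-kap Q/2), and kap Q = 2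
  - Q makes the exponent Q/2 - 1.\<close>

lemma inverse_sig_le_pn: "1 / sig m n \<le> pn n"
proof -
  have eq: "(n powr (Q/2)) powr (- kap) = pn n"
  proof -
    have "Q / 2 * (- kap) = - (kap * Q) / 2" by simp
    also have "\<dots> = Q / 2 - 1" unfolding kap_Q by (simp add: field_simps)
    finally show ?thesis by (simp only: pn_def powr_powr)
  qed
  have "s m n powr (- kap) \<le> (n powr (Q/2)) powr (- kap)"
    using m n kap_bounds by (intro powr_mono2') (auto simp: s_def)
  then show ?thesis unfolding eq by (simp add: sig_def powr_minus_divide)
qed

text \<open>The ratio is s^(-2/P), and m = (m^(P/2))^(2/P) is at most s^(2/P).\<close>

lemma m_sig_le: "m * (sig m n / s m n) \<le> 1"
proof -
  have "(m powr (P/2)) powr (2/P) \<le> s m n powr (2/P)"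
    using m n P2 by (intro powr_mono2) (auto simp: s_def)
  moreover have "(m powr (P/2)) powr (2/P) = m"
    using m P2 by (simp add: powr_powr)
  moreover have "sig m n / s m n = s m n powr (- (2/P))"
    using s_pos[OF m n] by (simp add: sig_def kap_def powr_diff powr_minus field_simps)
  ultimately have "m * (sig m n / s m n) \<le> s m n powr (2/P) * s m n powr (- (2/P))"
    by (metis mult_right_mono powr_ge_zero)
  then show ?thesis
    using s_pos[OF m n] by (simp add: powr_minus)
qed

text \<open>Governs all mixed terms: these carry \<open>pn n\<close> times the ratio
  \<open>sig / s\<close>, while the directions contribute sqrt(m n). Both pn^2 n = n^(Q-1) and m are
  at most s^(2/P), which the two ratios cancel.\<close>

lemma cross_bound: "(pn n * (sig m n / s m n))\<^sup>2 * (m * n) \<le> 1"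
proof -
  have pn2: "(pn n)\<^sup>2 * n = (n powr (Q/2)) powr (2/P)"
  proof -
    have "(pn n)\<^sup>2 = n powr (Q - 2)"
      by (simp add: pn_def power2_eq_square powr_add[symmetric])
    then have "(pn n)\<^sup>2 * n = n powr (Q - 1)"
      using powr_add[of n "Q - 2" 1] n by simp
    moreover have "Q - 1 = Q/2 * (2/P)" using P2 by (simp add: Q_def field_simps)
    ultimately show ?thesis by (simp add: powr_powr)
  qed
  have sd: "sig m n / s m n = s m n powr (- (2/P))"
    using s_pos[OF m n] by (simp add: sig_def kap_def powr_diff powr_minus field_simps)
  have "(pn n)\<^sup>2 * n * (sig m n / s m n) \<le> 1"
  proof -
    have "(n powr (Q/2)) powr (2/P) \<le> s m n powr (2/P)"
      using m n P2 by (intro powr_mono2) (auto simp: s_def)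
    then show ?thesis
      using s_pos[OF m n] unfolding pn2 sd by (simp add: powr_minus field_simps)
  qed
  from mult_mono[OF this m_sig_le] show ?thesis
    using m sig_pos[OF m n] s_pos[OF m n] by (simp add: power2_eq_square algebra_simps)
qed

text \<open>With a = m^(P/2)/s \<le> 1 one has pm = a^kap \<open>sig\<close>, so the claim reduces
  to a^2 \<le> a^kap.\<close>

lemma pm_bound: "(m * pm m / s m n)\<^sup>2 * sig m n \<le> pm m"
proof -
  define a where "a = m powr (P/2) / s m n"
  have a: "0 < a" "a \<le> 1" using m n s_pos[OF m n] by (auto simp: a_def s_def)
  have mp: "m * pm m = m powr (P/2)" using powr_mult_base[of m "P/2-1"] m by (simp add: pm_def)
  have "pm m = (m powr (P/2)) powr kap"
  proof -
    have "P / 2 * kap = (kap * P) / 2" by simp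
    also have "\<dots> = P / 2 - 1" unfolding kap_P by (simp add: field_simps)
    finally show ?thesis by (simp only: pm_def powr_powr)
  qed
  also have "\<dots> = (a * s m n) powr kap" using s_pos[OF m n] by (simp add: a_def)
  also have "\<dots> = a powr kap * sig m n" by (simp add: sig_def powr_mult)
  finally have pm: "pm m = a powr kap * sig m n" .
  have "a\<^sup>2 \<le> a powr kap"
    using powr_mono'[of kap 2 a] a kap_bounds by simp
  then show ?thesis
    unfolding mp a_def[symmetric] unfolding pm using sig_pos[OF m n] by simp
qed

lemma Bm_lower: "P / 2 * pm m + gam * sig m n \<le> Bm m n" and Bm_nonneg: "0 \<le> Bm m n"
  and sig_le_Bm: "gam * sig m n \<le> 2 * Bm m n"
proof -
  have "0 \<le> kap * m * (sig m n / s m n) * (P / 2 * pm m)"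
    using kap_bounds m P2 sig_pos[OF m n] s_pos[OF m n] pm_pos[OF m] by simp
  then have "0 \<le> gam * (kap * m * (sig m n / s m n) * (P / 2 * pm m))"
    using gam_pos by (simp only: zero_le_mult_iff less_imp_le simp_thms)
  then show *: "P / 2 * pm m + gam * sig m n \<le> Bm m n"
    unfolding Bm_def distrib_left by linarith
  have "0 \<le> P / 2 * pm m" "0 \<le> gam * sig m n"
    using P2 pm_pos[OF m] gam_pos sig_pos[OF m n] by auto
  with * show "0 \<le> Bm m n" "gam * sig m n \<le> 2 * Bm m n" by linarith+
qed

text \<open>The negative contribution comes from kap - 1. Because (kap - 1) P = -2 it amounts to -a
  with a = m pm / s \<le> 1, which 1 + P/2 outweighs.\<close>

lemma Bmm_nonneg: "0 \<le> Bmm m n"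
proof -
  define a where "a = m * pm m / s m n"
  have a: "0 \<le> a" "a \<le> 1"
    using le_s(1) m pm_pos[OF m] s_pos[OF m n] by (auto simp: a_def)
  have "Bmm m n = P / 2 * ((P / 2 - 1) * (pm m / m))
     + gam * kap * (sig m n / s m n) * (P / 2 * pm m) * (2 + (P / 2 - 1) + ((kap - 1) * P) / 2 * a)"
    unfolding Bmm_def a_def using m s_pos[OF m n] by (simp add: field_simps power2_eq_square)
  also have "\<dots> = P / 2 * ((P / 2 - 1) * (pm m / m))
     + gam * kap * (sig m n / s m n) * (P / 2 * pm m) * (1 + P / 2 - a)"
    unfolding kap1_P by simp
  also have "0 \<le> \<dots>"
    using a P2 m pm_pos[OF m] gam_pos kap_bounds sig_pos[OF m n] s_pos[OF m n] by simp
  finally show ?thesis .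
qed

lemma Bmn_alt: "Bmn m n = gam * (2 - Q) / 2 * pn n * (sig m n / s m n) * (1 - m * pm m / s m n)"
proof -
  have "Bmn m n = gam * (kap * Q) / 2 * pn n * (sig m n / s m n) * (1 + (kap - 1) * P / 2 * (m * pm m / s m n))"
    unfolding Bmn_def using s_pos[OF m n] by (simp add: field_simps power2_eq_square)
  then show ?thesis unfolding kap_Q kap1_P by simp
qed

text \<open>In \<open>Bmn_alt\<close> the factors 2 - Q and 1 - m pm / s lie in [0, 1];
  \<open>cross_bound\<close> handles the rest.\<close>

lemma Bmn_bound: "(Bmn m n)\<^sup>2 * (m * n) \<le> (gam / 2)\<^sup>2"
proof -
  define b where "b = (2 - Q) * (1 - m * pm m / s m n)"
  have "0 \<le> 1 - m * pm m / s m n" "1 - m * pm m / s m n \<le> 1"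
    using le_s(1) m pm_pos[OF m] s_pos[OF m n] by auto
  then have b: "0 \<le> b" "b \<le> 1" using Q_bounds unfolding b_def
    by (auto intro: mult_le_one)
  have "(Bmn m n)\<^sup>2 * (m * n) = (gam / 2)\<^sup>2 * (b\<^sup>2 * ((pn n * (sig m n / s m n))\<^sup>2 * (m * n)))"
    unfolding Bmn_alt b_def by (simp add: power_mult_distrib power_divide)
  also have "\<dots> \<le> (gam / 2)\<^sup>2 * (1 * 1)"
    using b cross_bound m n by (intro mult_left_mono mult_mono) (auto simp: power_le_one)
  finally show ?thesis by simp
qed

lemma Bn_lower: "Q / 2 * pn n \<le> Bn m n" and Bn_nonneg: "0 \<le> Bn m n"
proof -
  have "0 \<le> gam * kap * m * (sig m n / s m n)"
    using m gam_pos kap_bounds sig_pos[OF m n] s_pos[OF m n] by simp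
  moreover have "0 \<le> Q / 2 * pn n" using Q_bounds pn_pos[OF n] by simp
  ultimately show *: "Q / 2 * pn n \<le> Bn m n"
    unfolding Bn_def by (metis le_add_same_cancel1 mult.right_neutral mult_left_mono)
  with \<open>0 \<le> Q / 2 * pn n\<close> show "0 \<le> Bn m n" by linarith
qed

text \<open>Since Q \<le> 2, \<open>Bnn\<close> is not positive, and the second-order term has to be
  paid for by \<open>Bn\<close>. The number \<rho> measures p2 against n E. With \<rho> = 1 the
  margin is (7/8)(Q - 1) = 14 gam; the sharper \<rho> = u^2/n is kept exact in
  \<open>quadratic_form_small\<close>, where the null Lagrangian produces the same quotient. The
  loss (Q - 1)/8 stems from gam \<le> 1/16.\<close>

lemma n_part_lower:
  assumes "0 \<le> E" "p2 \<le> \<rho> * n * E" "0 \<le> p2" "0 \<le> \<rho>" "\<rho> \<le> 1"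
  shows "Q * pn n * E * (1 - (2 - Q) * \<rho> - (Q - 1) / 8) \<le> 2 * Bn m n * E + 4 * Bnn m n * p2"
proof -
  define r where "r = kap * (m * (sig m n / s m n))"
  define b where "b = n * pn n / s m n"
  have r: "0 \<le> r" "r \<le> 1"
    using mult_mono[of kap 1 "m * (sig m n / s m n)" 1] m_sig_le m kap_bounds sig_pos[OF m n] s_pos[OF m n]
    unfolding r_def by simp_all
  have b: "0 \<le> b" "b \<le> 1" using le_s(2) n pn_pos[OF n] s_pos[OF m n] by (auto simp: b_def)
  have "Bnn m n = Q / 2 * (pn n / n) * ((Q / 2 - 1) * (1 + gam * r) + gam * r * b * ((kap - 1) * Q / 2))"
    unfolding Bnn_def r_def b_def using n s_pos[OF m n] by (simp add: field_simps power2_eq_square)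
  then have Bnn: "Bnn m n = - (Q / 2 * (pn n / n) * ((1 - Q / 2) * (1 + gam * r) + gam * r * b * (Q - 1)))"
    unfolding kap1_Q by (simp add: algebra_simps add_divide_distrib diff_divide_distrib)
  have Bn: "Bn m n = Q / 2 * pn n * (1 + gam * r)"
    unfolding Bn_def r_def by (simp add: algebra_simps)
  define K where "K = Q / 2 * (pn n / n) * ((1 - Q / 2) * (1 + gam * r) + gam * r * b * (Q - 1))"
  have "0 \<le> K" unfolding K_def using Q_bounds r b gam_pos n pn_pos[OF n] by auto
  then have "K * p2 \<le> K * (\<rho> * n * E)" using assms by (intro mult_left_mono) auto
  then have 1: "2 * Bn m n * E + 4 * Bnn m n * p2 \<ge> 2 * Bn m n * E - 4 * (K * (\<rho> * n * E))"
    unfolding Bnn K_def[symmetric] by simp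
  have "2 * Bn m n * E - 4 * (K * (\<rho> * n * E))
     = Q * pn n * E * ((1 + gam * r) - \<rho> * ((2 - Q) * (1 + gam * r) + 2 * (gam * r * b * (Q - 1))))"
    unfolding K_def Bn using n by (simp add: field_simps)
  moreover have "1 - (2 - Q) * \<rho> - (Q - 1) / 8
     \<le> (1 + gam * r) - \<rho> * ((2 - Q) * (1 + gam * r) + 2 * (gam * r * b * (Q - 1)))"
  proof -
    have gr: "0 \<le> gam * r" "gam * r \<le> 1/16" using r gam_pos gam_le mult_mono[of gam "1/16" r 1] by auto
    have "\<rho> * (gam * r * b * (Q - 1)) \<le> 1 * ((1/16) * 1 * (Q - 1))"
      using assms gr b Q_bounds r gam_pos by (intro mult_mono) auto
    moreover have "\<rho> * ((2 - Q) * (gam * r)) \<le> 1 * (1 * (gam * r))"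
      using assms gr Q_bounds r gam_pos by (intro mult_mono) auto
    moreover have "(1 + gam * r) - \<rho> * ((2 - Q) * (1 + gam * r) + 2 * (gam * r * b * (Q - 1)))
      = 1 - (2 - Q) * \<rho> + gam * r - \<rho> * ((2 - Q) * (gam * r)) - 2 * (\<rho> * (gam * r * b * (Q - 1)))"
      by (simp add: algebra_simps)
    ultimately show ?thesis by linarith
  qed
  ultimately have "Q * pn n * E * (1 - (2 - Q) * \<rho> - (Q - 1) / 8) \<le> 2 * Bn m n * E - 4 * (K * (\<rho> * n * E))"
    using assms(1) Q_bounds pn_pos[OF n] by (simp add: mult_left_mono)
  with 1 show ?thesis by linarith
qed

text \<open>The hypotheses bound |x p| by sqrt(m n) X E, and \<open>Bmn_bound\<close> bounds |Bmn|
  sqrt(m n) by gam/2.\<close>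

lemma cross_lower:
  assumes "x\<^sup>2 \<le> m * X\<^sup>2" "p\<^sup>2 \<le> n * E\<^sup>2" "0 \<le> X" "0 \<le> E"
  shows "- (4 * gam * X * E) \<le> 8 * Bmn m n * x * p"
proof -
  have "(Bmn m n * (x * p))\<^sup>2 = (Bmn m n)\<^sup>2 * (x\<^sup>2 * p\<^sup>2)" by (simp add: power_mult_distrib)
  also have "\<dots> \<le> (Bmn m n)\<^sup>2 * ((m * X\<^sup>2) * (n * E\<^sup>2))"
    using assms m n by (intro mult_left_mono mult_mono) auto
  also have "\<dots> = (Bmn m n)\<^sup>2 * (m * n) * (X * E)\<^sup>2" by (simp add: power_mult_distrib)
  also have "\<dots> \<le> (gam / 2)\<^sup>2 * (X * E)\<^sup>2"
    by (intro mult_right_mono Bmn_bound) auto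
  also have "\<dots> = (gam / 2 * (X * E))\<^sup>2" by (simp only: power_mult_distrib)
  finally have "\<bar>Bmn m n * (x * p)\<bar> \<le> gam / 2 * (X * E)"
    using assms gam_pos by (metis abs_le_square_iff abs_of_nonneg divide_nonneg_nonneg less_imp_le mult_nonneg_nonneg zero_le_numeral)
  then show ?thesis by (simp add: algebra_simps)
qed

end


section \<open>Lower bounds for the quadratic forms: u in the slot of exponent P (large), then of
  exponent Q (small)\<close>

lemma quadratic_form_large:
  assumes "0 < e" "0 \<le> N" "0 \<le> E" "p\<^sup>2 \<le> N * E" "m = e + u\<^sup>2" "n = e + N"
  shows "P * pm m * \<xi>\<^sup>2 + 2 * gam * sig m n * \<xi>\<^sup>2 - 4 * gam * \<bar>\<xi>\<bar> * sqrt E + 14 * gam * (E / sig m n)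
    \<le> 2 * Bm m n * \<xi>\<^sup>2 + 2 * Bn m n * E + 4 * Bmm m n * (u * \<xi>)\<^sup>2 + 8 * Bmn m n * (u * \<xi>) * p + 4 * Bnn m n * p\<^sup>2"
proof -
  have m: "0 < m" and n: "0 < n" using assms by (auto intro: add_pos_nonneg)
  have 1: "(P * pm m + 2 * gam * sig m n) * \<xi>\<^sup>2 \<le> 2 * Bm m n * \<xi>\<^sup>2"
    using Bm_lower[OF m n] by (intro mult_right_mono) auto
  have 2: "0 \<le> 4 * Bmm m n * (u * \<xi>)\<^sup>2" using Bmm_nonneg[OF m n] by simp
  have NE: "N * E \<le> n * E" using assms by (simp add: mult_right_mono)
  have 3: "- (4 * gam * \<bar>\<xi>\<bar> * sqrt E) \<le> 8 * Bmn m n * (u * \<xi>) * p"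
    using assms(1,2,3,5) order_trans[OF assms(4) NE]
    by (intro cross_lower[OF m n]) (auto simp: power_mult_distrib mult_right_mono)
  have "Q * pn n * E * (1 - (2 - Q) * 1 - (Q - 1) / 8) \<le> 2 * Bn m n * E + 4 * Bnn m n * p\<^sup>2"
    using assms NE by (intro n_part_lower[OF m n]) auto
  moreover have "Q * pn n * E * (1 - (2 - Q) * 1 - (Q - 1) / 8) = 14 * gam * (Q * (pn n * E))"
    using Q_minus by (simp add: algebra_simps)
  moreover have "14 * gam * (E / sig m n) \<le> 14 * gam * (Q * (pn n * E))"
  proof -
    have "E / sig m n \<le> pn n * E"
      using mult_right_mono[OF inverse_sig_le_pn[OF m n] assms(3)] by simp
    also have "\<dots> \<le> Q * (pn n * E)"
      using mult_right_mono[of 1 Q "pn n * E"] Q_bounds pn_pos[OF n] assms(3) by simp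
    finally show ?thesis using gam_pos by (intro mult_left_mono) auto
  qed
  ultimately have 4: "14 * gam * (E / sig m n) \<le> 2 * Bn m n * E + 4 * Bnn m n * p\<^sup>2" by linarith
  from 1 2 3 4 show ?thesis unfolding distrib_right by linarith
qed


text \<open>Here u occupies the slot n of exponent Q, so the direction with negative second
  derivative is that of u itself, and w enjoys the weight \<open>sig\<close>.\<close>

lemma quadratic_form_small:
  assumes "0 < e" "0 \<le> N" "0 \<le> E" "p\<^sup>2 \<le> N * E" "m = e + N" "n = e + u\<^sup>2"
  shows "Q * pn n * \<xi>\<^sup>2 * (1 - (2 - Q) * (u\<^sup>2 / n) - (Q - 1) / 8) + 2 * gam * sig m n * E - 4 * gam * \<bar>\<xi>\<bar> * sqrt E
    \<le> 2 * Bn m n * \<xi>\<^sup>2 + 2 * Bm m n * E + 4 * Bnn m n * (u * \<xi>)\<^sup>2 + 8 * Bmn m n * (u * \<xi>) * p + 4 * Bmm m n * p\<^sup>2"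
proof -
  have m: "0 < m" and n: "0 < n" using assms by (auto intro: add_pos_nonneg)
  have NE: "N * E \<le> m * E" using assms by (simp add: mult_right_mono)
  have "0 \<le> P / 2 * pm m" using P2 pm_pos[OF m] by simp
  then have 1: "2 * gam * sig m n * E \<le> 2 * Bm m n * E"
    using Bm_lower[OF m n] assms(3) by (intro mult_right_mono) auto
  have 2: "0 \<le> 4 * Bmm m n * p\<^sup>2" using Bmm_nonneg[OF m n] by simp
  have 3: "- (4 * gam * sqrt E * \<bar>\<xi>\<bar>) \<le> 8 * Bmn m n * p * (u * \<xi>)"
    using assms(1,2,3,6) order_trans[OF assms(4) NE]
    by (intro cross_lower[OF m n]) (auto simp: power_mult_distrib mult_right_mono)
  have 4: "Q * pn n * \<xi>\<^sup>2 * (1 - (2 - Q) * (u\<^sup>2 / n) - (Q - 1) / 8)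
    \<le> 2 * Bn m n * \<xi>\<^sup>2 + 4 * Bnn m n * (u * \<xi>)\<^sup>2"
    using assms(1,6) n by (intro n_part_lower[OF m n]) (auto simp: power_mult_distrib)
  have "8 * Bmn m n * p * (u * \<xi>) = 8 * Bmn m n * (u * \<xi>) * p"
    "4 * gam * sqrt E * \<bar>\<xi>\<bar> = 4 * gam * \<bar>\<xi>\<bar> * sqrt E" by simp_all
  with 1 2 3 4 show ?thesis by linarith
qed

text \<open>In the scale z = sqrt E / sig the available form is 2 (|\<xi>| - z)^2 + 12 z^2, which is
  at least 8 z^2; the term with \<open>pm\<close> is discarded.\<close>

lemma time_large:
  assumes "0 < e" "0 \<le> N" "0 \<le> E" "p\<^sup>2 \<le> N * E" "m = e + u\<^sup>2" "n = e + N"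
  shows "8 * gam / sig m n * E
    \<le> 2 * Bm m n * \<xi>\<^sup>2 + 2 * Bn m n * E + 4 * Bmm m n * (u * \<xi>)\<^sup>2 + 8 * Bmn m n * (u * \<xi>) * p + 4 * Bnn m n * p\<^sup>2"
proof -
  have m: "0 < m" and n: "0 < n" using assms by (auto intro: add_pos_nonneg)
  define z where "z = sqrt E / sig m n"
  have sg: "0 < sig m n" by (rule sig_pos[OF m n])
  have E: "E / sig m n = sig m n * z\<^sup>2" "sqrt E = sig m n * z"
    using sg assms(3) by (auto simp: z_def power2_eq_square field_simps)
  have "0 \<le> P * pm m * \<xi>\<^sup>2" using P2 pm_pos[OF m] by simp
  moreover have "8 * gam / sig m n * E \<le> 2 * gam * sig m n * \<xi>\<^sup>2 - 4 * gam * \<bar>\<xi>\<bar> * sqrt E + 14 * gam * (E / sig m n)"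
  proof -
    have "0 \<le> 2 * (\<bar>\<xi>\<bar> - z)\<^sup>2 + 4 * z\<^sup>2" by simp
    then have "8 * z\<^sup>2 \<le> 2 * \<xi>\<^sup>2 - 4 * \<bar>\<xi>\<bar> * z + 14 * z\<^sup>2"
      by (simp add: power2_diff algebra_simps)
    from mult_left_mono[OF this, of "gam * sig m n"]
    have *: "gam * sig m n * (8 * z\<^sup>2) \<le> gam * sig m n * (2 * \<xi>\<^sup>2 - 4 * \<bar>\<xi>\<bar> * z + 14 * z\<^sup>2)"
      using sg gam_pos by simp
    show ?thesis
    proof -
      have "8 * gam / sig m n * E = 8 * gam * (E / sig m n)" by simp
      then show ?thesis
        unfolding E using * by (simp add: algebra_simps)
    qed
  qed
  ultimately show ?thesis using quadratic_form_large[OF assms, of \<xi>] by linarith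
qed

text \<open>The null Lagrangian of q u^2 g with g = gam \<open>sig\<close> supplies the cross term 2
  gam sig \<xi> q u that is needed for a multiple of (\<xi> + q u)^2. The derivatives of
  \<open>sig\<close> are errors: the one in m is absorbed by P pm \<xi>^2 and 1/32 of gam sig (q
  u)^2, the one in n by part of the reserve 14 gam E / sig.\<close>

lemma space_large:
  assumes "0 < e" "0 \<le> N" "0 \<le> E" "p\<^sup>2 \<le> N * E" "m = e + u\<^sup>2" "n = e + N"
  shows "gam / 2 * sig m n * (\<xi> + q * u)\<^sup>2
    \<le> 2 * Bm m n * \<xi>\<^sup>2 + 2 * Bn m n * E + 4 * Bmm m n * (u * \<xi>)\<^sup>2 + 8 * Bmn m n * (u * \<xi>) * p + 4 * Bnn m n * p\<^sup>2
      + q * (2 * u * \<xi> * (gam * sig m n)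
         + u\<^sup>2 * (gam * (kap * (sig m n / s m n) * (P / 2 * pm m)) * (2 * (u * \<xi>))
                + gam * (kap * (sig m n / s m n) * (Q / 2 * pn n)) * (2 * p)))
      + q\<^sup>2 * u\<^sup>2 * (gam * sig m n)"
proof -
  have m: "0 < m" and n: "0 < n" using assms by (auto intro: add_pos_nonneg)
  define z where "z = sqrt E / sig m n"
  define y where "y = q * u"
  define a where "a = m * pm m / s m n"
  have sg: "0 < sig m n" by (rule sig_pos[OF m n])
  have sp: "0 < s m n" by (rule s_pos[OF m n])
  have E: "E / sig m n = sig m n * z\<^sup>2" "sqrt E = sig m n * z" "0 \<le> z"
    using sg assms(3) by (auto simp: z_def power2_eq_square field_simps)
  have u2: "u\<^sup>2 \<le> m" using assms by simp
  have pmp: "0 < pm m" "0 < pn n" using pm_pos[OF m] pn_pos[OF n] by auto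

  have t1: "- (P * pm m * \<xi>\<^sup>2 + gam * sig m n * y\<^sup>2 / 32)
     \<le> q * (u\<^sup>2 * (gam * (kap * (sig m n / s m n) * (P / 2 * pm m)) * (2 * (u * \<xi>))))"
  proof -
    define b where "b = gam * (P - 2) * (u\<^sup>2 * pm m / s m n) * sig m n"
    have b0: "0 \<le> b" using gam_pos P2 pmp sp sg by (simp add: b_def)
    have "u\<^sup>2 * pm m / s m n \<le> a"
      unfolding a_def using u2 pmp sp by (intro divide_right_mono mult_right_mono) auto
    then have "b \<le> gam * P * a * sig m n"
      unfolding b_def using gam_pos P2 pmp sp sg m by (intro mult_mono) (auto simp: a_def)
    then have "b\<^sup>2 \<le> (gam * P * a * sig m n)\<^sup>2" using b0 by (intro power_mono)
    also have "\<dots> = (gam * P)\<^sup>2 * sig m n * (a\<^sup>2 * sig m n)" by (simp add: power2_eq_square)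
    also have "\<dots> \<le> (gam * P)\<^sup>2 * sig m n * pm m"
      using pm_bound[OF m n] sg unfolding a_def by (intro mult_left_mono) auto
    also have "\<dots> = (P * gam) * (P * pm m * (gam * sig m n))" by (simp add: power2_eq_square)
    also have "\<dots> \<le> (1/8) * (P * pm m * (gam * sig m n))"
      using P_gam Q_bounds P2 pmp gam_pos sg by (intro mult_right_mono) auto
    finally have b2: "b\<^sup>2 \<le> 4 * (P * pm m) * (gam * sig m n / 32)" by (simp add: mult_ac)
    have "0 \<le> P * pm m * \<xi>\<^sup>2 + b * \<xi> * y + (gam * sig m n / 32) * y\<^sup>2"
      using b2 P2 pmp gam_pos sg by (intro weighted_AMGM) auto
    moreover have "q * (u\<^sup>2 * (gam * (kap * (sig m n / s m n) * (P / 2 * pm m)) * (2 * (u * \<xi>)))) = b * \<xi> * y"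
      unfolding b_def y_def kap_P[symmetric] by simp
    ultimately show ?thesis by simp
  qed
  have t2: "- (gam * sig m n * (\<bar>y\<bar> * z))
     \<le> q * (u\<^sup>2 * (gam * (kap * (sig m n / s m n) * (Q / 2 * pn n)) * (2 * p)))"
  proof -
    define w where "w = u * p * (pn n * (sig m n / s m n))"
    have "w\<^sup>2 = (u\<^sup>2 * p\<^sup>2) * (pn n * (sig m n / s m n))\<^sup>2" unfolding w_def power_mult_distrib ..
    also have "\<dots> \<le> (m * (n * E)) * (pn n * (sig m n / s m n))\<^sup>2"
    proof -
      have "N * E \<le> n * E" using assms by (intro mult_right_mono) auto
      with assms(4) have "p\<^sup>2 \<le> n * E" by (rule order_trans)
      then show ?thesis using u2 m by (intro mult_right_mono mult_mono) auto
    qed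
    also have "\<dots> = (pn n * (sig m n / s m n))\<^sup>2 * (m * n) * E" by simp
    also have "\<dots> \<le> 1 * E" by (intro mult_right_mono cross_bound[OF m n] assms)
    finally have "\<bar>w\<bar> \<le> sqrt E" by (simp add: real_le_rsqrt)
    then have w: "\<bar>w\<bar> \<le> sig m n * z" unfolding E(2) .
    have "q * (u\<^sup>2 * (gam * (kap * (sig m n / s m n) * (Q / 2 * pn n)) * (2 * p))) = gam * (2 - Q) * (y * w)"
      unfolding kap_Q[symmetric] y_def w_def by (simp add: power2_eq_square)
    moreover have "\<bar>gam * (2 - Q) * (y * w)\<bar> \<le> gam * 1 * (\<bar>y\<bar> * (sig m n * z))"
      unfolding abs_mult using gam_pos Q_bounds w by (intro mult_mono) auto
    ultimately show ?thesis by (simp add: abs_le_iff algebra_simps)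
  qed
  \<comment> \<open>After the left side is subtracted, split 3/2 = 2/5 + 11/10 for \<xi>^2, 15/32 =
    1/16 + 13/32 for y^2 and 14 = 10 + 4 for z^2; the three resulting binary forms are
    nonnegative.\<close>
  have poly: "1/2 * (\<xi> + y)\<^sup>2 \<le> 2 * \<xi>\<^sup>2 + 2 * \<xi> * y + y\<^sup>2 - y\<^sup>2 / 32 - 4 * \<bar>\<xi>\<bar> * z - \<bar>y\<bar> * z + 14 * z\<^sup>2"
  proof -
    have "0 \<le> (2/5) * \<bar>\<xi>\<bar>\<^sup>2 + (-4) * \<bar>\<xi>\<bar> * z + 10 * z\<^sup>2" by (rule weighted_AMGM) auto
    moreover have "0 \<le> (1/16) * \<bar>y\<bar>\<^sup>2 + (-1) * \<bar>y\<bar> * z + 4 * z\<^sup>2" by (rule weighted_AMGM) auto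
    moreover have "0 \<le> (11/10) * \<xi>\<^sup>2 + 1 * \<xi> * y + (13/32) * y\<^sup>2" by (rule weighted_AMGM) auto
    ultimately show ?thesis by (simp add: power2_sum algebra_simps)
  qed
  have "gam / 2 * sig m n * (\<xi> + y)\<^sup>2 \<le> 2 * gam * sig m n * \<xi>\<^sup>2 + 2 * (gam * sig m n) * (\<xi> * y)
      + gam * sig m n * y\<^sup>2 - gam * sig m n * y\<^sup>2 / 32 - 4 * gam * \<bar>\<xi>\<bar> * sqrt E - gam * sig m n * (\<bar>y\<bar> * z) + 14 * gam * (E / sig m n)"
    using mult_left_mono[OF poly, of "gam * sig m n"] sg gam_pos unfolding E(2) E(1) by (simp add: algebra_simps)
  moreover have "q * (2 * u * \<xi> * (gam * sig m n)) = 2 * (gam * sig m n) * (\<xi> * y)"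
    "q\<^sup>2 * u\<^sup>2 * (gam * sig m n) = gam * sig m n * y\<^sup>2"
    by (simp_all add: y_def power_mult_distrib)
  ultimately show ?thesis
    using t1 t2 quadratic_form_large[OF assms, of \<xi>] unfolding distrib_left y_def[symmetric] by linarith
qed

text \<open>Although \<open>Bnn\<close> is not positive, the direction of u retains 14 gam \<xi>^2 /
  sig. This absorbs the mixed term at the cost of half of 2 gam sig E.\<close>

lemma time_small:
  assumes "0 < e" "0 \<le> N" "0 \<le> E" "p\<^sup>2 \<le> N * E" "m = e + N" "n = e + u\<^sup>2"
  shows "gam * sig m n * E
    \<le> 2 * Bn m n * \<xi>\<^sup>2 + 2 * Bm m n * E + 4 * Bnn m n * (u * \<xi>)\<^sup>2 + 8 * Bmn m n * (u * \<xi>) * p + 4 * Bmm m n * p\<^sup>2"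
proof -
  have m: "0 < m" and n: "0 < n" using assms by (auto intro: add_pos_nonneg)
  have sg: "0 < sig m n" by (rule sig_pos[OF m n])
  have "u\<^sup>2 / n \<le> 1" using assms(1,6) n by simp
  then have "(2 - Q) * (u\<^sup>2 / n) \<le> 2 - Q" using Q_bounds mult_left_mono[of "u\<^sup>2 / n" 1 "2 - Q"] by simp
  then have h: "14 * gam \<le> 1 - (2 - Q) * (u\<^sup>2 / n) - (Q - 1) / 8" using Q_minus by simp
  have "14 * gam / sig m n * \<xi>\<^sup>2 \<le> Q * pn n * \<xi>\<^sup>2 * (1 - (2 - Q) * (u\<^sup>2 / n) - (Q - 1) / 8)"
  proof -
    have "1 / sig m n \<le> Q * pn n"
      using mult_mono[of 1 Q "1 / sig m n" "pn n"] inverse_sig_le_pn[OF m n] Q_bounds sg by simp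
    then have "(1 / sig m n * \<xi>\<^sup>2) * (14 * gam) \<le> Q * pn n * \<xi>\<^sup>2 * (1 - (2 - Q) * (u\<^sup>2 / n) - (Q - 1) / 8)"
      using h gam_pos Q_bounds pn_pos[OF n] by (intro mult_mono) auto
    then show ?thesis by (simp add: mult_ac)
  qed
  moreover have "0 \<le> (14 * gam / sig m n) * \<bar>\<xi>\<bar>\<^sup>2 + (- 4 * gam) * \<bar>\<xi>\<bar> * sqrt E + (gam * sig m n) * (sqrt E)\<^sup>2"
    using sg gam_pos by (intro weighted_AMGM) (auto simp: power2_eq_square)
  ultimately show ?thesis
    using quadratic_form_small[OF assms, of \<xi>] assms(3) by simp
qed

text \<open>Put k = Q - 1, h = 1 - (2 - Q) u^2/n and y = q u. The density g = 8 gam Q pn is chosen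
  so that its derivative produces the same h as the second derivative of n^(Q/2). After division by
  Q pn the form is (h - k/4) \<xi>^2 + (k/2)(1 + h) \<xi> y + (k/2) y^2, where k/8 of \<xi>^2 has
  been spent on the mixed term with w; it dominates (k/4)(\<xi> + y)^2 because k \<le> h \<le>
  1.\<close>

lemma space_small:
  assumes "0 < e" "0 \<le> N" "0 \<le> E" "p\<^sup>2 \<le> N * E" "m = e + N" "n = e + u\<^sup>2"
  shows "4 * gam / sig m n * (\<xi> + q * u)\<^sup>2
    \<le> 2 * Bn m n * \<xi>\<^sup>2 + 2 * Bm m n * E + 4 * Bnn m n * (u * \<xi>)\<^sup>2 + 8 * Bmn m n * (u * \<xi>) * p + 4 * Bmm m n * p\<^sup>2
      + q * (2 * u * \<xi> * (8 * gam * Q * pn n)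
             + u\<^sup>2 * (8 * gam * Q * ((Q / 2 - 1) * (pn n / n)) * (2 * (u * \<xi>))))
      + q\<^sup>2 * u\<^sup>2 * (8 * gam * Q * pn n)"
proof -
  have m: "0 < m" and n: "0 < n" using assms by (auto intro: add_pos_nonneg)
  have sg: "0 < sig m n" by (rule sig_pos[OF m n])
  define y where "y = q * u"
  define k where "k = Q - 1"
  define h where "h = 1 - (2 - Q) * (u\<^sup>2 / n)"
  have k: "0 < k" "k \<le> 1" "16 * gam = k" using Q_bounds Q_minus by (auto simp: k_def)
  have "u\<^sup>2 / n \<le> 1" using assms(1,6) n by simp
  then have "(2 - Q) * (u\<^sup>2 / n) \<le> 2 - Q" using Q_bounds mult_left_mono[of "u\<^sup>2 / n" 1 "2 - Q"] by simp
  moreover have "0 \<le> (2 - Q) * (u\<^sup>2 / n)" using Q_bounds n by simp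
  ultimately have h: "k \<le> h" "h \<le> 1" by (auto simp: h_def k_def)
  have R: "1 / sig m n \<le> Q * pn n"
    using mult_mono[of 1 Q "1 / sig m n" "pn n"] inverse_sig_le_pn[OF m n] Q_bounds sg by simp
  have cross: "4 * gam * \<bar>\<xi>\<bar> * sqrt E \<le> 2 * gam * sig m n * E + Q * pn n * (k / 8 * \<xi>\<^sup>2)"
  proof -
    have "0 \<le> (2 * gam / sig m n) * \<bar>\<xi>\<bar>\<^sup>2 + (- 4 * gam) * \<bar>\<xi>\<bar> * sqrt E + (2 * gam * sig m n) * (sqrt E)\<^sup>2"
      using sg gam_pos by (intro weighted_AMGM) (auto simp: power2_eq_square)
    moreover have "1 / sig m n * (k / 8 * \<xi>\<^sup>2) \<le> Q * pn n * (k / 8 * \<xi>\<^sup>2)"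
      using R k by (intro mult_right_mono) auto
    moreover have "1 / sig m n * (k / 8 * \<xi>\<^sup>2) = 2 * gam / sig m n * \<bar>\<xi>\<bar>\<^sup>2"
      unfolding k(3)[symmetric] by simp
    moreover have "(sqrt E)\<^sup>2 = E" using assms(3) by simp
    ultimately show ?thesis by (smt (verit, best) mult_minus_left)
  qed
  have "k / 4 * (\<xi> + y)\<^sup>2 \<le> (h - k / 4) * \<xi>\<^sup>2 + k / 2 * (1 + h) * (\<xi> * y) + k / 2 * y\<^sup>2"
  proof -
    have "(k * h / 2)\<^sup>2 \<le> 4 * (h - k / 2) * (k / 4)"
    proof -
      have "k * h * h \<le> 1 * 1 * h" using k h by (intro mult_mono) auto
      then have "k * (k * h * h) \<le> k * h" using k by simp
      moreover have "k * k \<le> k * h" using k h by simp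
      moreover have "(k * h / 2)\<^sup>2 = k * (k * h * h) / 4" "4 * (h - k / 2) * (k / 4) = k * h - k * k / 2"
        by (simp_all add: power2_eq_square algebra_simps)
      moreover have "0 \<le> k * h" using k h by simp
      ultimately show ?thesis by linarith
    qed
    then have "0 \<le> (h - k / 2) * \<xi>\<^sup>2 + (k * h / 2) * \<xi> * y + (k / 4) * y\<^sup>2"
      using k h by (intro weighted_AMGM) auto
    moreover have "(h - k / 4) * \<xi>\<^sup>2 + k / 2 * (1 + h) * (\<xi> * y) + k / 2 * y\<^sup>2 - k / 4 * (\<xi> + y)\<^sup>2
      = (h - k / 2) * \<xi>\<^sup>2 + (k * h / 2) * \<xi> * y + (k / 4) * y\<^sup>2"
      by (simp add: power2_eq_square field_simps)
    ultimately show ?thesis by linarith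
  qed
  from mult_left_mono[OF this, of "Q * pn n"]
  have 1: "Q * pn n * (k / 4 * (\<xi> + y)\<^sup>2)
     \<le> Q * pn n * ((h - k / 4) * \<xi>\<^sup>2 + k / 2 * (1 + h) * (\<xi> * y) + k / 2 * y\<^sup>2)"
    using Q_bounds pn_pos[OF n] by simp
  have 2: "4 * gam / sig m n * (\<xi> + y)\<^sup>2 \<le> Q * pn n * (k / 4 * (\<xi> + y)\<^sup>2)"
  proof -
    have "1 / sig m n * (k / 4 * (\<xi> + y)\<^sup>2) \<le> Q * pn n * (k / 4 * (\<xi> + y)\<^sup>2)"
      using R k by (intro mult_right_mono) auto
    then show ?thesis unfolding k(3)[symmetric] by (simp add: mult_ac)
  qed
  have "q * (2 * u * \<xi> * (8 * gam * Q * pn n) + u\<^sup>2 * (8 * gam * Q * ((Q / 2 - 1) * (pn n / n)) * (2 * (u * \<xi>))))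
      = Q * pn n * (k / 2 * (1 + h) * (\<xi> * y))"
    unfolding h_def y_def k(3)[symmetric] using n by (simp add: field_simps power2_eq_square)
  moreover have "q\<^sup>2 * u\<^sup>2 * (8 * gam * Q * pn n) = Q * pn n * (k / 2 * y\<^sup>2)"
    unfolding y_def k(3)[symmetric] by (simp add: power_mult_distrib)
  moreover have "Q * pn n * \<xi>\<^sup>2 * (1 - (2 - Q) * (u\<^sup>2 / n) - (Q - 1) / 8)
     = Q * pn n * ((h - k / 4) * \<xi>\<^sup>2) + Q * pn n * (k / 8 * \<xi>\<^sup>2)"
    unfolding h_def k_def by (simp add: field_simps)
  ultimately show ?thesis
    using quadratic_form_small[OF assms, of \<xi>] 1 2 cross unfolding y_def[symmetric] distrib_left by linarith
qed


lemma B_nonneg: "0 < m \<Longrightarrow> 0 < n \<Longrightarrow> 0 \<le> B m n"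
  using s_pos[of m n] sig_pos[of m n] gam_pos by (simp add: B_def)

lemma B_upper:
  assumes "0 < m" "0 < n"
  shows "B m n \<le> (1 + gam) * (m powr (P / 2) + n powr (Q / 2))"
proof -
  have "m * sig m n \<le> s m n"
    using m_sig_le[OF assms] s_pos[OF assms] by (simp add: field_simps)
  then have "gam * (m * sig m n) \<le> gam * s m n" using gam_pos by (intro mult_left_mono) auto
  then show ?thesis by (simp add: B_def s_def[symmetric] algebra_simps)
qed

end

text \<open>In \<open>bellman_system\<close> the first argument \<open>m\<close> of \<open>b\<close> stands for \<open>e + u\<^sup>2\<close> and the second argument \<open>n\<close> for
  \<open>e + |w|\<^sup>2\<close>, where \<open>e > 0\<close> is a regularization. The numbers \<open>N\<close>, \<open>E\<close>, \<open>p\<close> are \<open>|w|\<^sup>2\<close>, \<open>|\<eta>|\<^sup>2\<close> and \<open>w \<bullet> \<eta>\<close> for a direction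
  \<open>(\<xi>, \<eta>)\<close>. In \<open>space\<close> the null Lagrangian generated by \<open>q u\<^sup>2 g\<close> has been added to the Hessian form; this turns
  the plain derivative \<open>\<xi>\<close> of \<open>u\<close> into \<open>\<xi> + q u\<close>.\<close>

locale bellman_system =
  fixes b b1 b2 b11 b12 b22 g g1 g2 T :: "real \<Rightarrow> real \<Rightarrow> real" and c :: real
  assumes c_pos: "0 < c"
    and deriv_b: "\<And>m n m' n' t S. (m has_real_derivative m') (at t within S) \<Longrightarrow> 0 < m t \<Longrightarrow>
      (n has_real_derivative n') (at t within S) \<Longrightarrow> 0 < n t \<Longrightarrow>
      ((\<lambda>t. b (m t) (n t)) has_real_derivative b1 (m t) (n t) * m' + b2 (m t) (n t) * n') (at t within S)"
    and deriv_b1: "\<And>m n m' n' t S. (m has_real_derivative m') (at t within S) \<Longrightarrow> 0 < m t \<Longrightarrow>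
      (n has_real_derivative n') (at t within S) \<Longrightarrow> 0 < n t \<Longrightarrow>
      ((\<lambda>t. b1 (m t) (n t)) has_real_derivative b11 (m t) (n t) * m' + b12 (m t) (n t) * n') (at t within S)"
    and deriv_b2: "\<And>m n m' n' t S. (m has_real_derivative m') (at t within S) \<Longrightarrow> 0 < m t \<Longrightarrow>
      (n has_real_derivative n') (at t within S) \<Longrightarrow> 0 < n t \<Longrightarrow>
      ((\<lambda>t. b2 (m t) (n t)) has_real_derivative b12 (m t) (n t) * m' + b22 (m t) (n t) * n') (at t within S)"
    and deriv_g: "\<And>m n m' n' t S. (m has_real_derivative m') (at t within S) \<Longrightarrow> 0 < m t \<Longrightarrow>
      (n has_real_derivative n') (at t within S) \<Longrightarrow> 0 < n t \<Longrightarrow>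
      ((\<lambda>t. g (m t) (n t)) has_real_derivative g1 (m t) (n t) * m' + g2 (m t) (n t) * n') (at t within S)"
    and cont: "\<And>f. f \<in> {b, b1, b2, b11, b12, b22, g, g1, g2} \<Longrightarrow>
      continuous_on ({0<..} \<times> {0<..}) (\<lambda>(m, n). f m n)"
    and b2_nonneg: "\<And>m n. 0 < m \<Longrightarrow> 0 < n \<Longrightarrow> 0 \<le> b2 m n"
    and g_nonneg: "\<And>m n. 0 < m \<Longrightarrow> 0 < n \<Longrightarrow> 0 \<le> g m n"
    and g_le: "\<And>m n. 0 < m \<Longrightarrow> 0 < n \<Longrightarrow> g m n \<le> 2 * b1 m n"
    and T_pos: "\<And>m n. 0 < m \<Longrightarrow> 0 < n \<Longrightarrow> 0 < T m n"
    and time: "\<And>e u N E p \<xi> m n. 0 < e \<Longrightarrow> 0 \<le> N \<Longrightarrow> 0 \<le> E \<Longrightarrow> p\<^sup>2 \<le> N * E \<Longrightarrow> m = e + u\<^sup>2 \<Longrightarrow> n = e + N \<Longrightarrow>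
      T m n * E \<le> 2 * b1 m n * \<xi>\<^sup>2 + 2 * b2 m n * E + 4 * b11 m n * (u * \<xi>)\<^sup>2
        + 8 * b12 m n * (u * \<xi>) * p + 4 * b22 m n * p\<^sup>2"
    and space: "\<And>e u N E p \<xi> m n q. 0 < e \<Longrightarrow> 0 \<le> N \<Longrightarrow> 0 \<le> E \<Longrightarrow> p\<^sup>2 \<le> N * E \<Longrightarrow> m = e + u\<^sup>2 \<Longrightarrow> n = e + N \<Longrightarrow>
      c\<^sup>2 / 4 / T m n * (\<xi> + q * u)\<^sup>2 \<le> 2 * b1 m n * \<xi>\<^sup>2 + 2 * b2 m n * E + 4 * b11 m n * (u * \<xi>)\<^sup>2
        + 8 * b12 m n * (u * \<xi>) * p + 4 * b22 m n * p\<^sup>2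
        + q * (2 * u * \<xi> * g m n + u\<^sup>2 * (g1 m n * (2 * (u * \<xi>)) + g2 m n * (2 * p))) + q\<^sup>2 * u\<^sup>2 * g m n"

section \<open>The two instances of the Bellman system\<close>

context bellman_exponent
begin

lemma bellman_system_large:
  "bellman_system B Bm Bn Bmm Bmn Bnn (\<lambda>m n. gam * sig m n)
     (\<lambda>m n. gam * (kap * (sig m n / s m n) * (P / 2 * pm m))) (\<lambda>m n. gam * (kap * (sig m n / s m n) * (Q / 2 * pn n)))
     (\<lambda>m n. 8 * gam / sig m n) (4 * gam)"
proof
  fix f assume "f \<in> {B, Bm, Bn, Bmm, Bmn, Bnn, \<lambda>m n. gam * sig m n,
     \<lambda>m n. gam * (kap * (sig m n / s m n) * (P / 2 * pm m)), \<lambda>m n. gam * (kap * (sig m n / s m n) * (Q / 2 * pn n))}"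
  moreover have "continuous_on ({0<..} \<times> {0<..}) (\<lambda>x::real \<times> real. fst x)" "continuous_on ({0<..} \<times> {0<..}) (\<lambda>x::real \<times> real. snd x)"
    by (intro continuous_intros)+
  note C = continuous_on_B_derivs[OF this]
  ultimately show "continuous_on ({0<..} \<times> {0<..}) (\<lambda>(m, n). f m n)"
    by (auto simp: case_prod_beta simp del: times_divide_eq_left times_divide_eq_right intro!: continuous_on_mult continuous_on_const C)
next
  fix e u N E p \<xi> m n q :: real
  assume *: "0 < e" "0 \<le> N" "0 \<le> E" "p\<^sup>2 \<le> N * E" "m = e + u\<^sup>2" "n = e + N"
  then have "(4 * gam)\<^sup>2 / 4 / (8 * gam / sig m n) = gam / 2 * sig m n"
    using gam_pos by (simp add: power2_eq_square)
  then show "(4 * gam)\<^sup>2 / 4 / (8 * gam / sig m n) * (\<xi> + q * u)\<^sup>2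
       \<le> 2 * Bm m n * \<xi>\<^sup>2 + 2 * Bn m n * E + 4 * Bmm m n * (u * \<xi>)\<^sup>2 + 8 * Bmn m n * (u * \<xi>) * p + 4 * Bnn m n * p\<^sup>2 +
          q * (2 * u * \<xi> * (gam * sig m n) + u\<^sup>2 * (gam * (kap * (sig m n / s m n) * (P / 2 * pm m)) * (2 * (u * \<xi>)) +
              gam * (kap * (sig m n / s m n) * (Q / 2 * pn n)) * (2 * p))) + q\<^sup>2 * u\<^sup>2 * (gam * sig m n)"
    using space_large[OF *, of \<xi> q] by (simp only:)
next
  fix m n :: "real \<Rightarrow> real" and m' n' t :: real and S :: "real set"
  assume *: "(m has_real_derivative m') (at t within S)" "0 < m t"
    "(n has_real_derivative n') (at t within S)" "0 < n t"
  show "((\<lambda>t. gam * sig (m t) (n t)) has_real_derivative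
        gam * (kap * (sig (m t) (n t) / s (m t) (n t)) * (P / 2 * pm (m t))) * m' +
        gam * (kap * (sig (m t) (n t) / s (m t) (n t)) * (Q / 2 * pn (n t))) * n') (at t within S)"
    by (rule DERIV_cong[OF DERIV_cmult[OF deriv_sig[OF *]]]) (simp add: algebra_simps)
next
  fix e u N E p \<xi> m n :: real
  assume *: "0 < e" "0 \<le> N" "0 \<le> E" "p\<^sup>2 \<le> N * E" "m = e + u\<^sup>2" "n = e + N"
  show "8 * gam / sig m n * E \<le> 2 * Bm m n * \<xi>\<^sup>2 + 2 * Bn m n * E + 4 * Bmm m n * (u * \<xi>)\<^sup>2
      + 8 * Bmn m n * (u * \<xi>) * p + 4 * Bnn m n * p\<^sup>2"
    by (rule time_large[OF *])
qed (use gam_pos sig_pos in \<open>auto intro!: deriv_B deriv_Bm deriv_Bn Bm_nonneg Bn_nonneg sig_le_Bm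
       simp: less_imp_le\<close>)

text \<open>The slots are exchanged, so that u takes the exponent Q and \<open>b1\<close> becomes
  \<open>Bn\<close>. The condition g \<le> 2 b1 holds because 8 gam \<le> 1 and Q pn / 2 \<le>
  \<open>Bn\<close>.\<close>

lemma bellman_system_small:
  "bellman_system (\<lambda>n m. B m n) (\<lambda>n m. Bn m n) (\<lambda>n m. Bm m n) (\<lambda>n m. Bnn m n) (\<lambda>n m. Bmn m n) (\<lambda>n m. Bmm m n)
     (\<lambda>n m. 8 * gam * Q * pn n) (\<lambda>n m. 8 * gam * Q * ((Q / 2 - 1) * (pn n / n))) (\<lambda>n m. 0)
     (\<lambda>n m. gam * sig m n) (4 * gam)"
proof
  fix f assume f: "f \<in> {\<lambda>n m. B m n, \<lambda>n m. Bn m n, \<lambda>n m. Bm m n, \<lambda>n m. Bnn m n, \<lambda>n m. Bmn m n, \<lambda>n m. Bmm m n,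
     \<lambda>n m. 8 * gam * Q * pn n, \<lambda>n m. 8 * gam * Q * ((Q / 2 - 1) * (pn n / n)), \<lambda>n m. 0}"
  have "continuous_on ({0<..} \<times> {0<..}) (\<lambda>x::real \<times> real. snd x)" "continuous_on ({0<..} \<times> {0<..}) (\<lambda>x::real \<times> real. fst x)"
    by (intro continuous_intros)+
  note C = continuous_on_B_derivs[OF this]
  show "continuous_on ({0<..} \<times> {0<..}) (\<lambda>(m, n). f m n)"
    using f by (auto simp: case_prod_beta intro!: continuous_intros C)
next
  fix e u N E p \<xi> n m q :: real
  assume *: "0 < e" "0 \<le> N" "0 \<le> E" "p\<^sup>2 \<le> N * E" "n = e + u\<^sup>2" "m = e + N"
  then have "(4 * gam)\<^sup>2 / 4 / (gam * sig m n) = 4 * gam / sig m n"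
    using gam_pos by (simp add: power2_eq_square)
  then show "(4 * gam)\<^sup>2 / 4 / (gam * sig m n) * (\<xi> + q * u)\<^sup>2
       \<le> 2 * Bn m n * \<xi>\<^sup>2 + 2 * Bm m n * E + 4 * Bnn m n * (u * \<xi>)\<^sup>2 + 8 * Bmn m n * (u * \<xi>) * p + 4 * Bmm m n * p\<^sup>2 +
          q * (2 * u * \<xi> * (8 * gam * Q * pn n) +
            u\<^sup>2 * (8 * gam * Q * ((Q / 2 - 1) * (pn n / n)) * (2 * (u * \<xi>)) + 0 * (2 * p))) +
          q\<^sup>2 * u\<^sup>2 * (8 * gam * Q * pn n)"
    using space_small[OF *(1,2,3,4,6,5), of \<xi> q] by (simp only: mult_zero_left add_0_right)
next
  fix n m :: "real \<Rightarrow> real" and n' m' t :: real and S :: "real set"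
  assume *: "(n has_real_derivative n') (at t within S)" "0 < n t"
    "(m has_real_derivative m') (at t within S)" "0 < m t"
  show "((\<lambda>t. 8 * gam * Q * pn (n t)) has_real_derivative
        8 * gam * Q * ((Q / 2 - 1) * (pn (n t) / n t)) * n' + 0 * m') (at t within S)"
    by (rule DERIV_cong[OF DERIV_cmult[OF deriv_pn[OF *(1,2)]]]) simp
  show "((\<lambda>t. B (m t) (n t)) has_real_derivative Bn (m t) (n t) * n' + Bm (m t) (n t) * m') (at t within S)"
    using deriv_B[OF *(3,4,1,2)] by (simp add: add.commute)
  show "((\<lambda>t. Bn (m t) (n t)) has_real_derivative Bnn (m t) (n t) * n' + Bmn (m t) (n t) * m') (at t within S)"
    using deriv_Bn[OF *(3,4,1,2)] by (simp add: add.commute)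
  show "((\<lambda>t. Bm (m t) (n t)) has_real_derivative Bmn (m t) (n t) * n' + Bmm (m t) (n t) * m') (at t within S)"
    using deriv_Bm[OF *(3,4,1,2)] by (simp add: add.commute)
next
  fix n m :: real assume *: "0 < n" "0 < m"
  have "8 * gam \<le> 1" using gam_le by simp
  then have "8 * gam * (Q * pn n) \<le> 1 * (Q * pn n)"
    using Q_bounds pn_pos[OF *(1)] by (intro mult_right_mono) auto
  then show "8 * gam * Q * pn n \<le> 2 * Bn m n" using Bn_lower[OF *(2,1)] by (simp add: mult_ac)
qed (use gam_pos sig_pos pn_pos Q_bounds in \<open>auto intro!: Bm_nonneg Bn_nonneg time_small simp: less_imp_le\<close>)

end

section \<open>The cube\<close>

text \<open>The same vector as inside \<open>partial_deriv\<close>, so coordinate derivatives become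
  derivatives in one variable.\<close>

definition upd :: "'d \<Rightarrow> real ^ 'd \<Rightarrow> real \<Rightarrow> real ^ 'd" where
  "upd j x s = (\<chi> i. if i = j then s else x $ i)"

lemma upd_nth [simp]: "upd j x s $ i = (if i = j then s else x $ i)"
  by (simp add: upd_def)

lemma upd_self [simp]: "upd j x (x $ j) = x"
  by (simp add: vec_eq_iff)

lemma upd_upd [simp]: "upd j (upd j x s) t = upd j x t"
  by (simp add: vec_eq_iff)

lemma upd_eq_plus: "upd j x (x $ j + h) = x + h *\<^sub>R axis j 1"
  by (auto simp: vec_eq_iff axis_def)

definition ccube :: "(real ^ 'd) set" where
  "ccube = cbox 0 (\<chi> i. pi)"

lemma cube_eq_box: "cube = box 0 (\<chi> i. (pi :: real))"
  by (auto simp: cube_def mem_box_cart)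

lemma cube_subset_ccube: "cube \<subseteq> ccube"
  unfolding cube_eq_box ccube_def by (rule box_subset_cbox)

lemma mem_ccube: "x \<in> ccube \<longleftrightarrow> (\<forall>i. 0 \<le> x $ i \<and> x $ i \<le> pi)"
  by (simp add: ccube_def mem_box_cart)

lemma compact_ccube: "compact ccube"
  by (simp add: ccube_def)

lemma open_cube: "open cube"
  unfolding cube_eq_box by (rule open_box)

lemma cube_measurable [measurable, simp]: "cube \<in> sets lebesgue" "cube \<in> sets borel" "cube \<in> lmeasurable"
  by (simp_all add: cube_eq_box)

lemma finite_measure_cube: "finite_measure cube_measure"
  by (rule finite_measure_lebesgue_on) simp

lemma emeasure_cube_finite: "emeasure cube_measure cube < \<infinity>"
  using finite_measure.emeasure_finite[OF finite_measure_cube, of cube] by (simp add: less_top)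

lemma sin_pos_cube: "x \<in> cube \<Longrightarrow> 0 < sin (x $ i)"
  by (auto simp: cube_def intro: sin_gt_zero)

lemma cube_nth: "x \<in> cube \<Longrightarrow> 0 < x $ j" "x \<in> cube \<Longrightarrow> x $ j < pi"
  by (simp_all add: cube_def)

lemma integrable_bounded_cube:
  fixes f :: "real ^ 'd \<Rightarrow> 'b::{banach, second_countable_topology}"
  assumes "f \<in> borel_measurable cube_measure" "\<And>x. x \<in> cube \<Longrightarrow> norm (f x) \<le> C"
  shows "integrable cube_measure f"
  using assms emeasure_cube_finite
  by (intro integrableI_bounded_set[where A = cube and B = C]) auto

lemma measurable_continuous_cube:
  fixes f :: "real ^ 'd \<Rightarrow> 'b::{second_countable_topology, t2_space, metric_space}"
  assumes "continuous_on cube f"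
  shows "f \<in> borel_measurable cube_measure"
  using assms by (intro continuous_imp_measurable_on_sets_lebesgue) auto

lemma integral_ccube:
  fixes f :: "real ^ 'd \<Rightarrow> real"
  assumes "continuous_on ccube f"
  shows "integrable cube_measure f" "(\<integral>x. f x \<partial>cube_measure) = integral ccube f"
proof -
  obtain C where C: "\<And>x. x \<in> ccube \<Longrightarrow> norm (f x) \<le> C"
    using compact_imp_bounded[OF compact_continuous_image[OF assms compact_ccube]]
    by (auto simp: bounded_iff)
  show int: "integrable cube_measure f"
    using C cube_subset_ccube
    by (intro integrable_bounded_cube[where C = C] measurable_continuous_cube continuous_on_subset[OF assms]) auto
  show "(\<integral>x. f x \<partial>cube_measure) = integral ccube f"
    using lebesgue_integral_eq_integral[OF int] unfolding ccube_def cube_eq_box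
    by (simp add: integral_open_interval)
qed

lemma integral_cube_lborel:
  fixes f :: "real ^ 'd \<Rightarrow> real"
  assumes "(\<lambda>x. if x \<in> cube then f x else 0) \<in> borel_measurable borel"
  shows "integrable cube_measure f \<longleftrightarrow> integrable lborel (\<lambda>x. if x \<in> cube then f x else 0)"
    "(\<integral>x. f x \<partial>cube_measure) = (\<integral>x. (if x \<in> cube then f x else 0) \<partial>lborel)"
proof -
  have eq: "(\<lambda>x. indicator cube x * f x) = (\<lambda>x. if x \<in> cube then f x else 0)"
    by auto
  show "integrable cube_measure f \<longleftrightarrow> integrable lborel (\<lambda>x. if x \<in> cube then f x else 0)"
    using assms by (subst integrable_restrict_space) (auto simp: eq integrable_completion)
  show "(\<integral>x. f x \<partial>cube_measure) = (\<integral>x. (if x \<in> cube then f x else 0) \<partial>lborel)"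
    using assms by (subst integral_restrict_space) (auto simp: eq integral_completion)
qed

text \<open>For two points of (0, pi) this is the mean value inequality. If one point lies outside,
  use |G s| \<le> C sin s and the fact that sin s is at most the distance from s to either
  endpoint.\<close>

lemma zero_extension_lipschitz:
  fixes G :: "real \<Rightarrow> real"
  assumes G: "\<And>s. 0 < s \<Longrightarrow> s < pi \<Longrightarrow> (G has_real_derivative G' s) (at s)"
    "\<And>s. 0 < s \<Longrightarrow> s < pi \<Longrightarrow> \<bar>G' s\<bar> \<le> C" "\<And>s. 0 < s \<Longrightarrow> s < pi \<Longrightarrow> \<bar>G s\<bar> \<le> C * sin s"
    and G0: "\<And>s. G0 s = (if 0 < s \<and> s < pi then G s else 0)" and C: "0 \<le> C"
  shows "\<bar>G0 y - G0 z\<bar> \<le> C * \<bar>y - z\<bar>"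
proof -
  have edge: "\<bar>G s\<bar> \<le> C * \<bar>s - r\<bar>" if "0 < s" "s < pi" "\<not> (0 < r \<and> r < pi)" for s r
  proof -
    have "sin s \<le> s" using that by (simp add: sin_x_le_x)
    moreover have "sin s \<le> pi - s" using sin_x_le_x[of "pi - s"] that by simp
    ultimately have "sin s \<le> \<bar>s - r\<bar>" using that by auto
    then show ?thesis using G(3)[of s] that C by (meson mult_left_mono order_trans)
  qed
  have inner: "\<bar>G y - G z\<bar> \<le> C * \<bar>y - z\<bar>" if "0 < y" "y < pi" "0 < z" "z < pi" for y z
  proof -
    have "norm (G y - G z) \<le> C * norm (y - z)"
      by (rule field_differentiable_bound[where S = "{0<..<pi}" and f' = G'])
         (use that G in \<open>auto intro: DERIV_subset\<close>)
    then show ?thesis by simp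
  qed
  show ?thesis
    using edge[of y z] edge[of z y] inner[of y z] C unfolding G0 by (auto simp: abs_minus_commute)
qed

lemma integral_lborel_translate:
  fixes f :: "real ^ 'd \<Rightarrow> real"
  assumes [measurable]: "f \<in> borel_measurable borel"
  shows "(\<integral>x. f (x + a) \<partial>lborel) = (\<integral>x. f x \<partial>lborel)"
    "integrable lborel (\<lambda>x. f (x + a)) \<longleftrightarrow> integrable lborel f"
proof -
  have "(\<integral>x. f x \<partial>lborel) = (\<integral>x. f x \<partial>distr lborel borel ((+) a))"
    by (simp add: lborel_distr_plus)
  also have "\<dots> = (\<integral>x. f (x + a) \<partial>lborel)"
    by (subst integral_distr) (auto simp: add.commute)
  finally show "(\<integral>x. f (x + a) \<partial>lborel) = (\<integral>x. f x \<partial>lborel)" ..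
  have "integrable lborel f \<longleftrightarrow> integrable (distr lborel borel ((+) a)) f"
    by (simp add: lborel_distr_plus)
  also have "\<dots> \<longleftrightarrow> integrable lborel (\<lambda>x. f (x + a))"
    by (subst integrable_distr_eq) (auto simp: add.commute)
  finally show "integrable lborel (\<lambda>x. f (x + a)) \<longleftrightarrow> integrable lborel f" ..
qed

text \<open>Proved without Fubini: the difference quotients of the extension by zero have integral \<open>0\<close> by
  translation invariance, and they are dominated because the extension is Lipschitz in direction \<open>j\<close>.\<close>

lemma integral_partial_derivative:
  fixes F D :: "real ^ 'd \<Rightarrow> real"
  assumes cont: "continuous_on cube F"
    and deriv: "\<And>x. x \<in> cube \<Longrightarrow> ((\<lambda>s. F (upd j x s)) has_real_derivative D x) (at (x $ j))"
    and bD: "\<And>x. x \<in> cube \<Longrightarrow> \<bar>D x\<bar> \<le> C"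
    and bF: "\<And>x. x \<in> cube \<Longrightarrow> \<bar>F x\<bar> \<le> C * sin (x $ j)"
  shows "integrable cube_measure D" "(\<integral>x. D x \<partial>cube_measure) = 0"
proof -
  let ?e = "axis j (1::real)"
  define F0 where "F0 x = (if x \<in> cube then F x else 0)" for x
  define D0 where "D0 x = (if x \<in> cube then D x else 0)" for x
  define h where "h n = inverse (real (Suc n))" for n
  define q where "q n x = (F0 (x + h n *\<^sub>R ?e) - F0 x) / h n" for n x
  \<comment> \<open>Since the steps h n are at most 1, this box contains the supports of all
    difference quotients, so C times its indicator dominates them.\<close>
  define big where "big = cbox (\<chi> i. -1) (\<chi> i. (pi + 1 :: real)) \<inter> (UNIV :: (real ^ 'd) set)"
  have h: "0 < h n" "h n \<le> 1" for n by (simp_all add: h_def field_simps)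
  have h0: "h \<longlonglongrightarrow> 0" unfolding h_def by (rule LIMSEQ_inverse_real_of_nat)
  have C: "0 \<le> C"
  proof -
    have "(\<chi> i. pi / 2) \<in> (cube :: (real ^ 'd) set)" by (simp add: cube_def)
    from bD[OF this] show ?thesis by (meson abs_ge_zero order_trans)
  qed
  have F0m [measurable]: "F0 \<in> borel_measurable borel"
  proof -
    have "F0 = (\<lambda>x. indicator cube x *\<^sub>R F x)" by (auto simp: F0_def)
    then show ?thesis using borel_measurable_continuous_on_indicator[OF _ cont] by simp
  qed
  have lip: "\<bar>F0 (x + t *\<^sub>R ?e) - F0 x\<bar> \<le> C * \<bar>t\<bar>" for x t
  proof (cases "\<forall>i. i \<noteq> j \<longrightarrow> 0 < x $ i \<and> x $ i < pi")
    case True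
    then have mem: "upd j x s \<in> cube \<longleftrightarrow> 0 < s \<and> s < pi" for s
      by (auto simp: cube_def)
    have "\<bar>F0 (upd j x (x $ j + t)) - F0 (upd j x (x $ j))\<bar> \<le> C * \<bar>x $ j + t - x $ j\<bar>"
    proof (rule zero_extension_lipschitz[where G = "\<lambda>s. F (upd j x s)" and G' = "\<lambda>s. D (upd j x s)"])
      fix s assume s: "0 < s" "s < pi"
      then show "((\<lambda>s. F (upd j x s)) has_real_derivative D (upd j x s)) (at s)"
        using deriv[of "upd j x s"] mem by simp
      show "\<bar>D (upd j x s)\<bar> \<le> C" "\<bar>F (upd j x s)\<bar> \<le> C * sin s"
        using s bD[of "upd j x s"] bF[of "upd j x s"] mem by simp_all
    qed (use C mem in \<open>auto simp: F0_def\<close>)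
    then show ?thesis by (simp add: upd_eq_plus)
  next
    case False
    then obtain i where i: "i \<noteq> j" "\<not> (0 < x $ i \<and> x $ i < pi)" by auto
    then have "x \<notin> cube" "x + t *\<^sub>R ?e \<notin> cube"
      by (auto simp: cube_def axis_def intro!: exI[of _ i])
    then show ?thesis using C by (simp add: F0_def)
  qed
  have dom: "norm (q n x) \<le> C * indicator big x" for n x
  proof (cases "x \<in> big")
    case True
    then show ?thesis using lip[of x "h n"] h[of n] by (simp add: q_def field_simps)
  next
    case False
    have "x \<notin> cube" "x + h n *\<^sub>R ?e \<notin> cube"
    proof -
      from False obtain i where i: "\<not> (-1 \<le> x $ i \<and> x $ i \<le> pi + 1)"
        by (auto simp: big_def mem_box_cart)
      then show "x \<notin> cube" by (auto simp: cube_def intro!: exI[of _ i])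
      have "(x + h n *\<^sub>R ?e) $ i = x $ i \<or> (x + h n *\<^sub>R ?e) $ i = x $ i + h n" by (simp add: axis_def)
      then have "\<not> (0 < (x + h n *\<^sub>R ?e) $ i \<and> (x + h n *\<^sub>R ?e) $ i < pi)"
        using i h[of n] pi_gt_zero by linarith
      then show "x + h n *\<^sub>R ?e \<notin> cube" using cube_nth by blast
    qed
    then show ?thesis using C by (simp add: q_def F0_def)
  qed
  have lim_in: "(\<lambda>n. q n x) \<longlonglongrightarrow> D0 x" if "x \<in> cube" for x
  proof -
    have "((\<lambda>t. (F (upd j x (x $ j + t)) - F (upd j x (x $ j))) / t) \<longlongrightarrow> D x) (at 0)"
      using deriv[OF that] by (simp add: DERIV_def)
    then have "(\<lambda>n. (F (upd j x (x $ j + h n)) - F (upd j x (x $ j))) / h n) \<longlonglongrightarrow> D x"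
    proof (rule filterlim_compose)
      have "h n \<noteq> 0" for n using h(1)[of n] by simp
      then show "filterlim h (at 0) sequentially" using h0 by (simp add: filterlim_at)
    qed
    moreover have "\<forall>\<^sub>F n in sequentially. (F (upd j x (x $ j + h n)) - F (upd j x (x $ j))) / h n = q n x"
    proof -
      have "(\<lambda>n. x + h n *\<^sub>R ?e) \<longlonglongrightarrow> x + 0 *\<^sub>R ?e" by (intro tendsto_intros h0)
      then have "\<forall>\<^sub>F n in sequentially. x + h n *\<^sub>R ?e \<in> cube"
        using that open_cube by (intro topological_tendstoD) auto
      then show ?thesis
        by eventually_elim (use that in \<open>simp add: q_def F0_def upd_eq_plus\<close>)
    qed
    ultimately show ?thesis using that by (simp add: D0_def Lim_transform_eventually)
  qed
  \<comment> \<open>Outside the cube the quotients vanish for large n, except perhaps on the face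
    x_j = 0, where a positive step enters the cube; that hyperplane is a null set.\<close>
  have lim_out: "(\<lambda>n. q n x) \<longlonglongrightarrow> D0 x" if "x \<notin> cube" "x $ j \<noteq> 0" for x
  proof -
    have "\<forall>\<^sub>F n in sequentially. x + h n *\<^sub>R ?e \<notin> cube"
    proof (cases "x $ j < 0")
      case True
      then have "\<forall>\<^sub>F n in sequentially. h n < - x $ j"
        using h0 by (intro order_tendstoD) auto
      then show ?thesis
        by eventually_elim (auto simp: cube_def axis_def intro!: exI[of _ j])
    next
      case False
      then have xj: "0 < x $ j" using that(2) by simp
      have "x \<notin> cube" by (rule that(1))
      then obtain i where i: "\<not> (0 < x $ i \<and> x $ i < pi)" unfolding cube_def mem_Collect_eq by blast
      have "x + h n *\<^sub>R ?e \<notin> cube" for n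
      proof -
        have "(x + h n *\<^sub>R ?e) $ i = (if i = j then x $ i + h n else x $ i)" by (simp add: axis_def)
        then have "\<not> (0 < (x + h n *\<^sub>R ?e) $ i \<and> (x + h n *\<^sub>R ?e) $ i < pi)"
          using i xj h(1)[of n] by (cases "i = j") auto
        then show ?thesis using cube_nth by blast
      qed
      then show ?thesis by simp
    qed
    then have "\<forall>\<^sub>F n in sequentially. q n x = D0 x"
      by eventually_elim (use that in \<open>simp add: q_def F0_def D0_def\<close>)
    then show ?thesis by (rule tendsto_eventually)
  qed
  have D0m [measurable]: "D0 \<in> borel_measurable borel"
  proof (rule borel_measurable_LIMSEQ_real)
    fix x show "(\<lambda>n. if x \<in> cube then q n x else 0) \<longlonglongrightarrow> D0 x"
      using lim_in[of x] by (cases "x \<in> cube") (auto simp: D0_def)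
  next
    fix n show "(\<lambda>x. if x \<in> cube then q n x else 0) \<in> borel_measurable borel"
      unfolding q_def by measurable
  qed
  have qm: "q n \<in> borel_measurable lborel" for n unfolding q_def by measurable
  have ae: "AE x in lborel. (\<lambda>n. q n x) \<longlonglongrightarrow> D0 x"
  proof -
    have "{x. x $ j = 0} \<in> null_sets (lebesgue :: (real ^ 'd) measure)"
      using negligible_standard_hyperplane_cart[of j] by (simp add: negligible_iff_null_sets)
    then have "AE x in (lebesgue :: (real ^ 'd) measure). x \<notin> {x. x $ j = 0}"
      by (rule AE_not_in)
    then have "AE x in (lborel :: (real ^ 'd) measure). x \<notin> {x. x $ j = 0}"
      by (simp add: AE_completion_iff)
    then show ?thesis by eventually_elim (use lim_in lim_out in blast)
  qed
  have bigint: "integrable lborel (\<lambda>x. C * indicator big x)"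
    unfolding big_def by (auto intro!: integrable_mult_right integrable_real_indicator emeasure_lborel_cbox_finite)
  have F0int: "integrable lborel F0"
  proof (rule Bochner_Integration.integrable_bound[OF bigint])
    show "AE x in lborel. norm (F0 x) \<le> norm (C * indicator big x)"
    proof (intro AE_I2)
      fix x
      have "\<bar>F x\<bar> \<le> C * 1" if "x \<in> cube"
        using bF[OF that] C by (meson mult_left_mono order_trans sin_le_one)
      moreover have "x \<in> big" if "x \<in> cube"
      proof -
        have "-1 \<le> x $ i \<and> x $ i \<le> pi + 1" for i using cube_nth[OF that, of i] by linarith
        then show ?thesis by (simp add: big_def mem_box_cart)
      qed
      ultimately show "norm (F0 x) \<le> norm (C * indicator big x)"
        using C by (auto simp: F0_def)
    qed
  qed simp
  have q0: "(\<integral>x. q n x \<partial>lborel) = 0" for n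
  proof -
    note tr = integral_lborel_translate[OF F0m, of "h n *\<^sub>R ?e"]
    have "integrable lborel (\<lambda>x. F0 (x + h n *\<^sub>R ?e))" using tr(2) F0int by simp
    then have "(\<integral>x. q n x \<partial>lborel) = ((\<integral>x. F0 (x + h n *\<^sub>R ?e) \<partial>lborel) - (\<integral>x. F0 x \<partial>lborel)) / h n"
      unfolding q_def using F0int by simp
    then show ?thesis unfolding tr(1) by simp
  qed
  have D0m': "D0 \<in> borel_measurable lborel" by simp
  have ae_dom: "AE x in lborel. norm (q n x) \<le> C * indicator big x" for n
    using dom by (intro AE_I2)
  have int: "integrable lborel D0"
    by (rule integrable_dominated_convergence[OF D0m' qm bigint ae ae_dom])
  have "(\<lambda>n. \<integral>x. q n x \<partial>lborel) \<longlonglongrightarrow> (\<integral>x. D0 x \<partial>lborel)"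
    by (rule integral_dominated_convergence[OF D0m' qm bigint ae ae_dom])
  then have zero: "(\<integral>x. D0 x \<partial>lborel) = 0"
    unfolding q0 by (rule LIMSEQ_unique) simp
  have D0: "(\<lambda>x. if x \<in> cube then D x else 0) = D0" by (auto simp: D0_def)
  show "integrable cube_measure D" "(\<integral>x. D x \<partial>cube_measure) = 0"
    using integral_cube_lborel[of D, unfolded D0, OF D0m] int zero by simp_all
qed

text \<open>If K 0 were negative, the mean value theorem would give a positive slope somewhere, and
  convexity would turn it into linear growth, contradicting the limit 0.\<close>

lemma convex_limit_nonneg:
  fixes K :: "real \<Rightarrow> real"
  assumes K: "\<And>t. 0 \<le> t \<Longrightarrow> (K has_real_derivative K' t) (at t)"
    "\<And>t. 0 \<le> t \<Longrightarrow> (K' has_real_derivative K'' t) (at t)"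
    and pos: "\<And>t. 0 \<le> t \<Longrightarrow> 0 \<le> K'' t" and lim: "(\<lambda>n. K (real n)) \<longlonglongrightarrow> 0"
  shows "0 \<le> K 0"
proof (rule ccontr)
  assume "\<not> 0 \<le> K 0"
  then have "\<forall>\<^sub>F n in sequentially. K 0 < K (real n)"
    using lim by (intro order_tendstoD) auto
  then have "\<forall>\<^sub>F n in sequentially. K 0 < K (real n) \<and> 0 < n"
    using eventually_gt_at_top by eventually_elim auto
  then obtain n :: nat where n: "K 0 < K (real n)" "0 < n"
    by (auto simp: eventually_sequentially)
  obtain z where z: "0 < z" "z < real n" "K (real n) - K 0 = (real n - 0) * K' z"
    using MVT2[of 0 "real n" K K'] K n by auto
  have "0 < real n * K' z" using n(1) z(3) by simp
  then have Kz: "0 < K' z" using n(2) by (simp add: zero_less_mult_iff)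
  have mono: "K' z \<le> K' t" if "z \<le> t" for t
  proof (rule DERIV_nonneg_imp_nondecreasing[OF that])
    fix x assume "z \<le> x" "x \<le> t"
    then have "0 \<le> x" using z by simp
    then show "\<exists>y. (K' has_real_derivative y) (at x) \<and> 0 \<le> y" using K(2) pos by blast
  qed
  have grow: "K z + K' z * (t - z) \<le> K t" if "z < t" for t
  proof -
    have "\<exists>y>z. y < t \<and> K t - K z = (t - z) * K' y"
      using that z by (intro MVT2) (auto intro!: K(1))
    then obtain y where y: "z < y" "K t - K z = (t - z) * K' y" by auto
    have "(t - z) * K' z \<le> (t - z) * K' y"
      using mono[of y] y(1) that by (intro mult_left_mono) auto
    then show ?thesis using y(2) by (simp add: mult.commute)
  qed
  have "\<forall>\<^sub>F n in sequentially. K (real n) < 1"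
    using lim by (intro order_tendstoD) auto
  then obtain n0 where n0: "\<And>n. n0 \<le> n \<Longrightarrow> K (real n) < 1"
    by (auto simp: eventually_sequentially)
  obtain n1 :: nat where n1: "max z (z + (1 - K z) / K' z) < real n1"
    using reals_Archimedean2 by blast
  define n where "n = max n0 n1"
  have n: "z < real n" "z + (1 - K z) / K' z < real n" using n1 by (auto simp: n_def)
  then have "1 - K z < K' z * (real n - z)"
    using Kz by (simp add: field_simps)
  with grow[OF n(1)] n0[of n] show False by (simp add: n_def)
qed

section \<open>Ladder systems of eigenfunctions\<close>

context bellman_system
begin

text \<open>The right-hand side is the second t-derivative of b plus the divergence of the vector
  field \<partial>_j b + q_j u^2 g, written out. The equations for u and w trade the second
  derivatives for potential terms. The estimate \<open>space\<close> needs q_j^2 u^2 g, whereas the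
  divergence supplies q_j' u^2 g; the missing difference is at most 2 b1 u^2 times the sum of the
  V_j, because g \<le> 2 b1 and q_j^2 - q_j' \<le> V_j.\<close>

lemma pointwise_lower_bound:
  fixes w wt wtt q q' V u1 u2 :: "'d::finite \<Rightarrow> real" and w1 w2 :: "'d \<Rightarrow> 'd \<Rightarrow> real" and u ut utt e m n :: real
  assumes e: "0 < e" and m: "m = e + u\<^sup>2" and n: "n = e + (\<Sum>i\<in>UNIV. (w i)\<^sup>2)"
    and u2: "utt + (\<Sum>j\<in>UNIV. u2 j) = (\<Sum>j\<in>UNIV. V j) * u"
    and w2: "\<And>i. wtt i + (\<Sum>j\<in>UNIV. w2 j i) = ((\<Sum>j\<in>UNIV. V j) + 2 * q' i) * w i"
    and V: "\<And>j. 0 \<le> V j" "\<And>j. (q j)\<^sup>2 - q' j \<le> V j" and q': "\<And>j. 0 \<le> q' j"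
  shows "c * \<bar>\<Sum>i\<in>UNIV. (u1 i + q i * u) * wt i\<bar>
    \<le> (b11 m n * (2 * (u * ut)) + b12 m n * (2 * (\<Sum>i\<in>UNIV. w i * wt i))) * (2 * (u * ut))
      + b1 m n * (2 * (ut\<^sup>2 + u * utt))
      + (b12 m n * (2 * (u * ut)) + b22 m n * (2 * (\<Sum>i\<in>UNIV. w i * wt i))) * (2 * (\<Sum>i\<in>UNIV. w i * wt i))
      + b2 m n * (2 * (\<Sum>i\<in>UNIV. (wt i)\<^sup>2 + w i * wtt i))
      + (\<Sum>j\<in>UNIV.
           (b11 m n * (2 * (u * u1 j)) + b12 m n * (2 * (\<Sum>i\<in>UNIV. w i * w1 j i))) * (2 * (u * u1 j))
           + b1 m n * (2 * ((u1 j)\<^sup>2 + u * u2 j))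
           + (b12 m n * (2 * (u * u1 j)) + b22 m n * (2 * (\<Sum>i\<in>UNIV. w i * w1 j i))) * (2 * (\<Sum>i\<in>UNIV. w i * w1 j i))
           + b2 m n * (2 * (\<Sum>i\<in>UNIV. (w1 j i)\<^sup>2 + w i * w2 j i))
           + (q' j * u\<^sup>2 * g m n
              + q j * (2 * u * u1 j * g m n
                  + u\<^sup>2 * (g1 m n * (2 * (u * u1 j)) + g2 m n * (2 * (\<Sum>i\<in>UNIV. w i * w1 j i))))))"
    (is "_ \<le> ?R")
proof -
  define N where "N = (\<Sum>i\<in>UNIV. (w i)\<^sup>2)"
  define E where "E v = (\<Sum>i\<in>UNIV. (v i)\<^sup>2)" for v :: "'d \<Rightarrow> real"
  define ip where "ip v = (\<Sum>i\<in>UNIV. w i * v i)" for v :: "'d \<Rightarrow> real"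
  define hess where "hess \<xi> \<eta> = 2 * b1 m n * \<xi>\<^sup>2 + 2 * b2 m n * E \<eta> + 4 * b11 m n * (u * \<xi>)\<^sup>2
        + 8 * b12 m n * (u * \<xi>) * ip \<eta> + 4 * b22 m n * (ip \<eta>)\<^sup>2" for \<xi> \<eta>
  define dG where "dG j = 2 * u * u1 j * g m n + u\<^sup>2 * (g1 m n * (2 * (u * u1 j)) + g2 m n * (2 * ip (w1 j)))" for j
  have N0: "0 \<le> N" "0 \<le> E v" for v by (auto simp: N_def E_def intro: sum_nonneg)
  have mn: "0 < m" "0 < n" using e N0 unfolding m n N_def[symmetric] by (auto intro: add_pos_nonneg)
  have nN: "n = e + N" by (simp add: n N_def)
  have cs: "(ip v)\<^sup>2 \<le> N * E v" for v
    unfolding ip_def N_def E_def by (rule Cauchy_Schwarz_ineq_sum)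
  have T: "0 < T m n" by (rule T_pos[OF mn])
  have t: "T m n * E wt \<le> hess ut wt"
    unfolding hess_def by (rule time[OF e N0 cs m nN])
  have s: "c\<^sup>2 / 4 / T m n * (u1 j + q j * u)\<^sup>2 \<le> hess (u1 j) (w1 j) + q j * dG j + (q j)\<^sup>2 * u\<^sup>2 * g m n" for j
    unfolding hess_def dG_def by (rule space[OF e N0 cs m nN])
  have R: "?R = hess ut wt + (\<Sum>j\<in>UNIV. hess (u1 j) (w1 j) + q j * dG j + q' j * u\<^sup>2 * g m n)
      + 2 * b1 m n * u\<^sup>2 * (\<Sum>j\<in>UNIV. V j) + 2 * b2 m n * (\<Sum>i\<in>UNIV. ((\<Sum>j\<in>UNIV. V j) + 2 * q' i) * (w i)\<^sup>2)"
  proof -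
    have "(\<Sum>i\<in>UNIV. ((\<Sum>j\<in>UNIV. V j) + 2 * q' i) * (w i)\<^sup>2) = (\<Sum>i\<in>UNIV. w i * (wtt i + (\<Sum>j\<in>UNIV. w2 j i)))"
      unfolding w2 by (intro sum.cong) (auto simp: power2_eq_square)
    also have "\<dots> = (\<Sum>i\<in>UNIV. w i * wtt i) + (\<Sum>i\<in>UNIV. \<Sum>j\<in>UNIV. w i * w2 j i)"
      by (simp add: distrib_left sum.distrib sum_distrib_left)
    also have "(\<Sum>i\<in>UNIV. \<Sum>j\<in>UNIV. w i * w2 j i) = (\<Sum>j\<in>UNIV. \<Sum>i\<in>UNIV. w i * w2 j i)"
      by (rule sum.swap)
    finally have W: "(\<Sum>i\<in>UNIV. ((\<Sum>j\<in>UNIV. V j) + 2 * q' i) * (w i)\<^sup>2)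
      = (\<Sum>i\<in>UNIV. w i * wtt i) + (\<Sum>j\<in>UNIV. \<Sum>i\<in>UNIV. w i * w2 j i)" .
    have "u\<^sup>2 * (\<Sum>j\<in>UNIV. V j) = u * (utt + (\<Sum>j\<in>UNIV. u2 j))" unfolding u2 by (simp add: power2_eq_square)
    then have U: "u\<^sup>2 * (\<Sum>j\<in>UNIV. V j) = u * utt + (\<Sum>j\<in>UNIV. u * u2 j)"
      by (simp add: distrib_left sum_distrib_left)
    have "?R = hess ut wt + 2 * b1 m n * (u * utt) + 2 * b2 m n * (\<Sum>i\<in>UNIV. w i * wtt i)
       + (\<Sum>j\<in>UNIV. hess (u1 j) (w1 j) + q j * dG j + q' j * u\<^sup>2 * g m n
           + 2 * b1 m n * (u * u2 j) + 2 * b2 m n * (\<Sum>i\<in>UNIV. w i * w2 j i))"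
    proof -
      have 1: "(b11 m n * (2 * (u * \<xi>)) + b12 m n * (2 * ip \<eta>)) * (2 * (u * \<xi>)) + b1 m n * (2 * (\<xi>\<^sup>2 + u * \<xi>'))
         + (b12 m n * (2 * (u * \<xi>)) + b22 m n * (2 * ip \<eta>)) * (2 * ip \<eta>)
         + b2 m n * (2 * (\<Sum>i\<in>UNIV. (\<eta> i)\<^sup>2 + w i * \<eta>' i))
         = hess \<xi> \<eta> + 2 * b1 m n * (u * \<xi>') + 2 * b2 m n * (\<Sum>i\<in>UNIV. w i * \<eta>' i)" for \<xi> \<xi>' \<eta> \<eta>'
        unfolding hess_def E_def by (simp add: sum.distrib power2_eq_square algebra_simps)
      show ?thesis
        unfolding ip_def[symmetric] 1 dG_def[symmetric]
        by (simp only: add_ac)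
    qed
    also have "\<dots> = hess ut wt + (\<Sum>j\<in>UNIV. hess (u1 j) (w1 j) + q j * dG j + q' j * u\<^sup>2 * g m n)
       + 2 * b1 m n * (u * utt + (\<Sum>j\<in>UNIV. u * u2 j))
       + 2 * b2 m n * ((\<Sum>i\<in>UNIV. w i * wtt i) + (\<Sum>j\<in>UNIV. \<Sum>i\<in>UNIV. w i * w2 j i))"
      by (simp add: sum.distrib sum_distrib_left[symmetric] distrib_left mult.assoc)
    finally show ?thesis unfolding U[symmetric] W[symmetric] by simp
  qed
  have SV: "0 \<le> (\<Sum>j\<in>UNIV. V j)" using V by (simp add: sum_nonneg)
  have 1: "0 \<le> 2 * b2 m n * (\<Sum>i\<in>UNIV. ((\<Sum>j\<in>UNIV. V j) + 2 * q' i) * (w i)\<^sup>2)"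
    using b2_nonneg[OF mn] SV q' by (intro mult_nonneg_nonneg sum_nonneg) auto
  have 2: "g m n * u\<^sup>2 * (\<Sum>j\<in>UNIV. (q j)\<^sup>2 - q' j) \<le> 2 * b1 m n * u\<^sup>2 * (\<Sum>j\<in>UNIV. V j)"
  proof -
    have "g m n * u\<^sup>2 * (\<Sum>j\<in>UNIV. (q j)\<^sup>2 - q' j) \<le> g m n * u\<^sup>2 * (\<Sum>j\<in>UNIV. V j)"
      using g_nonneg[OF mn] V by (intro mult_left_mono sum_mono) auto
    also have "\<dots> \<le> 2 * b1 m n * u\<^sup>2 * (\<Sum>j\<in>UNIV. V j)"
      using g_le[OF mn] SV by (intro mult_right_mono) auto
    finally show ?thesis .
  qed
  have 3: "(\<Sum>j\<in>UNIV. hess (u1 j) (w1 j) + q j * dG j + q' j * u\<^sup>2 * g m n) + g m n * u\<^sup>2 * (\<Sum>j\<in>UNIV. (q j)\<^sup>2 - q' j)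
    = (\<Sum>j\<in>UNIV. hess (u1 j) (w1 j) + q j * dG j + (q j)\<^sup>2 * u\<^sup>2 * g m n)"
    unfolding sum_distrib_left sum.distrib[symmetric] by (intro sum.cong) (auto simp: algebra_simps)
  have 4: "c\<^sup>2 / 4 / T m n * (\<Sum>j\<in>UNIV. (u1 j + q j * u)\<^sup>2)
     \<le> (\<Sum>j\<in>UNIV. hess (u1 j) (w1 j) + q j * dG j + (q j)\<^sup>2 * u\<^sup>2 * g m n)"
    unfolding sum_distrib_left by (intro sum_mono s)
  define X where "X = sqrt (\<Sum>j\<in>UNIV. (u1 j + q j * u)\<^sup>2)"
  define Y where "Y = sqrt (E wt)"
  have XY: "X\<^sup>2 = (\<Sum>j\<in>UNIV. (u1 j + q j * u)\<^sup>2)" "Y\<^sup>2 = E wt"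
    unfolding X_def Y_def using N0 by (auto intro: real_sqrt_pow2 sum_nonneg)
  have "\<bar>\<Sum>i\<in>UNIV. (u1 i + q i * u) * wt i\<bar> \<le> X * Y"
  proof -
    have "(\<Sum>i\<in>UNIV. (u1 i + q i * u) * wt i)\<^sup>2 \<le> X\<^sup>2 * Y\<^sup>2"
      unfolding XY E_def by (rule Cauchy_Schwarz_ineq_sum)
    then have "\<bar>\<Sum>i\<in>UNIV. (u1 i + q i * u) * wt i\<bar> \<le> \<bar>X * Y\<bar>"
      unfolding abs_le_square_iff power_mult_distrib .
    moreover have "0 \<le> X * Y" unfolding X_def Y_def by (simp add: N0 sum_nonneg)
    ultimately show ?thesis by simp
  qed
  then have "c * \<bar>\<Sum>i\<in>UNIV. (u1 i + q i * u) * wt i\<bar> \<le> c * (X * Y)"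
    using c_pos by simp
  also have "\<dots> \<le> c\<^sup>2 / 4 / T m n * X\<^sup>2 + T m n * Y\<^sup>2"
  proof -
    have "0 \<le> c\<^sup>2 / 4 / T m n * X\<^sup>2 + (- c) * X * Y + T m n * Y\<^sup>2"
      using T c_pos by (intro weighted_AMGM) auto
    then show ?thesis by simp
  qed
  also have "\<dots> \<le> ?R"
    unfolding R XY using 1 2 3 4 t by linarith
  finally show ?thesis .
qed

end

text \<open>\<open>H i n\<close> is \<open>\<delta>\<^sub>i\<close> applied to the eigenfunction \<open>A i n\<close> of the one-dimensional operator \<open>\<delta>\<^sub>i\<^sup>* \<delta>\<^sub>i + a0 i\<close>, where
  \<open>\<delta>\<^sub>i = d/dx + q i\<close>, with eigenvalue \<open>ev i n + a0 i\<close>.\<close>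

locale ladder_system =
  fixes A H :: "'d::finite \<Rightarrow> nat \<Rightarrow> real \<Rightarrow> real" and q q' :: "'d \<Rightarrow> real \<Rightarrow> real"
    and ev :: "'d \<Rightarrow> nat \<Rightarrow> real" and a0 :: "'d \<Rightarrow> real"
  assumes deriv_A: "\<And>i n x. 0 < x \<Longrightarrow> x < pi \<Longrightarrow> (A i n has_real_derivative H i n x - q i x * A i n x) (at x)"
    and deriv_H: "\<And>i n x. 0 < x \<Longrightarrow> x < pi \<Longrightarrow> (H i n has_real_derivative q i x * H i n x - ev i n * A i n x) (at x)"
    and deriv_q: "\<And>i x. 0 < x \<Longrightarrow> x < pi \<Longrightarrow> (q i has_real_derivative q' i x) (at x)"
    and q'_nonneg: "\<And>i x. 0 < x \<Longrightarrow> x < pi \<Longrightarrow> 0 \<le> q' i x"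
    and V_nonneg: "\<And>i x. 0 < x \<Longrightarrow> x < pi \<Longrightarrow> 0 \<le> (q i x)\<^sup>2 - q' i x + a0 i"
    and cont_A: "\<And>i n. continuous_on {0..pi} (A i n)" and cont_H: "\<And>i n. continuous_on {0..pi} (H i n)"
    and bound_A: "\<And>i n. \<exists>C. \<forall>x\<in>{0..pi}. \<bar>A i n x\<bar> \<le> C * sin x"
    and bound_H: "\<And>i n. \<exists>C. \<forall>x\<in>{0..pi}. \<bar>H i n x\<bar> \<le> C * sin x"
    and bound_q: "\<And>i. \<exists>C. \<forall>x\<in>{0<..<pi}. \<bar>q i x\<bar> * sin x \<le> C"
    and bound_q': "\<And>i. \<exists>C. \<forall>x\<in>{0<..<pi}. \<bar>q' i x\<bar> * (sin x)\<^sup>2 \<le> C"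
    and ev_nonneg: "\<And>i n. 0 \<le> ev i n" and ev_inj: "\<And>i. inj (ev i)"
    and a0_pos: "\<And>i. 0 < a0 i"
begin

text \<open>The flag \<open>st\<close> tells whether \<delta> has been applied. Both families solve
  f'' = (pot - ev) f, with potential q^2 - q' before and q^2 + q' after applying \<delta>.\<close>

definition f :: "'d \<Rightarrow> bool \<Rightarrow> nat \<Rightarrow> real \<Rightarrow> real" where
  "f i st n = (if st then H i n else A i n)"

definition f' :: "'d \<Rightarrow> bool \<Rightarrow> nat \<Rightarrow> real \<Rightarrow> real" where
  "f' i st n x = (if st then q i x * H i n x - ev i n * A i n x else H i n x - q i x * A i n x)"

definition pot :: "'d \<Rightarrow> bool \<Rightarrow> real \<Rightarrow> real" where
  "pot i st x = (q i x)\<^sup>2 + (if st then q' i x else - q' i x)"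

text \<open>\<open>S\<close> collects the coordinates in which \<delta> has been applied. The empty
  set gives the eigenfunctions of L, and {i} gives their images under \<delta>_i, which are
  eigenfunctions of M_i with the same eigenvalue \<open>lam\<close>.\<close>

definition \<Psi> :: "'d set \<Rightarrow> nat ^ 'd \<Rightarrow> real ^ 'd \<Rightarrow> real" where
  "\<Psi> S k x = (\<Prod>i\<in>UNIV. f i (i \<in> S) (k $ i) (x $ i))"

definition \<Psi>' :: "'d \<Rightarrow> 'd set \<Rightarrow> nat ^ 'd \<Rightarrow> real ^ 'd \<Rightarrow> real" where
  "\<Psi>' j S k x = f' j (j \<in> S) (k $ j) (x $ j) * (\<Prod>i\<in>UNIV - {j}. f i (i \<in> S) (k $ i) (x $ i))"

definition lam :: "nat ^ 'd \<Rightarrow> real" where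
  "lam k = (\<Sum>i\<in>UNIV. ev i (k $ i) + a0 i)"

definition mu :: "nat ^ 'd \<Rightarrow> real" where
  "mu k = sqrt (lam k)"

lemma lam_pos: "0 < lam k"
  unfolding lam_def using ev_nonneg a0_pos by (intro sum_pos) (auto intro: add_nonneg_pos)

lemma mu_pos: "0 < mu k" and mu_sq: "mu k * mu k = lam k"
  using lam_pos[of k] by (auto simp: mu_def)

lemma deriv_f: "0 < x \<Longrightarrow> x < pi \<Longrightarrow> (f i st n has_real_derivative f' i st n x) (at x)"
  using deriv_A[of x i n] deriv_H[of x i n] by (auto simp: f_def f'_def)

lemma deriv_f':
  assumes "0 < x" "x < pi"
  shows "(f' i st n has_real_derivative (pot i st x - ev i n) * f i st n x) (at x)"
  unfolding f'_def[abs_def] f_def pot_def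
  by (cases st) (auto intro!: derivative_eq_intros deriv_A deriv_H deriv_q assms simp: algebra_simps power2_eq_square)

lemma \<Psi>_split: "\<Psi> S k x = f j (j \<in> S) (k $ j) (x $ j) * (\<Prod>i\<in>UNIV - {j}. f i (i \<in> S) (k $ i) (x $ i))"
  unfolding \<Psi>_def by (subst prod.remove[of _ j]) auto

lemma deriv_\<Psi>:
  assumes "x \<in> cube"
  shows "((\<lambda>s. \<Psi> S k (upd j x s)) has_real_derivative \<Psi>' j S k x) (at (x $ j))"
proof -
  have "((\<lambda>s. f j (j \<in> S) (k $ j) s * (\<Prod>i\<in>UNIV - {j}. f i (i \<in> S) (k $ i) (x $ i))) has_real_derivative \<Psi>' j S k x) (at (x $ j))"
    unfolding \<Psi>'_def using cube_nth[OF assms] by (intro DERIV_cmult_right deriv_f) auto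
  moreover have "\<Psi> S k (upd j x s) = f j (j \<in> S) (k $ j) s * (\<Prod>i\<in>UNIV - {j}. f i (i \<in> S) (k $ i) (x $ i))" for s
    unfolding \<Psi>_split[of S k _ j] by simp
  ultimately show ?thesis by simp
qed

lemma deriv_\<Psi>':
  assumes "x \<in> cube"
  shows "((\<lambda>s. \<Psi>' j S k (upd j x s)) has_real_derivative (pot j (j \<in> S) (x $ j) - ev j (k $ j)) * \<Psi> S k x) (at (x $ j))"
proof -
  have "((\<lambda>s. f' j (j \<in> S) (k $ j) s * (\<Prod>i\<in>UNIV - {j}. f i (i \<in> S) (k $ i) (x $ i))) has_real_derivative
      ((pot j (j \<in> S) (x $ j) - ev j (k $ j)) * f j (j \<in> S) (k $ j) (x $ j)) * (\<Prod>i\<in>UNIV - {j}. f i (i \<in> S) (k $ i) (x $ i))) (at (x $ j))"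
    using cube_nth[OF assms] by (intro DERIV_cmult_right deriv_f') auto
  moreover have "\<Psi>' j S k (upd j x s) = f' j (j \<in> S) (k $ j) s * (\<Prod>i\<in>UNIV - {j}. f i (i \<in> S) (k $ i) (x $ i))" for s
    unfolding \<Psi>'_def by simp
  ultimately show ?thesis by (simp add: \<Psi>_split[of S k x j] mult.assoc)
qed

lemma \<Psi>'_empty: "\<Psi>' j {} k x = \<Psi> {j} k x - q j (x $ j) * \<Psi> {} k x"
proof -
  have "(\<Prod>i\<in>UNIV - {j}. f i (i \<in> {j}) (k $ i) (x $ i)) = (\<Prod>i\<in>UNIV - {j}. f i (i \<in> {}) (k $ i) (x $ i))"
    by (intro prod.cong) auto
  then show ?thesis
    unfolding \<Psi>'_def \<Psi>_split[of "{j}" k x j] \<Psi>_split[of "{}" k x j] by (simp add: f'_def f_def algebra_simps)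
qed

lemma \<Psi>'_single: "\<Psi>' j {j} k x = q j (x $ j) * \<Psi> {j} k x - ev j (k $ j) * \<Psi> {} k x"
proof -
  have "(\<Prod>i\<in>UNIV - {j}. f i (i \<in> {j}) (k $ i) (x $ i)) = (\<Prod>i\<in>UNIV - {j}. f i (i \<in> {}) (k $ i) (x $ i))"
    by (intro prod.cong) auto
  then show ?thesis
    unfolding \<Psi>'_def \<Psi>_split[of "{j}" k x j] \<Psi>_split[of "{}" k x j] by (simp add: f'_def f_def algebra_simps)
qed

lemma bound_f: "\<exists>C\<ge>0. \<forall>x\<in>{0..pi}. \<bar>f i st n x\<bar> \<le> C * sin x"
proof -
  obtain C where C: "\<forall>x\<in>{0..pi}. \<bar>f i st n x\<bar> \<le> C * sin x"
    using bound_A[of i n] bound_H[of i n] by (cases st) (auto simp: f_def)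
  have "0 \<le> C" using bspec[OF C, of "pi/2"] by simp
  with C show ?thesis by blast
qed

lemma bound_f': "\<exists>C\<ge>0. \<forall>x\<in>{0<..<pi}. \<bar>f' i st n x\<bar> \<le> C"
proof -
  obtain C1 where C1: "0 \<le> C1" "\<forall>x\<in>{0..pi}. \<bar>f i True n x\<bar> \<le> C1 * sin x" using bound_f by blast
  obtain C2 where C2: "0 \<le> C2" "\<forall>x\<in>{0..pi}. \<bar>f i False n x\<bar> \<le> C2 * sin x" using bound_f by blast
  obtain C3 where C3: "\<forall>x\<in>{0<..<pi}. \<bar>q i x\<bar> * sin x \<le> C3" using bound_q by blast
  have "0 \<le> C3" using bspec[OF C3, of "pi/2"] by (simp add: order_trans[OF abs_ge_zero])
  have "\<bar>f' i st n x\<bar> \<le> C3 * C1 + ev i n * C2 + C1 + C3 * C2" if x: "x \<in> {0<..<pi}" for x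
  proof -
    have s: "0 \<le> sin x" "sin x \<le> 1" using x by (auto intro: less_imp_le sin_gt_zero)
    have H: "\<bar>H i n x\<bar> \<le> C1 * sin x" and A: "\<bar>A i n x\<bar> \<le> C2 * sin x" using C1 C2 x by (auto simp: f_def)
    have qH: "\<bar>q i x * H i n x\<bar> \<le> C3 * C1"
    proof -
      have "\<bar>q i x * H i n x\<bar> \<le> \<bar>q i x\<bar> * (C1 * sin x)" unfolding abs_mult by (intro mult_left_mono H) auto
      also have "\<dots> = (\<bar>q i x\<bar> * sin x) * C1" by simp
      also have "\<dots> \<le> C3 * C1" using C3 x C1 by (intro mult_right_mono) auto
      finally show ?thesis .
    qed
    have qA: "\<bar>q i x * A i n x\<bar> \<le> C3 * C2"
    proof -
      have "\<bar>q i x * A i n x\<bar> \<le> \<bar>q i x\<bar> * (C2 * sin x)" unfolding abs_mult by (intro mult_left_mono A) auto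
      also have "\<dots> = (\<bar>q i x\<bar> * sin x) * C2" by simp
      also have "\<dots> \<le> C3 * C2" using C3 x C2 by (intro mult_right_mono) auto
      finally show ?thesis .
    qed
    have "C1 * sin x \<le> C1" "C2 * sin x \<le> C2" using s C1 C2 by (auto intro: mult_left_le)
    then have "\<bar>H i n x\<bar> \<le> C1" "\<bar>A i n x\<bar> \<le> C2" using H A by auto
    moreover from this have "\<bar>ev i n * A i n x\<bar> \<le> ev i n * C2"
      unfolding abs_mult using ev_nonneg[of i n] by (simp add: mult_left_mono)
    moreover have "0 \<le> ev i n * C2" "0 \<le> C3 * C1" "0 \<le> C3 * C2" using ev_nonneg[of i n] C1 C2 \<open>0 \<le> C3\<close> by auto
    ultimately show ?thesis using qH qA C1(1) C2(1) unfolding f'_def by auto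
  qed
  moreover have "0 \<le> C3 * C1 + ev i n * C2 + C1 + C3 * C2" using ev_nonneg[of i n] C1 C2 \<open>0 \<le> C3\<close> by auto
  ultimately show ?thesis by blast
qed

lemma bound_prod_f: "\<exists>C\<ge>0. \<forall>x\<in>ccube. \<bar>\<Prod>i\<in>I. f i (i \<in> S) (k $ i) (x $ i)\<bar> \<le> C"
proof -
  have "\<forall>i. \<exists>C. 0 \<le> C \<and> (\<forall>x\<in>{0..pi}. \<bar>f i (i \<in> S) (k $ i) x\<bar> \<le> C * sin x)"
    using bound_f by blast
  from choice[OF this] obtain C where
    C: "\<And>i. 0 \<le> C i" "\<And>i x. x \<in> {0..pi} \<Longrightarrow> \<bar>f i (i \<in> S) (k $ i) x\<bar> \<le> C i * sin x"
    by blast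
  have "\<bar>\<Prod>i\<in>I. f i (i \<in> S) (k $ i) (x $ i)\<bar> \<le> (\<Prod>i\<in>I. C i)" if x: "x \<in> ccube" for x
    unfolding abs_prod
  proof (intro prod_mono conjI)
    fix i
    have "C i * sin (x $ i) \<le> C i" using C(1)[of i] by (intro mult_left_le) auto
    then show "\<bar>f i (i \<in> S) (k $ i) (x $ i)\<bar> \<le> C i" using C(2)[of "x $ i" i] x by (auto simp: mem_ccube)
  qed auto
  then show ?thesis using C(1) by (intro exI[of _ "prod C I"]) (auto intro: prod_nonneg)
qed

lemma bound_\<Psi>: "\<exists>C\<ge>0. \<forall>x\<in>ccube. \<bar>\<Psi> S k x\<bar> \<le> C * sin (x $ j)"
proof -
  obtain C1 where C1: "C1 \<ge> 0" "\<And>x. x \<in> {0..pi} \<Longrightarrow> \<bar>f j (j \<in> S) (k $ j) x\<bar> \<le> C1 * sin x"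
    using bound_f by blast
  obtain C2 where C2: "C2 \<ge> 0" "\<And>x. x \<in> ccube \<Longrightarrow> \<bar>\<Prod>i\<in>UNIV - {j}. f i (i \<in> S) (k $ i) (x $ i)\<bar> \<le> C2"
    using bound_prod_f by blast
  have "\<bar>\<Psi> S k x\<bar> \<le> C1 * C2 * sin (x $ j)" if "x \<in> ccube" for x
  proof -
    have "x $ j \<in> {0..pi}" using that by (auto simp: mem_ccube)
    from mult_mono[OF C1(2)[OF this] C2(2)[OF that]] show ?thesis
      using C1(1) C2(1) \<open>x $ j \<in> {0..pi}\<close>
      unfolding \<Psi>_split[of S k x j] abs_mult by (simp add: mult_ac sin_ge_zero)
  qed
  then show ?thesis using C1(1) C2(1) by (intro exI[of _ "C1 * C2"]) auto
qed

lemma bound_\<Psi>': "\<exists>C\<ge>0. \<forall>x\<in>cube. \<bar>\<Psi>' j S k x\<bar> \<le> C"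
proof -
  obtain C1 where C1: "C1 \<ge> 0" "\<And>x. x \<in> {0<..<pi} \<Longrightarrow> \<bar>f' j (j \<in> S) (k $ j) x\<bar> \<le> C1"
    using bound_f' by blast
  obtain C2 where C2: "C2 \<ge> 0" "\<And>x. x \<in> ccube \<Longrightarrow> \<bar>\<Prod>i\<in>UNIV - {j}. f i (i \<in> S) (k $ i) (x $ i)\<bar> \<le> C2"
    using bound_prod_f by blast
  have "\<bar>\<Psi>' j S k x\<bar> \<le> C1 * C2" if "x \<in> cube" for x
    unfolding \<Psi>'_def abs_mult using C1 C2 cube_nth[OF that] cube_subset_ccube that
    by (intro mult_mono) auto
  then show ?thesis using C1(1) C2(1) by (intro exI[of _ "C1 * C2"]) auto
qed

lemma continuous_f: "continuous_on {0..pi} (f i st n)"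
  using cont_A cont_H by (cases st) (auto simp: f_def)

lemma continuous_\<Psi>: "continuous_on ccube (\<Psi> S k)"
proof -
  have *: "continuous_on ccube (\<lambda>x. f i (i \<in> S) (k $ i) (x $ i))" for i
  proof (rule continuous_on_compose2[OF continuous_f, where f = "\<lambda>x. x $ i"])
    show "continuous_on ccube (\<lambda>x. x $ i)" by (intro continuous_intros)
    show "(\<lambda>x. x $ i) ` ccube \<subseteq> {0..pi}" by (auto simp: mem_ccube)
  qed
  show ?thesis unfolding \<Psi>_def[abs_def] by (rule continuous_on_prod) (rule *)
qed

lemma continuous_q: "continuous_on cube (\<lambda>x. q i (x $ i))"
proof -
  have "continuous_on {0<..<pi} (q i)"
    by (rule DERIV_continuous_on[where D = "q' i"]) (use deriv_q in \<open>auto intro: DERIV_subset[OF _ subset_UNIV]\<close>)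
  then show ?thesis
  proof (rule continuous_on_compose2[where f = "\<lambda>x. x $ i"])
    show "continuous_on cube (\<lambda>x. x $ i)" by (intro continuous_intros)
    show "(\<lambda>x. x $ i) ` cube \<subseteq> {0<..<pi}" by (auto simp: cube_nth)
  qed
qed

lemma continuous_\<Psi>': "continuous_on cube (\<Psi>' j S k)"
proof -
  have "continuous_on {0<..<pi} (f' j (j \<in> S) (k $ j))"
    by (rule DERIV_continuous_on[where D = "\<lambda>x. (pot j (j \<in> S) x - ev j (k $ j)) * f j (j \<in> S) (k $ j) x"]) (use deriv_f' in \<open>auto intro: DERIV_subset[OF _ subset_UNIV]\<close>)
  then have *: "continuous_on cube (\<lambda>x. f' j (j \<in> S) (k $ j) (x $ j))"
  proof (rule continuous_on_compose2[where f = "\<lambda>x. x $ j"])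
    show "continuous_on cube (\<lambda>x. x $ j)" by (intro continuous_intros)
    show "(\<lambda>x. x $ j) ` cube \<subseteq> {0<..<pi}" by (auto simp: cube_nth)
  qed
  have **: "continuous_on cube (\<lambda>x. f i (i \<in> S) (k $ i) (x $ i))" for i
  proof (rule continuous_on_compose2[OF continuous_f, where f = "\<lambda>x. x $ i"])
    show "continuous_on cube (\<lambda>x. x $ i)" by (intro continuous_intros)
    show "(\<lambda>x. x $ i) ` cube \<subseteq> {0..pi}" by (auto simp: cube_nth less_imp_le)
  qed
  show ?thesis
    unfolding \<Psi>'_def[abs_def] by (rule continuous_on_mult[OF *], rule continuous_on_prod) (rule **)
qed

lemma integrable_\<Psi>_mult: "integrable cube_measure (\<lambda>x. \<Psi> S k x * \<Psi> S' l x)"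
  by (intro integral_ccube continuous_intros continuous_\<Psi>)

text \<open>Integrate the j-th partial derivative of \<open>\<Psi> {j} k * \<Psi> {} l\<close>; the
  two terms containing q_j cancel.\<close>

lemma integral_\<Psi>_single:
  "(\<integral>x. \<Psi> {j} k x * \<Psi> {j} l x \<partial>cube_measure) = ev j (k $ j) * (\<integral>x. \<Psi> {} k x * \<Psi> {} l x \<partial>cube_measure)"
proof -
  obtain C1 where C1: "0 \<le> C1" "\<And>x. x \<in> ccube \<Longrightarrow> \<bar>\<Psi> {j} k x\<bar> \<le> C1 * sin (x $ j)" using bound_\<Psi> by blast
  obtain C2 where C2: "0 \<le> C2" "\<And>x. x \<in> ccube \<Longrightarrow> \<bar>\<Psi> {} l x\<bar> \<le> C2 * sin (x $ j)" using bound_\<Psi> by blast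
  obtain C3 where C3: "0 \<le> C3" "\<And>x. x \<in> ccube \<Longrightarrow> \<bar>\<Psi> {j} l x\<bar> \<le> C3 * sin (x $ j)" using bound_\<Psi> by blast
  obtain C4 where C4: "0 \<le> C4" "\<And>x. x \<in> ccube \<Longrightarrow> \<bar>\<Psi> {} k x\<bar> \<le> C4 * sin (x $ j)" using bound_\<Psi> by blast
  define D where "D x = \<Psi> {j} k x * \<Psi> {j} l x - ev j (k $ j) * (\<Psi> {} k x * \<Psi> {} l x)" for x
  define C where "C = C1 * C2 + C1 * C3 + ev j (k $ j) * (C4 * C2)"
  have "(\<integral>x. D x \<partial>cube_measure) = 0"
  proof (rule integral_partial_derivative)
    show "continuous_on cube (\<lambda>x. \<Psi> {j} k x * \<Psi> {} l x)"
      by (intro continuous_intros continuous_on_subset[OF continuous_\<Psi> cube_subset_ccube])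
  next
    fix x :: "real ^ 'd" assume x: "x \<in> cube"
    then have xc: "x \<in> ccube" using cube_subset_ccube by auto
    have s: "0 \<le> sin (x $ j)" "sin (x $ j) \<le> 1" using sin_pos_cube[OF x, of j] by auto
    have prod: "\<bar>a * b\<bar> \<le> Ca * Cb * sin (x $ j)"
      if "\<bar>a\<bar> \<le> Ca * sin (x $ j)" "\<bar>b\<bar> \<le> Cb * sin (x $ j)" "0 \<le> Ca" "0 \<le> Cb" for a b Ca Cb
    proof -
      have "\<bar>b\<bar> \<le> Cb" using that(2) mult_left_le[OF s(2) that(4)] by linarith
      then have "\<bar>a\<bar> * \<bar>b\<bar> \<le> (Ca * sin (x $ j)) * Cb" using that s by (intro mult_mono) auto
      then show ?thesis by (simp add: abs_mult mult_ac)
    qed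
    have p: "\<bar>\<Psi> {j} k x * \<Psi> {} l x\<bar> \<le> C1 * C2 * sin (x $ j)" "\<bar>\<Psi> {j} k x * \<Psi> {j} l x\<bar> \<le> C1 * C3 * sin (x $ j)"
      "\<bar>\<Psi> {} k x * \<Psi> {} l x\<bar> \<le> C4 * C2 * sin (x $ j)"
      using prod C1 C2 C3 C4 xc by auto
    have Cle: "C1 * C2 \<le> C" "C1 * C3 + ev j (k $ j) * (C4 * C2) \<le> C" unfolding C_def
      using C1 C2 C3 C4 ev_nonneg[of j "k $ j"] by auto
    show "\<bar>\<Psi> {j} k x * \<Psi> {} l x\<bar> \<le> C * sin (x $ j)"
      using p(1) mult_right_mono[OF Cle(1) s(1)] by linarith
    show "\<bar>D x\<bar> \<le> C"
    proof -
      have le: "t * sin (x $ j) \<le> t" if "0 \<le> t" for t using mult_left_le[OF s(2) that] .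
      have "\<bar>\<Psi> {j} k x * \<Psi> {j} l x\<bar> \<le> C1 * C3" "\<bar>\<Psi> {} k x * \<Psi> {} l x\<bar> \<le> C4 * C2"
        using p(2,3) le[of "C1 * C3"] le[of "C4 * C2"] C1 C2 C3 C4 by auto
      moreover from this(2) have "ev j (k $ j) * \<bar>\<Psi> {} k x * \<Psi> {} l x\<bar> \<le> ev j (k $ j) * (C4 * C2)"
        using ev_nonneg[of j "k $ j"] by (intro mult_left_mono)
      moreover have "\<bar>D x\<bar> \<le> \<bar>\<Psi> {j} k x * \<Psi> {j} l x\<bar> + ev j (k $ j) * \<bar>\<Psi> {} k x * \<Psi> {} l x\<bar>"
        unfolding D_def using ev_nonneg[of j "k $ j"]
        by (metis abs_mult abs_of_nonneg abs_triangle_ineq4)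
      ultimately show ?thesis using Cle(2) by linarith
    qed
    show "((\<lambda>s. \<Psi> {j} k (upd j x s) * \<Psi> {} l (upd j x s)) has_real_derivative D x) (at (x $ j))"
      by (rule DERIV_cong[OF DERIV_mult[OF deriv_\<Psi>[OF x] deriv_\<Psi>[OF x]]])
         (simp add: \<Psi>'_single \<Psi>'_empty D_def algebra_simps)
  qed
  then show ?thesis
    unfolding D_def using integrable_\<Psi>_mult by simp
qed

text \<open>The left side of \<open>integral_\<Psi>_single\<close> is symmetric in k and l, so
  multiplying the inner product by two different values of \<open>ev\<close> gives the same
  number.\<close>

lemma orthogonal:
  assumes "k \<noteq> l"
  shows "(\<integral>x. \<Psi> {} k x * \<Psi> {} l x \<partial>cube_measure) = 0"
proof -
  obtain j where "k $ j \<noteq> l $ j" using assms by (auto simp: vec_eq_iff)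
  then have "ev j (k $ j) \<noteq> ev j (l $ j)" using ev_inj[of j] by (auto dest: injD)
  moreover have "ev j (k $ j) * (\<integral>x. \<Psi> {} k x * \<Psi> {} l x \<partial>cube_measure)
    = ev j (l $ j) * (\<integral>x. \<Psi> {} k x * \<Psi> {} l x \<partial>cube_measure)"
    using integral_\<Psi>_single[of j k l] integral_\<Psi>_single[of j l k] by (simp add: mult.commute)
  ultimately show ?thesis by simp
qed

end

section \<open>Bounded functions on the open cube\<close>

definition bdd_cube :: "(real ^ 'd \<Rightarrow> real) \<Rightarrow> bool" where
  "bdd_cube f \<longleftrightarrow> (\<exists>C. \<forall>x\<in>cube. \<bar>f x\<bar> \<le> C)"

lemma bdd_cube_const: "bdd_cube (\<lambda>x. c)"
  by (auto simp: bdd_cube_def)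

lemma bdd_cube_add: "bdd_cube f \<Longrightarrow> bdd_cube g \<Longrightarrow> bdd_cube (\<lambda>x. f x + g x)"
proof -
  assume "bdd_cube f" "bdd_cube g"
  then obtain C D where "\<forall>x\<in>cube. \<bar>f x\<bar> \<le> C" "\<forall>x\<in>cube. \<bar>g x\<bar> \<le> D" by (auto simp: bdd_cube_def)
  then have "\<forall>x\<in>cube. \<bar>f x + g x\<bar> \<le> C + D" by (auto intro: order_trans[OF abs_triangle_ineq add_mono])
  then show ?thesis unfolding bdd_cube_def by blast
qed

lemma bdd_cube_mult: "bdd_cube f \<Longrightarrow> bdd_cube g \<Longrightarrow> bdd_cube (\<lambda>x. f x * g x)"
proof -
  assume "bdd_cube f" "bdd_cube g"
  then obtain C D where *: "\<forall>x\<in>cube. \<bar>f x\<bar> \<le> C" "\<forall>x\<in>cube. \<bar>g x\<bar> \<le> D" by (auto simp: bdd_cube_def)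
  have "\<bar>f x * g x\<bar> \<le> C * D" if "x \<in> cube" for x
    unfolding abs_mult using * that by (intro mult_mono) (auto intro: order_trans[OF abs_ge_zero])
  then show ?thesis unfolding bdd_cube_def by blast
qed

lemma bdd_cube_diff: "bdd_cube f \<Longrightarrow> bdd_cube g \<Longrightarrow> bdd_cube (\<lambda>x. f x - g x)"
  using bdd_cube_add[of f "\<lambda>x. (-1) * g x"] bdd_cube_mult[OF bdd_cube_const[of "-1"], of g] by simp

lemma bdd_cube_power2: "bdd_cube f \<Longrightarrow> bdd_cube (\<lambda>x. (f x)\<^sup>2)"
  unfolding power2_eq_square by (rule bdd_cube_mult)

lemma bdd_cube_sum: "(\<And>i. i \<in> I \<Longrightarrow> bdd_cube (f i)) \<Longrightarrow> bdd_cube (\<lambda>x. \<Sum>i\<in>I. f i x)"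
  by (induction I rule: infinite_finite_induct) (auto intro: bdd_cube_add bdd_cube_const)

lemma bdd_cube_continuous:
  assumes "continuous_on ccube f"
  shows "bdd_cube f"
  using compact_imp_bounded[OF compact_continuous_image[OF assms compact_ccube]] cube_subset_ccube
  unfolding bdd_cube_def bounded_iff by force

lemmas bdd_cube_intros = bdd_cube_const bdd_cube_add bdd_cube_mult bdd_cube_diff bdd_cube_power2 bdd_cube_sum

section \<open>The chain rule for the Bellman function\<close>

context bellman_system
begin

text \<open>The variable s plays both the time t and a single coordinate x_j; the third claim serves
  the null Lagrangian.\<close>

lemma derivs_along_line:
  fixes u u1 :: "real \<Rightarrow> real" and w w1 :: "'d::finite \<Rightarrow> real \<Rightarrow> real" and u2 e s :: real and w2 :: "'d \<Rightarrow> real"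
  assumes u: "(u has_real_derivative u1 s) (at s)" and u1: "(u1 has_real_derivative u2) (at s)"
    and w: "\<And>i. (w i has_real_derivative w1 i s) (at s)" and w1: "\<And>i. (w1 i has_real_derivative w2 i) (at s)"
    and e: "0 < e"
  defines "m \<equiv> \<lambda>s. e + (u s)\<^sup>2" and "n \<equiv> \<lambda>s. e + (\<Sum>i\<in>UNIV. (w i s)\<^sup>2)"
  shows "((\<lambda>s. b (m s) (n s)) has_real_derivative
      b1 (m s) (n s) * (2 * (u s * u1 s)) + b2 (m s) (n s) * (2 * (\<Sum>i\<in>UNIV. w i s * w1 i s))) (at s)" (is ?A)
    and "((\<lambda>s. b1 (m s) (n s) * (2 * (u s * u1 s)) + b2 (m s) (n s) * (2 * (\<Sum>i\<in>UNIV. w i s * w1 i s))) has_real_derivative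
      (b11 (m s) (n s) * (2 * (u s * u1 s)) + b12 (m s) (n s) * (2 * (\<Sum>i\<in>UNIV. w i s * w1 i s))) * (2 * (u s * u1 s))
      + b1 (m s) (n s) * (2 * ((u1 s)\<^sup>2 + u s * u2))
      + (b12 (m s) (n s) * (2 * (u s * u1 s)) + b22 (m s) (n s) * (2 * (\<Sum>i\<in>UNIV. w i s * w1 i s))) * (2 * (\<Sum>i\<in>UNIV. w i s * w1 i s))
      + b2 (m s) (n s) * (2 * (\<Sum>i\<in>UNIV. (w1 i s)\<^sup>2 + w i s * w2 i))) (at s)" (is ?B)
    and "((\<lambda>s. (u s)\<^sup>2 * g (m s) (n s)) has_real_derivative
      2 * u s * u1 s * g (m s) (n s)
      + (u s)\<^sup>2 * (g1 (m s) (n s) * (2 * (u s * u1 s)) + g2 (m s) (n s) * (2 * (\<Sum>i\<in>UNIV. w i s * w1 i s)))) (at s)" (is ?C)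
proof -
  have m: "(m has_real_derivative 2 * (u s * u1 s)) (at s)" "0 < m s"
    unfolding m_def using e by (auto intro!: derivative_eq_intros u simp: add_pos_nonneg)
  have n: "(n has_real_derivative 2 * (\<Sum>i\<in>UNIV. w i s * w1 i s)) (at s)" "0 < n s"
    unfolding n_def using e
    by (auto intro!: derivative_eq_intros w sum.cong add_pos_nonneg sum_nonneg simp: sum_distrib_left)
  show ?A by (rule deriv_b[OF m n])
  have uu: "((\<lambda>s. 2 * (u s * u1 s)) has_real_derivative 2 * ((u1 s)\<^sup>2 + u s * u2)) (at s)"
    by (auto intro!: derivative_eq_intros u u1 simp: power2_eq_square)
  have ww: "((\<lambda>s. 2 * (\<Sum>i\<in>UNIV. w i s * w1 i s)) has_real_derivative 2 * (\<Sum>i\<in>UNIV. (w1 i s)\<^sup>2 + w i s * w2 i)) (at s)"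
    by (auto intro!: derivative_eq_intros w w1 sum.cong simp: power2_eq_square)
  show ?B
    by (rule DERIV_cong[OF DERIV_add[OF DERIV_mult[OF deriv_b1[OF m n] uu] DERIV_mult[OF deriv_b2[OF m n] ww]]])
       (simp add: mult_ac)
  have u2: "((\<lambda>s. (u s)\<^sup>2) has_real_derivative 2 * u s * u1 s) (at s)"
    by (auto intro!: derivative_eq_intros u)
  show ?C
    by (rule DERIV_cong[OF DERIV_mult[OF u2 deriv_g[OF m n]]]) (simp add: mult_ac)
qed

lemma continuous_bellman:
  assumes mn: "continuous_on X m" "continuous_on X n" "\<And>x. x \<in> X \<Longrightarrow> 0 < m x" "\<And>x. x \<in> X \<Longrightarrow> 0 < n x"
  shows "continuous_on X (\<lambda>x. b (m x) (n x))"
    "continuous_on X (\<lambda>x. b1 (m x) (n x))"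
    "continuous_on X (\<lambda>x. b2 (m x) (n x))"
    "continuous_on X (\<lambda>x. b11 (m x) (n x))"
    "continuous_on X (\<lambda>x. b12 (m x) (n x))"
    "continuous_on X (\<lambda>x. b22 (m x) (n x))"
    "continuous_on X (\<lambda>x. g (m x) (n x))"
    "continuous_on X (\<lambda>x. g1 (m x) (n x))"
    "continuous_on X (\<lambda>x. g2 (m x) (n x))"
proof -
  have *: "continuous_on X (\<lambda>x. f (m x) (n x))" if f: "f \<in> {b, b1, b2, b11, b12, b22, g, g1, g2}" for f
  proof -
    have "continuous_on X (\<lambda>x. (\<lambda>(m, n). f m n) (m x, n x))"
      by (rule continuous_on_compose2[OF cont[OF f] continuous_on_Pair[OF mn(1,2)]]) (use mn(3,4) in auto)
    then show ?thesis by simp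
  qed
  show "continuous_on X (\<lambda>x. b (m x) (n x))"
    "continuous_on X (\<lambda>x. b1 (m x) (n x))"
    "continuous_on X (\<lambda>x. b2 (m x) (n x))"
    "continuous_on X (\<lambda>x. b11 (m x) (n x))"
    "continuous_on X (\<lambda>x. b12 (m x) (n x))"
    "continuous_on X (\<lambda>x. b22 (m x) (n x))"
    "continuous_on X (\<lambda>x. g (m x) (n x))"
    "continuous_on X (\<lambda>x. g1 (m x) (n x))"
    "continuous_on X (\<lambda>x. g2 (m x) (n x))"
    by (rule *; simp)+
qed

end

section \<open>Poisson extensions of finite combinations\<close>

context ladder_system
begin

text \<open>The Poisson extension of a finite sum of the functions \<open>\<Psi> S k\<close>, for L
  if S is empty and for M_i if S = {i}. A t-derivative only changes the coefficients, which is the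
  task of \<open>dt\<close>.\<close>

definition comb :: "'d set \<Rightarrow> (nat ^ 'd) set \<Rightarrow> (nat ^ 'd \<Rightarrow> real) \<Rightarrow> real \<Rightarrow> real ^ 'd \<Rightarrow> real" where
  "comb S K cf t x = (\<Sum>k\<in>K. cf k * exp (- (t * mu k)) * \<Psi> S k x)"

definition comb' :: "'d \<Rightarrow> 'd set \<Rightarrow> (nat ^ 'd) set \<Rightarrow> (nat ^ 'd \<Rightarrow> real) \<Rightarrow> real \<Rightarrow> real ^ 'd \<Rightarrow> real" where
  "comb' j S K cf t x = (\<Sum>k\<in>K. cf k * exp (- (t * mu k)) * \<Psi>' j S k x)"

definition comb'' :: "'d \<Rightarrow> 'd set \<Rightarrow> (nat ^ 'd) set \<Rightarrow> (nat ^ 'd \<Rightarrow> real) \<Rightarrow> real \<Rightarrow> real ^ 'd \<Rightarrow> real" where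
  "comb'' j S K cf t x = (\<Sum>k\<in>K. cf k * exp (- (t * mu k)) * ((pot j (j \<in> S) (x $ j) - ev j (k $ j)) * \<Psi> S k x))"

definition dt :: "(nat ^ 'd \<Rightarrow> real) \<Rightarrow> nat ^ 'd \<Rightarrow> real" where
  "dt cf k = - mu k * cf k"

lemma deriv_comb_t: "((\<lambda>t. comb S K cf t x) has_real_derivative comb S K (dt cf) t x) (at t)"
  unfolding comb_def dt_def by (auto intro!: derivative_eq_intros sum.cong)

lemma deriv_comb:
  "x \<in> cube \<Longrightarrow> ((\<lambda>s. comb S K cf t (upd j x s)) has_real_derivative comb' j S K cf t x) (at (x $ j))"
  unfolding comb_def comb'_def by (intro DERIV_sum DERIV_cmult deriv_\<Psi>)

lemma deriv_comb':
  "x \<in> cube \<Longrightarrow> ((\<lambda>s. comb' j S K cf t (upd j x s)) has_real_derivative comb'' j S K cf t x) (at (x $ j))"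
  unfolding comb'_def comb''_def by (intro DERIV_sum DERIV_cmult deriv_\<Psi>')

text \<open>Two t-derivatives produce \<open>lam k\<close>, whose summands \<open>ev\<close> cancel
  those of the second x-derivatives; the potential and the constants \<open>a0\<close>
  remain.\<close>

lemma comb_pde:
  "comb S K (dt (dt cf)) t x + (\<Sum>j\<in>UNIV. comb'' j S K cf t x)
   = (\<Sum>j\<in>UNIV. pot j (j \<in> S) (x $ j) + a0 j) * comb S K cf t x"
proof -
  have "(\<Sum>j\<in>UNIV. comb'' j S K cf t x)
    = (\<Sum>k\<in>K. \<Sum>j\<in>UNIV. cf k * exp (- (t * mu k)) * ((pot j (j \<in> S) (x $ j) - ev j (k $ j)) * \<Psi> S k x))"
    unfolding comb''_def by (rule sum.swap)
  also have "\<dots> = (\<Sum>k\<in>K. cf k * exp (- (t * mu k)) * \<Psi> S k x * (\<Sum>j\<in>UNIV. pot j (j \<in> S) (x $ j) - ev j (k $ j)))"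
    by (simp add: sum_distrib_left mult_ac)
  finally have "comb S K (dt (dt cf)) t x + (\<Sum>j\<in>UNIV. comb'' j S K cf t x)
    = (\<Sum>k\<in>K. cf k * exp (- (t * mu k)) * \<Psi> S k x * (lam k + (\<Sum>j\<in>UNIV. pot j (j \<in> S) (x $ j) - ev j (k $ j))))"
    unfolding comb_def dt_def by (simp add: sum.distrib[symmetric] mu_sq[symmetric] algebra_simps)
  moreover have "lam k + (\<Sum>j\<in>UNIV. pot j (j \<in> S) (x $ j) - ev j (k $ j)) = (\<Sum>j\<in>UNIV. pot j (j \<in> S) (x $ j) + a0 j)" for k
    unfolding lam_def sum.distrib[symmetric] by (intro sum.cong) auto
  ultimately show ?thesis unfolding comb_def by (simp add: sum_distrib_left mult_ac)
qed

lemma comb'_empty: "comb' j {} K cf t x + q j (x $ j) * comb {} K cf t x = comb {j} K cf t x"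
  unfolding comb_def comb'_def \<Psi>'_empty sum_distrib_left sum.distrib[symmetric]
  by (intro sum.cong) (auto simp: algebra_simps)

lemma bound_comb: "\<exists>C\<ge>0. \<forall>x\<in>ccube. \<bar>comb S K cf t x\<bar> \<le> C * sin (x $ j)"
proof -
  have "\<forall>k. \<exists>C. 0 \<le> C \<and> (\<forall>x\<in>ccube. \<bar>\<Psi> S k x\<bar> \<le> C * sin (x $ j))" using bound_\<Psi> by blast
  from choice[OF this] obtain C where C: "\<And>k. 0 \<le> C k" "\<And>k x. x \<in> ccube \<Longrightarrow> \<bar>\<Psi> S k x\<bar> \<le> C k * sin (x $ j)" by blast
  define D where "D = (\<Sum>k\<in>K. \<bar>cf k * exp (- (t * mu k))\<bar> * C k)"
  have "\<bar>comb S K cf t x\<bar> \<le> D * sin (x $ j)" if "x \<in> ccube" for x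
  proof -
    have "\<bar>comb S K cf t x\<bar> \<le> (\<Sum>k\<in>K. \<bar>cf k * exp (- (t * mu k)) * \<Psi> S k x\<bar>)"
      unfolding comb_def by (rule sum_abs)
    also have "\<dots> \<le> (\<Sum>k\<in>K. \<bar>cf k * exp (- (t * mu k))\<bar> * (C k * sin (x $ j)))"
      unfolding abs_mult[of _ "\<Psi> _ _ _"] by (intro sum_mono mult_left_mono C that) auto
    finally show ?thesis unfolding D_def sum_distrib_right by (simp only: mult.assoc)
  qed
  moreover have "0 \<le> D" unfolding D_def using C by (intro sum_nonneg) auto
  ultimately show ?thesis by blast
qed

lemma bdd_comb: "bdd_cube (comb S K cf t)"
  unfolding comb_def[abs_def] by (intro bdd_cube_intros bdd_cube_continuous continuous_\<Psi>)

lemma bdd_comb': "bdd_cube (comb' j S K cf t)"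
proof -
  have "bdd_cube (\<Psi>' j S k)" for k using bound_\<Psi>' unfolding bdd_cube_def by blast
  then show ?thesis unfolding comb'_def[abs_def] by (intro bdd_cube_intros)
qed

lemma bdd_q_comb: "bdd_cube (\<lambda>x. q j (x $ j) * comb S K cf t x)"
proof -
  obtain C where C: "0 \<le> C" "\<And>x. x \<in> ccube \<Longrightarrow> \<bar>comb S K cf t x\<bar> \<le> C * sin (x $ j)" using bound_comb by blast
  obtain D where D: "\<And>x. x \<in> {0<..<pi} \<Longrightarrow> \<bar>q j x\<bar> * sin x \<le> D" using bound_q by blast
  have "\<bar>q j (x $ j) * comb S K cf t x\<bar> \<le> D * C" if "x \<in> cube" for x
  proof -
    have "\<bar>q j (x $ j) * comb S K cf t x\<bar> \<le> \<bar>q j (x $ j)\<bar> * (C * sin (x $ j))"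
      unfolding abs_mult using C(2) that cube_subset_ccube by (intro mult_left_mono) auto
    also have "\<dots> = (\<bar>q j (x $ j)\<bar> * sin (x $ j)) * C" by simp
    also have "\<dots> \<le> D * C" using D cube_nth[OF that] C(1) by (intro mult_right_mono) auto
    finally show ?thesis .
  qed
  then show ?thesis unfolding bdd_cube_def by blast
qed

lemma bdd_q'_comb: "bdd_cube (\<lambda>x. q' j (x $ j) * (comb S K cf t x)\<^sup>2)"
proof -
  obtain C where C: "0 \<le> C" "\<And>x. x \<in> ccube \<Longrightarrow> \<bar>comb S K cf t x\<bar> \<le> C * sin (x $ j)" using bound_comb by blast
  obtain D where D: "\<And>x. x \<in> {0<..<pi} \<Longrightarrow> \<bar>q' j x\<bar> * (sin x)\<^sup>2 \<le> D" using bound_q' by blast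
  have "\<bar>q' j (x $ j) * (comb S K cf t x)\<^sup>2\<bar> \<le> D * C\<^sup>2" if "x \<in> cube" for x
  proof -
    have "(comb S K cf t x)\<^sup>2 \<le> (C * sin (x $ j))\<^sup>2"
      using C that cube_subset_ccube sin_pos_cube[OF that, of j] by (intro abs_le_square_iff[THEN iffD1]) (auto simp: abs_mult)
    then have "\<bar>q' j (x $ j) * (comb S K cf t x)\<^sup>2\<bar> \<le> \<bar>q' j (x $ j)\<bar> * (C * sin (x $ j))\<^sup>2"
      unfolding abs_mult by (intro mult_left_mono) auto
    also have "\<dots> = (\<bar>q' j (x $ j)\<bar> * (sin (x $ j))\<^sup>2) * C\<^sup>2" by (simp add: power_mult_distrib)
    also have "\<dots> \<le> D * C\<^sup>2" using D cube_nth[OF that] by (intro mult_right_mono) auto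
    finally show ?thesis .
  qed
  then show ?thesis unfolding bdd_cube_def by blast
qed

text \<open>The second derivative alone may blow up at the boundary: the potential is controlled
  only by a multiple of sin^(-2), while \<open>comb\<close> vanishes like sin. One more factor
  \<open>comb\<close> compensates.\<close>

lemma bdd_comb_comb'': "bdd_cube (\<lambda>x. comb S K cf t x * comb'' j S K cf t x)"
proof -
  define r where "r x = comb S K (\<lambda>k. ev j (k $ j) * cf k) t x" for x
  have "comb'' j S K cf t x = pot j (j \<in> S) (x $ j) * comb S K cf t x - r x" for x
    unfolding comb''_def comb_def r_def sum_distrib_left sum_subtractf[symmetric]
    by (intro sum.cong) (auto simp: algebra_simps)
  note eq = this
  have "comb S K cf t x * comb'' j S K cf t x =
     (q j (x $ j) * comb S K cf t x)\<^sup>2 + (if j \<in> S then 1 else -1) * (q' j (x $ j) * (comb S K cf t x)\<^sup>2)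
     - comb S K cf t x * r x" for x
    unfolding eq pot_def by (simp add: power2_eq_square algebra_simps)
  then show ?thesis
    unfolding r_def by (simp only:) (intro bdd_cube_intros bdd_q_comb bdd_q'_comb bdd_comb)
qed

lemma continuous_comb: "continuous_on ccube (comb S K cf t)"
  unfolding comb_def[abs_def] by (intro continuous_intros continuous_\<Psi>)

lemma continuous_comb_joint: "continuous_on (UNIV \<times> ccube) (\<lambda>z. comb S K cf (fst z) (snd z))"
proof -
  have "continuous_on (UNIV \<times> ccube) (\<lambda>z. \<Psi> S k (snd z))" for k :: "nat ^ 'd"
    by (rule continuous_on_compose2[OF continuous_\<Psi>, where f = snd]) (auto intro: continuous_on_snd continuous_on_id)
  then show ?thesis unfolding comb_def by (intro continuous_intros)
qed

lemma continuous_comb': "continuous_on cube (comb' j S K cf t)"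
  unfolding comb'_def[abs_def] by (intro continuous_intros continuous_\<Psi>')

lemma integral_comb_single:
  assumes "finite K"
  shows "(\<integral>x. comb {i} K cf t x * comb {i} K df t x \<partial>cube_measure)
    = (\<Sum>k\<in>K. cf k * df k * exp (- (2 * t * mu k)) * (\<integral>x. (\<Psi> {i} k x)\<^sup>2 \<partial>cube_measure))"
proof -
  have *: "comb {i} K cf t x * comb {i} K df t x
    = (\<Sum>k\<in>K. \<Sum>l\<in>K. (cf k * exp (- (t * mu k)) * (df l * exp (- (t * mu l)))) * (\<Psi> {i} k x * \<Psi> {i} l x))" for x
    unfolding comb_def sum_product by (intro sum.cong) (auto simp: mult_ac)
  have "(\<integral>x. comb {i} K cf t x * comb {i} K df t x \<partial>cube_measure)
    = (\<Sum>k\<in>K. \<Sum>l\<in>K. (cf k * exp (- (t * mu k)) * (df l * exp (- (t * mu l)))) * (\<integral>x. \<Psi> {i} k x * \<Psi> {i} l x \<partial>cube_measure))"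
    unfolding * using integrable_\<Psi>_mult by (simp add: Bochner_Integration.integral_sum Bochner_Integration.integrable_sum)
  also have "\<dots> = (\<Sum>k\<in>K. \<Sum>l\<in>K. if k = l then cf k * df k * exp (- (2 * t * mu k)) * (\<integral>x. (\<Psi> {i} k x)\<^sup>2 \<partial>cube_measure) else 0)"
  proof (intro sum.cong refl)
    fix k l
    show "(cf k * exp (- (t * mu k)) * (df l * exp (- (t * mu l)))) * (\<integral>x. \<Psi> {i} k x * \<Psi> {i} l x \<partial>cube_measure)
      = (if k = l then cf k * df k * exp (- (2 * t * mu k)) * (\<integral>x. (\<Psi> {i} k x)\<^sup>2 \<partial>cube_measure) else 0)"
    proof (cases "k = l")
      case True
      have "exp (- (t * mu k)) * exp (- (t * mu k)) = exp (- (2 * t * mu k))"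
        by (simp add: exp_add[symmetric])
      then show ?thesis using True by (simp add: power2_eq_square mult_ac)
    next
      case False
      then show ?thesis by (simp add: integral_\<Psi>_single orthogonal)
    qed
  qed
  also have "\<dots> = (\<Sum>k\<in>K. cf k * df k * exp (- (2 * t * mu k)) * (\<integral>x. (\<Psi> {i} k x)\<^sup>2 \<partial>cube_measure))"
    using assms by simp
  finally show ?thesis .
qed

lemma comb_tendsto: "(\<lambda>n. comb S K cf (real n) x) \<longlonglongrightarrow> 0"
proof -
  have "(\<lambda>n. exp (- (real n * mu k))) \<longlonglongrightarrow> 0" for k
  proof -
    have "(\<lambda>n. exp (- mu k) ^ n) \<longlonglongrightarrow> 0" using mu_pos[of k] by (intro LIMSEQ_realpow_zero) auto
    then show ?thesis by (simp add: exp_of_nat_mult[symmetric])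
  qed
  then have "(\<lambda>n. comb S K cf (real n) x) \<longlonglongrightarrow> (\<Sum>k\<in>K. cf k * 0 * \<Psi> S k x)"
    unfolding comb_def by (intro tendsto_intros)
  then show ?thesis by simp
qed

text \<open>A bound independent of t and x, which feeds dominated convergence as t tends to
  infinity.\<close>

lemma comb_le:
  assumes "x \<in> ccube" "0 \<le> t"
  shows "\<bar>comb S K cf t x\<bar> \<le> (\<Sum>k\<in>K. \<bar>cf k\<bar> * (SOME C. \<forall>x\<in>ccube. \<bar>\<Psi> S k x\<bar> \<le> C))"
  unfolding comb_def
proof (rule sum_abs[THEN order_trans], rule sum_mono)
  fix k assume "k \<in> K"
  have "\<exists>C. \<forall>x\<in>ccube. \<bar>\<Psi> S k x\<bar> \<le> C"
    using compact_imp_bounded[OF compact_continuous_image[OF continuous_\<Psi> compact_ccube]] by (force simp: bounded_iff)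
  then have *: "\<forall>x\<in>ccube. \<bar>\<Psi> S k x\<bar> \<le> (SOME C. \<forall>x\<in>ccube. \<bar>\<Psi> S k x\<bar> \<le> C)" by (rule someI_ex)
  have "exp (- (t * mu k)) \<le> 1" using assms(2) mu_pos[of k] by simp
  then have "\<bar>cf k * exp (- (t * mu k))\<bar> \<le> \<bar>cf k\<bar>" by (simp add: abs_mult mult_left_le)
  then show "\<bar>cf k * exp (- (t * mu k)) * \<Psi> S k x\<bar> \<le> \<bar>cf k\<bar> * (SOME C. \<forall>x\<in>ccube. \<bar>\<Psi> S k x\<bar> \<le> C)"
    unfolding abs_mult[of _ "\<Psi> S k x"] using * assms(1) by (intro mult_mono) auto
qed

end

section \<open>The bilinear estimate\<close>

text \<open>One index set K serves u and all w_i; coefficient families with different supports are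
  padded with zeros in \<open>pairing\<close>.\<close>

locale bilinear = ladder_system + bellman_system +
  fixes K :: "(nat ^ 'a) set" and cf :: "nat ^ 'a \<Rightarrow> real" and df :: "'a \<Rightarrow> nat ^ 'a \<Rightarrow> real" and e :: real
  assumes fin: "finite K" and e_pos: "0 < e"
begin

abbreviation "u \<equiv> comb {} K cf"
abbreviation "ut \<equiv> comb {} K (dt cf)"
abbreviation "utt \<equiv> comb {} K (dt (dt cf))"
abbreviation "u1 j \<equiv> comb' j {} K cf"
abbreviation "u2 j \<equiv> comb'' j {} K cf"
abbreviation "w i \<equiv> comb {i} K (df i)"
abbreviation "wt i \<equiv> comb {i} K (dt (df i))"
abbreviation "wtt i \<equiv> comb {i} K (dt (dt (df i)))"
abbreviation "w1 j i \<equiv> comb' j {i} K (df i)"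
abbreviation "w2 j i \<equiv> comb'' j {i} K (df i)"

definition m :: "real \<Rightarrow> real ^ 'a \<Rightarrow> real" where "m t x = e + (u t x)\<^sup>2"
definition n :: "real \<Rightarrow> real ^ 'a \<Rightarrow> real" where "n t x = e + (\<Sum>i\<in>UNIV. (w i t x)\<^sup>2)"

definition bt :: "real \<Rightarrow> real ^ 'a \<Rightarrow> real" where
  "bt t x = b1 (m t x) (n t x) * (2 * (u t x * ut t x)) + b2 (m t x) (n t x) * (2 * (\<Sum>i\<in>UNIV. w i t x * wt i t x))"

definition btt :: "real \<Rightarrow> real ^ 'a \<Rightarrow> real" where
  "btt t x = (b11 (m t x) (n t x) * (2 * (u t x * ut t x)) + b12 (m t x) (n t x) * (2 * (\<Sum>i\<in>UNIV. w i t x * wt i t x))) * (2 * (u t x * ut t x))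
      + b1 (m t x) (n t x) * (2 * ((ut t x)\<^sup>2 + u t x * utt t x))
      + (b12 (m t x) (n t x) * (2 * (u t x * ut t x)) + b22 (m t x) (n t x) * (2 * (\<Sum>i\<in>UNIV. w i t x * wt i t x))) * (2 * (\<Sum>i\<in>UNIV. w i t x * wt i t x))
      + b2 (m t x) (n t x) * (2 * (\<Sum>i\<in>UNIV. (wt i t x)\<^sup>2 + w i t x * wtt i t x))"

text \<open>The flux \<partial>_j b + q_j u^2 g; its derivative in direction j is
  \<open>D j\<close>.\<close>

definition F :: "'a \<Rightarrow> real \<Rightarrow> real ^ 'a \<Rightarrow> real" where
  "F j t x = b1 (m t x) (n t x) * (2 * (u t x * u1 j t x)) + b2 (m t x) (n t x) * (2 * (\<Sum>i\<in>UNIV. w i t x * w1 j i t x))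
     + q j (x $ j) * ((u t x)\<^sup>2 * g (m t x) (n t x))"

definition D :: "'a \<Rightarrow> real \<Rightarrow> real ^ 'a \<Rightarrow> real" where
  "D j t x = (b11 (m t x) (n t x) * (2 * (u t x * u1 j t x)) + b12 (m t x) (n t x) * (2 * (\<Sum>i\<in>UNIV. w i t x * w1 j i t x))) * (2 * (u t x * u1 j t x))
      + b1 (m t x) (n t x) * (2 * ((u1 j t x)\<^sup>2 + u t x * u2 j t x))
      + (b12 (m t x) (n t x) * (2 * (u t x * u1 j t x)) + b22 (m t x) (n t x) * (2 * (\<Sum>i\<in>UNIV. w i t x * w1 j i t x))) * (2 * (\<Sum>i\<in>UNIV. w i t x * w1 j i t x))
      + b2 (m t x) (n t x) * (2 * (\<Sum>i\<in>UNIV. (w1 j i t x)\<^sup>2 + w i t x * w2 j i t x))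
      + (q' j (x $ j) * (u t x)\<^sup>2 * g (m t x) (n t x)
         + q j (x $ j) * (2 * u t x * u1 j t x * g (m t x) (n t x)
            + (u t x)\<^sup>2 * (g1 (m t x) (n t x) * (2 * (u t x * u1 j t x)) + g2 (m t x) (n t x) * (2 * (\<Sum>i\<in>UNIV. w i t x * w1 j i t x)))))"

lemma mn_pos: "0 < m t x" "0 < n t x"
  unfolding m_def n_def using e_pos by (auto intro!: add_pos_nonneg sum_nonneg)

lemma deriv_b_t: "((\<lambda>t. b (m t x) (n t x)) has_real_derivative bt t x) (at t)"
  unfolding m_def n_def bt_def
  by (rule derivs_along_line(1)[OF deriv_comb_t deriv_comb_t deriv_comb_t deriv_comb_t e_pos])

lemma deriv_bt: "((\<lambda>t. bt t x) has_real_derivative btt t x) (at t)"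
  unfolding m_def n_def bt_def btt_def
  by (rule derivs_along_line(2)[OF deriv_comb_t deriv_comb_t deriv_comb_t deriv_comb_t e_pos])

lemma deriv_F:
  assumes x: "x \<in> cube"
  shows "((\<lambda>s. F j t (upd j x s)) has_real_derivative D j t x) (at (x $ j))"
proof -
  have q: "((\<lambda>s. q j (upd j x s $ j)) has_real_derivative q' j (x $ j)) (at (x $ j))"
    using deriv_q cube_nth[OF x] by simp
  note * = deriv_comb[OF x, where j = j, of _ K _ t]
  note ** = deriv_comb'[OF x, where j = j, of _ K _ t]
  have eq: "u1 j t x = u1 j t (upd j x (x $ j))" "w1 j i t x = w1 j i t (upd j x (x $ j))" for i by simp_all
  note L = derivs_along_line[where s = "x $ j" and u = "\<lambda>s. u t (upd j x s)" and ?u1.0 = "\<lambda>s. u1 j t (upd j x s)"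
      and w = "\<lambda>i s. w i t (upd j x s)" and ?w1.0 = "\<lambda>i s. w1 j i t (upd j x s)",
      unfolded upd_self, OF * ** * ** e_pos]
  show ?thesis
    unfolding F_def D_def m_def n_def
    by (rule DERIV_cong[OF DERIV_add[OF L(2) DERIV_mult[OF q L(3)]]]) (simp only: upd_self, simp add: algebra_simps)
qed

lemma continuous_m: "continuous_on ccube (m t)" and continuous_n: "continuous_on ccube (n t)"
  unfolding m_def[abs_def] n_def[abs_def] by (intro continuous_intros continuous_comb)+

lemma continuous_m_joint: "continuous_on (UNIV \<times> ccube) (\<lambda>z. m (fst z) (snd z))"
  and continuous_n_joint: "continuous_on (UNIV \<times> ccube) (\<lambda>z. n (fst z) (snd z))"
  unfolding m_def n_def by (intro continuous_intros continuous_comb_joint)+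

lemma bdd_bellman:
  shows "bdd_cube (\<lambda>x. b (m t x) (n t x))"
    "bdd_cube (\<lambda>x. b1 (m t x) (n t x))"
    "bdd_cube (\<lambda>x. b2 (m t x) (n t x))"
    "bdd_cube (\<lambda>x. b11 (m t x) (n t x))"
    "bdd_cube (\<lambda>x. b12 (m t x) (n t x))"
    "bdd_cube (\<lambda>x. b22 (m t x) (n t x))"
    "bdd_cube (\<lambda>x. g (m t x) (n t x))"
    "bdd_cube (\<lambda>x. g1 (m t x) (n t x))"
    "bdd_cube (\<lambda>x. g2 (m t x) (n t x))"
  by (intro bdd_cube_continuous continuous_bellman continuous_m continuous_n mn_pos)+

lemma bdd_D: "bdd_cube (D j t)"
proof -
  \<comment> \<open>The factors are regrouped so that each \<open>q j\<close> meets a factor u and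
    \<open>q' j\<close> meets u^2, which makes the products bounded.\<close>
  have "D j t = (\<lambda>x. (b11 (m t x) (n t x) * (2 * (u t x * u1 j t x)) + b12 (m t x) (n t x) * (2 * (\<Sum>i\<in>UNIV. w i t x * w1 j i t x))) * (2 * (u t x * u1 j t x))
      + b1 (m t x) (n t x) * (2 * ((u1 j t x)\<^sup>2 + u t x * u2 j t x))
      + (b12 (m t x) (n t x) * (2 * (u t x * u1 j t x)) + b22 (m t x) (n t x) * (2 * (\<Sum>i\<in>UNIV. w i t x * w1 j i t x))) * (2 * (\<Sum>i\<in>UNIV. w i t x * w1 j i t x))
      + b2 (m t x) (n t x) * (2 * (\<Sum>i\<in>UNIV. (w1 j i t x)\<^sup>2 + w i t x * w2 j i t x))
      + ((q' j (x $ j) * (u t x)\<^sup>2) * g (m t x) (n t x)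
         + (2 * ((q j (x $ j) * u t x) * u1 j t x * g (m t x) (n t x))
            + (q j (x $ j) * u t x) * u t x * (g1 (m t x) (n t x) * (2 * (u t x * u1 j t x)) + g2 (m t x) (n t x) * (2 * (\<Sum>i\<in>UNIV. w i t x * w1 j i t x))))))"
    unfolding D_def by (simp add: fun_eq_iff power2_eq_square algebra_simps)
  then show ?thesis
    by (simp only:)
       (intro bdd_cube_intros bdd_comb bdd_comb' bdd_q_comb bdd_q'_comb bdd_comb_comb'' bdd_bellman)
qed

text \<open>Every term of the flux contains a factor u or w_i that can be divided by sin x_j. In the
  Lagrangian term one factor u cancels the singularity of q_j and the other one vanishes at the
  boundary.\<close>

lemma F_edge: "\<exists>C. \<forall>x\<in>cube. \<bar>F j t x\<bar> \<le> C * sin (x $ j)"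
proof -
  have div: "bdd_cube (\<lambda>x. comb S K c t x / sin (x $ j))" for S c
  proof -
    obtain C where C: "0 \<le> C" "\<And>x. x \<in> ccube \<Longrightarrow> \<bar>comb S K c t x\<bar> \<le> C * sin (x $ j)"
      using bound_comb by blast
    have "\<bar>comb S K c t x / sin (x $ j)\<bar> \<le> C" if "x \<in> cube" for x
      using C(2)[of x] that cube_subset_ccube sin_pos_cube[OF that, of j] by (auto simp: divide_simps abs_if split: if_splits)
    then show ?thesis unfolding bdd_cube_def by blast
  qed
  define G where "G x = b1 (m t x) (n t x) * (2 * ((u t x / sin (x $ j)) * u1 j t x))
     + b2 (m t x) (n t x) * (2 * (\<Sum>i\<in>UNIV. (w i t x / sin (x $ j)) * w1 j i t x))
     + (q j (x $ j) * u t x) * ((u t x / sin (x $ j)) * g (m t x) (n t x))" for x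
  have "bdd_cube G"
    unfolding G_def by (intro bdd_cube_intros bdd_comb bdd_comb' bdd_q_comb div bdd_bellman)
  then obtain C where C: "\<And>x. x \<in> cube \<Longrightarrow> \<bar>G x\<bar> \<le> C" unfolding bdd_cube_def by blast
  have "\<bar>F j t x\<bar> \<le> C * sin (x $ j)" if "x \<in> cube" for x
  proof -
    have s: "0 < sin (x $ j)" by (rule sin_pos_cube[OF that])
    have "F j t x = G x * sin (x $ j)"
      unfolding F_def G_def using s
      by (simp add: distrib_right sum_distrib_right sum_distrib_left power2_eq_square field_simps)
    then show ?thesis using C[OF that] s by (simp add: abs_mult)
  qed
  then show ?thesis by blast
qed

lemma integral_D: "integrable cube_measure (D j t)" "(\<integral>x. D j t x \<partial>cube_measure) = 0"
proof -
  obtain C1 where C1: "\<And>x. x \<in> cube \<Longrightarrow> \<bar>D j t x\<bar> \<le> C1" using bdd_D unfolding bdd_cube_def by blast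
  obtain C2 where C2: "\<And>x. x \<in> cube \<Longrightarrow> \<bar>F j t x\<bar> \<le> C2 * sin (x $ j)" using F_edge by blast
  have cont: "continuous_on cube (F j t)"
    unfolding F_def[abs_def]
    by (intro continuous_intros continuous_q continuous_comb' continuous_bellman
        continuous_on_subset[OF continuous_comb cube_subset_ccube] continuous_on_subset[OF continuous_m cube_subset_ccube]
        continuous_on_subset[OF continuous_n cube_subset_ccube] mn_pos)
  have 1: "\<bar>D j t x\<bar> \<le> max C1 C2" if "x \<in> cube" for x using C1[OF that] by simp
  have 2: "\<bar>F j t x\<bar> \<le> max C1 C2 * sin (x $ j)" if "x \<in> cube" for x
    using sin_pos_cube[OF that, of j] by (intro order_trans[OF C2[OF that] mult_right_mono]) auto
  show "integrable cube_measure (D j t)" "(\<integral>x. D j t x \<partial>cube_measure) = 0"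
    by (rule integral_partial_derivative[OF cont deriv_F 1 2], assumption+)+
qed

text \<open>The potential of M_i exceeds that of L by 2 q_i', which is the extra term in the
  equation for w_i. By \<open>comb'_empty\<close> the combination \<partial>_i u + q_i u is
  \<delta>_i u = \<open>comb {i} K cf\<close>.\<close>

lemma btt_lower:
  assumes x: "x \<in> cube"
  shows "c * \<bar>\<Sum>i\<in>UNIV. comb {i} K cf t x * wt i t x\<bar> \<le> btt t x + (\<Sum>j\<in>UNIV. D j t x)"
proof -
  have pot_single: "(\<Sum>j\<in>UNIV. pot j (j \<in> {i}) (x $ j) + a0 j)
    = (\<Sum>j\<in>UNIV. (q j (x $ j))\<^sup>2 - q' j (x $ j) + a0 j) + 2 * q' i (x $ i)" for i
  proof -
    have "pot j (j \<in> {i}) (x $ j) + a0 j = (q j (x $ j))\<^sup>2 - q' j (x $ j) + a0 j + (if i = j then 2 * q' j (x $ j) else 0)" for j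
      by (auto simp: pot_def)
    then have "(\<Sum>j\<in>UNIV. pot j (j \<in> {i}) (x $ j) + a0 j)
      = (\<Sum>j\<in>UNIV. (q j (x $ j))\<^sup>2 - q' j (x $ j) + a0 j + (if i = j then 2 * q' j (x $ j) else 0))"
      by (intro sum.cong refl)
    also have "\<dots> = (\<Sum>j\<in>UNIV. (q j (x $ j))\<^sup>2 - q' j (x $ j) + a0 j) + (\<Sum>j\<in>UNIV. if i = j then 2 * q' j (x $ j) else 0)"
      by (rule sum.distrib)
    finally show ?thesis by simp
  qed
  have "c * \<bar>\<Sum>i\<in>UNIV. (u1 i t x + q i (x $ i) * u t x) * wt i t x\<bar> \<le> btt t x + (\<Sum>j\<in>UNIV. D j t x)"
    unfolding btt_def D_def
  proof (rule pointwise_lower_bound[OF e_pos, where V = "\<lambda>j. (q j (x $ j))\<^sup>2 - q' j (x $ j) + a0 j"])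
    show "utt t x + (\<Sum>j\<in>UNIV. u2 j t x) = (\<Sum>j\<in>UNIV. (q j (x $ j))\<^sup>2 - q' j (x $ j) + a0 j) * u t x"
      unfolding comb_pde by (simp add: pot_def)
    show "wtt i t x + (\<Sum>j\<in>UNIV. w2 j i t x)
      = ((\<Sum>j\<in>UNIV. (q j (x $ j))\<^sup>2 - q' j (x $ j) + a0 j) + 2 * q' i (x $ i)) * w i t x" for i
      unfolding comb_pde pot_single ..
  qed (use cube_nth[OF x] in \<open>auto simp: m_def n_def intro: V_nonneg q'_nonneg less_imp_le[OF a0_pos]\<close>)
  then show ?thesis unfolding comb'_empty .
qed

lemma continuous_b_joint:
  "continuous_on (UNIV \<times> ccube) (\<lambda>z. bt (fst z) (snd z))" "continuous_on (UNIV \<times> ccube) (\<lambda>z. btt (fst z) (snd z))"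
  unfolding bt_def btt_def
  by (intro continuous_intros continuous_comb_joint continuous_bellman continuous_m_joint continuous_n_joint mn_pos)+

lemma continuous_b: "continuous_on ccube (\<lambda>x. b (m t x) (n t x))" "continuous_on ccube (bt t)" "continuous_on ccube (btt t)"
  unfolding bt_def[abs_def] btt_def[abs_def]
  by (intro continuous_intros continuous_comb continuous_bellman continuous_m continuous_n mn_pos)+

text \<open>Subtracting \<open>b e e\<close>, the value at u = 0 and w = 0, makes the function tend
  to 0 for large t.\<close>

definition I :: "real \<Rightarrow> real" where "I t = integral ccube (\<lambda>x. b (m t x) (n t x) - b e e)"

lemma deriv_I: "(I has_real_derivative integral ccube (bt t)) (at t)"
  unfolding I_def[abs_def]
proof (rule leibniz_rule_field_derivative[where U = UNIV and a = 0 and b = "\<chi> i. pi", folded ccube_def])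
  show "continuous_on (UNIV \<times> ccube) (\<lambda>(t, x). bt t x)"
    using continuous_b_joint(1) by (simp add: case_prod_beta)
  show "(\<lambda>x. b (m t x) (n t x) - b e e) integrable_on ccube" for t
    unfolding ccube_def
    by (rule integrable_continuous, fold ccube_def) (intro continuous_intros continuous_b)
  show "((\<lambda>t. b (m t x) (n t x) - b e e) has_real_derivative bt t x) (at t)" for t x
    by (auto intro!: derivative_eq_intros deriv_b_t)
qed auto

lemma deriv_I': "((\<lambda>t. integral ccube (bt t)) has_real_derivative integral ccube (btt t)) (at t)"
proof (rule leibniz_rule_field_derivative[where U = UNIV and a = 0 and b = "\<chi> i. pi", folded ccube_def])
  show "continuous_on (UNIV \<times> ccube) (\<lambda>(t, x). btt t x)"
    using continuous_b_joint(2) by (simp add: case_prod_beta)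
  show "bt t integrable_on ccube" for t
    unfolding ccube_def by (rule integrable_continuous, fold ccube_def) (rule continuous_b)
qed (auto intro: deriv_bt)

text \<open>For t \<ge> 0 the pair (m, n) stays in a fixed compact rectangle of the open quadrant,
  on which b is bounded; dominated convergence applies.\<close>

lemma I_tendsto: "(\<lambda>k. I (real k)) \<longlonglongrightarrow> 0"
proof -
  define R where "R S c = (\<Sum>k\<in>K. \<bar>c k\<bar> * (SOME C. \<forall>x\<in>ccube. \<bar>\<Psi> S k x\<bar> \<le> C))" for S and c :: "nat ^ 'a \<Rightarrow> real"
  define R1 where "R1 = e + (R {} cf)\<^sup>2"
  define R2 where "R2 = e + (\<Sum>i\<in>UNIV. (R {i} (df i))\<^sup>2)"
  have le: "(comb S K c t x)\<^sup>2 \<le> (R S c)\<^sup>2" if "x \<in> ccube" "0 \<le> t" for S c t x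
    using comb_le[OF that, of S K c] unfolding R_def by (rule abs_le_square_iff[THEN iffD1, OF order_trans]) simp
  have cont_b: "continuous_on ({e..R1} \<times> {e..R2}) (\<lambda>z. b (fst z) (snd z))"
    by (rule continuous_bellman) (use e_pos in \<open>auto intro: continuous_on_fst continuous_on_snd continuous_on_id\<close>)
  have "compact ({e..R1} \<times> {e..R2})" by (intro compact_Times) auto
  from compact_imp_bounded[OF compact_continuous_image[OF cont_b this]]
  obtain C where C: "\<And>m n. e \<le> m \<Longrightarrow> m \<le> R1 \<Longrightarrow> e \<le> n \<Longrightarrow> n \<le> R2 \<Longrightarrow> \<bar>b m n\<bar> \<le> C"
    unfolding bounded_iff by force
  have bound: "\<bar>b (m t x) (n t x) - b e e\<bar> \<le> 2 * C" if "x \<in> ccube" "0 \<le> t" for t x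
  proof -
    have "\<bar>b (m t x) (n t x)\<bar> \<le> C"
      by (rule C) (auto simp: m_def n_def R1_def R2_def intro!: le that sum_mono sum_nonneg)
    moreover have "\<bar>b e e\<bar> \<le> C"
      by (rule C) (auto simp: R1_def R2_def intro!: sum_nonneg)
    ultimately show ?thesis by linarith
  qed
  have lim: "(\<lambda>k. b (m (real k) x) (n (real k) x) - b e e) \<longlonglongrightarrow> 0" for x
  proof -
    have "(\<lambda>k. m (real k) x) \<longlonglongrightarrow> e + 0\<^sup>2" unfolding m_def by (intro tendsto_intros comb_tendsto)
    moreover have "(\<lambda>k. n (real k) x) \<longlonglongrightarrow> e + (\<Sum>i\<in>(UNIV :: 'a set). 0\<^sup>2)" unfolding n_def by (intro tendsto_intros comb_tendsto)
    ultimately have "(\<lambda>k. (m (real k) x, n (real k) x)) \<longlonglongrightarrow> (e, e)" using tendsto_Pair by fastforce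
    then have "(\<lambda>k. (\<lambda>(m, n). b m n) (m (real k) x, n (real k) x)) \<longlonglongrightarrow> (\<lambda>(m, n). b m n) (e, e)"
    proof (rule isCont_tendsto_compose[rotated])
      have "continuous_on ({0<..} \<times> {0<..}) (\<lambda>(m, n). b m n)" by (rule cont) simp
      moreover have "open ({0<..} \<times> {0<..} :: (real \<times> real) set)" by (intro open_Times) auto
      ultimately show "isCont (\<lambda>(m, n). b m n) (e, e)"
        using e_pos by (simp add: continuous_on_eq_continuous_at)
    qed
    from tendsto_diff[OF this tendsto_const[of "b e e"]] show ?thesis by simp
  qed
  have cont_k: "continuous_on ccube (\<lambda>x. b (m t x) (n t x) - b e e)" for t
    by (intro continuous_intros continuous_b)
  have "(\<lambda>k. \<integral>x. b (m (real k) x) (n (real k) x) - b e e \<partial>cube_measure) \<longlonglongrightarrow> (\<integral>x. 0 \<partial>(cube_measure :: (real ^ 'a) measure))"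
  proof (rule integral_dominated_convergence)
    show "integrable cube_measure (\<lambda>x. 2 * C)"
      by (rule integrable_bounded_cube) auto
    show "(\<lambda>x. b (m (real k) x) (n (real k) x) - b e e) \<in> borel_measurable cube_measure" for k
      by (rule borel_measurable_integrable[OF integral_ccube(1)[OF cont_k]])
    show "AE x in cube_measure. norm (b (m (real k) x) (n (real k) x) - b e e) \<le> 2 * C" for k
      using bound cube_subset_ccube by (intro AE_I2) auto
    show "AE x in cube_measure. (\<lambda>k. b (m (real k) x) (n (real k) x) - b e e) \<longlonglongrightarrow> 0"
      by (rule AE_I2) (rule lim)
    show "(\<lambda>x :: real ^ 'a. 0 :: real) \<in> borel_measurable cube_measure" by (rule borel_measurable_const)
  qed
  then show ?thesis by (simp only: I_def integral_ccube(2)[OF cont_k, symmetric] Bochner_Integration.integral_zero)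
qed


end


context ladder_system
begin

text \<open>The functions \<open>\<Psi> {i} k\<close> are orthogonal but not normalized; this is the
  square of their norm.\<close>

definition nu :: "'d \<Rightarrow> nat ^ 'd \<Rightarrow> real" where
  "nu i k = (\<integral>x. (\<Psi> {i} k x)\<^sup>2 \<partial>cube_measure)"
end

context bilinear
begin


text \<open>\<open>I - c \<Theta>\<close> is convex on \<open>[0, \<infinity>)\<close> and tends to \<open>0\<close>, for both signs of \<open>\<Theta>\<close>.\<close>

lemma bilinear_estimate:
  "c * abs (\<Sum>i\<in>UNIV. \<Sum>k\<in>K. cf k * df i k / (4 * mu k) * nu i k) \<le> (\<integral>x. b (m 0 x) (n 0 x) - b e e \<partial>cube_measure)"
proof -
  \<comment> \<open>At t = 0 this is a quarter of the pairing of the Riesz transforms with g. Its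
    second derivative \<open>\<Theta>2\<close> is minus the integral of the sum of the \<delta>_i u
    \<partial>_t w_i, which \<open>btt_lower\<close> controls.\<close>
  define \<Theta> where "\<Theta> t = (\<Sum>i\<in>UNIV. \<Sum>k\<in>K. cf k * df i k / (4 * mu k) * nu i k * exp (- (2 * t * mu k)))" for t
  define \<Theta>1 where "\<Theta>1 t = (\<Sum>i\<in>UNIV. \<Sum>k\<in>K. - (cf k * df i k / 2 * nu i k * exp (- (2 * t * mu k))))" for t
  define \<Theta>2 where "\<Theta>2 t = (\<Sum>i\<in>UNIV. \<Sum>k\<in>K. cf k * df i k * mu k * nu i k * exp (- (2 * t * mu k)))" for t
  have expd: "((\<lambda>t. C * exp (- (2 * t * r))) has_real_derivative C * (- 2 * r) * exp (- (2 * t * r))) (at t)" for C r t :: real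
    by (rule derivative_eq_intros refl | simp)+
  have d1: "(\<Theta> has_real_derivative \<Theta>1 t) (at t)" for t
    unfolding \<Theta>_def \<Theta>1_def
  proof (rule DERIV_sum, rule DERIV_sum)
    fix i k
    have "mu k \<noteq> 0" using mu_pos[of k] by simp
    then have "cf k * df i k / (4 * mu k) * nu i k * (- 2 * mu k) * exp (- (2 * t * mu k)) = - (cf k * df i k / 2 * nu i k * exp (- (2 * t * mu k)))"
      by simp
    then show "((\<lambda>t. cf k * df i k / (4 * mu k) * nu i k * exp (- (2 * t * mu k))) has_real_derivative
        - (cf k * df i k / 2 * nu i k * exp (- (2 * t * mu k)))) (at t)"
      using expd[of "cf k * df i k / (4 * mu k) * nu i k" "mu k" t] by (simp only:)
  qed
  have d2: "(\<Theta>1 has_real_derivative \<Theta>2 t) (at t)" for t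
    unfolding \<Theta>1_def \<Theta>2_def
  proof (rule DERIV_sum, rule DERIV_sum)
    fix i k
    show "((\<lambda>t. - (cf k * df i k / 2 * nu i k * exp (- (2 * t * mu k)))) has_real_derivative
        cf k * df i k * mu k * nu i k * exp (- (2 * t * mu k))) (at t)"
      by (rule DERIV_cong[OF DERIV_minus[OF expd]]) simp
  qed
  have lim: "(\<lambda>n. \<Theta> (real n)) \<longlonglongrightarrow> 0"
  proof -
    have "(\<lambda>n. exp (- (2 * real n * mu k))) \<longlonglongrightarrow> 0" for k
    proof -
      have "(\<lambda>n. exp (- (2 * mu k)) ^ n) \<longlonglongrightarrow> 0" using mu_pos[of k] by (intro LIMSEQ_realpow_zero) auto
      then show ?thesis by (simp add: exp_of_nat_mult[symmetric] mult_ac)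
    qed
    then have "(\<lambda>n. \<Theta> (real n)) \<longlonglongrightarrow> (\<Sum>i\<in>UNIV. \<Sum>k\<in>K. cf k * df i k / (4 * mu k) * nu i k * 0)"
      unfolding \<Theta>_def by (intro tendsto_intros)
    then show ?thesis by simp
  qed
  have T2: "(\<integral>x. (\<Sum>i\<in>UNIV. comb {i} K cf t x * wt i t x) \<partial>cube_measure) = - \<Theta>2 t"
    and T2i: "integrable cube_measure (\<lambda>x. \<Sum>i\<in>UNIV. comb {i} K cf t x * wt i t x)" for t
  proof -
    have int: "integrable cube_measure (\<lambda>x. comb {i} K cf t x * wt i t x)" for i
      by (intro integral_ccube continuous_intros continuous_comb)
    then show "integrable cube_measure (\<lambda>x. \<Sum>i\<in>UNIV. comb {i} K cf t x * wt i t x)" by simp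
    show "(\<integral>x. (\<Sum>i\<in>UNIV. comb {i} K cf t x * wt i t x) \<partial>cube_measure) = - \<Theta>2 t"
      using int by (simp add: integral_comb_single[OF fin] \<Theta>2_def nu_def dt_def sum_negf[symmetric] mult_ac)
  qed
  have I2: "c * \<bar>\<Theta>2 t\<bar> \<le> integral ccube (btt t)" for t
  proof -
    have bi: "integrable cube_measure (btt t)" and be: "(\<integral>x. btt t x \<partial>cube_measure) = integral ccube (btt t)"
      using integral_ccube[OF continuous_b(3)] by auto
    have "c * \<bar>\<Theta>2 t\<bar> = c * \<bar>\<integral>x. (\<Sum>i\<in>UNIV. comb {i} K cf t x * wt i t x) \<partial>cube_measure\<bar>"
      unfolding T2 by simp
    also have "\<dots> \<le> c * (\<integral>x. \<bar>\<Sum>i\<in>UNIV. comb {i} K cf t x * wt i t x\<bar> \<partial>cube_measure)"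
      using c_pos by (intro mult_left_mono integral_abs_bound) auto
    also have "\<dots> = (\<integral>x. c * \<bar>\<Sum>i\<in>UNIV. comb {i} K cf t x * wt i t x\<bar> \<partial>cube_measure)"
      by simp
    \<comment> \<open>The added divergence has integral 0, so the pointwise bound becomes a bound by
      the integral of \<open>btt\<close> alone.\<close>
    also have "\<dots> \<le> (\<integral>x. btt t x + (\<Sum>j\<in>UNIV. D j t x) \<partial>cube_measure)"
      using T2i bi integral_D(1) by (intro integral_mono btt_lower) auto
    also have "\<dots> = integral ccube (btt t)"
      using bi integral_D by (simp add: be)
    finally show ?thesis .
  qed
  have "0 \<le> I 0 - (c * s) * \<Theta> 0" if s: "s = 1 \<or> s = - 1" for s
  proof (rule convex_limit_nonneg)
    fix t
    show "((\<lambda>t. I t - (c * s) * \<Theta> t) has_real_derivative integral ccube (bt t) - (c * s) * \<Theta>1 t) (at t)"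
      by (intro DERIV_diff DERIV_cmult deriv_I d1)
    show "((\<lambda>t. integral ccube (bt t) - (c * s) * \<Theta>1 t) has_real_derivative integral ccube (btt t) - (c * s) * \<Theta>2 t) (at t)"
      by (intro DERIV_diff DERIV_cmult deriv_I' d2)
    have "(c * s) * \<Theta>2 t \<le> c * \<bar>\<Theta>2 t\<bar>"
      using s c_pos by (auto simp: abs_if mult_le_0_iff zero_le_mult_iff)
    then show "0 \<le> integral ccube (btt t) - (c * s) * \<Theta>2 t" using I2[of t] by linarith
  next
    have "(\<lambda>k. I (real k) - (c * s) * \<Theta> (real k)) \<longlonglongrightarrow> 0 - (c * s) * 0"
      by (intro tendsto_intros I_tendsto lim)
    then show "(\<lambda>k. I (real k) - (c * s) * \<Theta> (real k)) \<longlonglongrightarrow> 0" by simp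
  qed
  from this[of 1] this[of "-1"] have "c * \<bar>\<Theta> 0\<bar> \<le> I 0"
    using c_pos by (auto simp: abs_if)
  moreover have "I 0 = (\<integral>x. b (m 0 x) (n 0 x) - b e e \<partial>cube_measure)"
    unfolding I_def by (rule integral_ccube(2)[symmetric]) (intro continuous_intros continuous_b)
  ultimately show ?thesis unfolding \<Theta>_def by simp
qed

end

section \<open>$L^p$ spaces on the cube\<close>

lemma powr_add_le: "0 \<le> a \<Longrightarrow> 0 \<le> b \<Longrightarrow> 0 \<le> p \<Longrightarrow> (a + b) powr p \<le> 2 powr p * (a powr p + b powr p)" for a b p :: real
proof -
  assume *: "0 \<le> a" "0 \<le> b" "0 \<le> p"
  have "(a + b) powr p \<le> (2 * max a b) powr p" using * by (intro powr_mono2) auto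
  also have "\<dots> = 2 powr p * max a b powr p" using * by (simp add: powr_mult)
  also have "\<dots> \<le> 2 powr p * (a powr p + b powr p)" by (intro mult_left_mono) (auto simp: max_def)
  finally show ?thesis .
qed

lemma powr_convex_combination:
  fixes x y s t p :: real
  assumes "1 \<le> p" "0 \<le> x" "0 \<le> y" "0 \<le> s" "0 \<le> t" "s + t = 1"
  shows "(s * x + t * y) powr p \<le> s * x powr p + t * y powr p"
proof (cases "x = 0 \<or> y = 0")
  \<comment> \<open>At a zero argument s^p \<le> s for 0 \<le> s \<le> 1 suffices; the other case
    uses convexity on positive arguments.\<close>
  case True
  have le: "r powr p \<le> r" if "0 \<le> r" "r \<le> 1" for r :: real
    using powr_mono'[of 1 p r] assms(1) that by (cases "r = 0") auto
  have "s powr p * x powr p \<le> s * x powr p" "t powr p * y powr p \<le> t * y powr p"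
    using assms by (auto intro!: mult_right_mono le)
  with True assms show ?thesis by (auto simp: powr_mult)
next
  case False
  have s: "s = 1 - t" using assms by simp
  show ?thesis
    unfolding s using convex_onD[OF powr_convex[OF assms(1)], of t x y] False assms by simp
qed

lemma Lp_I:
  assumes "f \<in> borel_measurable cube_measure" "integrable cube_measure (\<lambda>x. norm (f x) powr p)"
  shows "f \<in> Lp p"
  using assms by (simp add: Lp_def)

lemma Lp_measurable: "f \<in> Lp p \<Longrightarrow> f \<in> borel_measurable cube_measure"
  and Lp_integrable: "f \<in> Lp p \<Longrightarrow> integrable cube_measure (\<lambda>x. norm (f x) powr p)"
  by (simp_all add: Lp_def)

lemma Lp_bounded:
  fixes f :: "real ^ 'd \<Rightarrow> 'b::euclidean_space"
  assumes "f \<in> borel_measurable cube_measure" "\<And>x. x \<in> cube \<Longrightarrow> norm (f x) \<le> C" "0 < p"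
  shows "f \<in> Lp p"
proof (rule Lp_I[OF assms(1)])
  note [measurable] = assms(1)
  show "integrable cube_measure (\<lambda>x. norm (f x) powr p)"
  proof (rule integrable_bounded_cube[where C = "C powr p"])
    fix x :: "real ^ 'd" assume "x \<in> cube"
    from powr_mono2[OF _ norm_ge_zero assms(2)[OF this], of p] show "norm (norm (f x) powr p) \<le> C powr p"
      using assms(3) by simp
  qed measurable
qed

lemma Lp_add:
  fixes f g :: "real ^ 'd \<Rightarrow> 'b::euclidean_space"
  assumes "f \<in> Lp p" "g \<in> Lp p" "0 < p"
  shows "(\<lambda>x. f x + g x) \<in> Lp p"
proof (rule Lp_I)
  note [measurable] = assms(1,2)[THEN Lp_measurable]
  show "(\<lambda>x. f x + g x) \<in> borel_measurable cube_measure" by measurable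
  show "integrable cube_measure (\<lambda>x. norm (f x + g x) powr p)"
  proof (rule Bochner_Integration.integrable_bound)
    show "integrable cube_measure (\<lambda>x. 2 powr p * (norm (f x) powr p + norm (g x) powr p))"
      using assms by (auto intro: Lp_integrable)
    show "AE x in cube_measure. norm (norm (f x + g x) powr p) \<le> norm (2 powr p * (norm (f x) powr p + norm (g x) powr p))"
    proof (rule AE_I2)
      fix x
      have "norm (f x + g x) powr p \<le> (norm (f x) + norm (g x)) powr p"
        using assms(3) by (intro powr_mono2 norm_triangle_ineq) auto
      also have "\<dots> \<le> 2 powr p * (norm (f x) powr p + norm (g x) powr p)"
        using assms(3) by (intro powr_add_le) auto
      finally show "norm (norm (f x + g x) powr p) \<le> norm (2 powr p * (norm (f x) powr p + norm (g x) powr p))"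
        by simp
    qed
  qed measurable
qed

lemma Lp_scaleR:
  fixes f :: "real ^ 'd \<Rightarrow> 'b::euclidean_space"
  assumes "f \<in> Lp p"
  shows "(\<lambda>x. r *\<^sub>R f x) \<in> Lp p"
proof (rule Lp_I)
  note [measurable] = assms(1)[THEN Lp_measurable]
  show "(\<lambda>x. r *\<^sub>R f x) \<in> borel_measurable cube_measure" by measurable
  show "integrable cube_measure (\<lambda>x. norm (r *\<^sub>R f x) powr p)"
    using Lp_integrable[OF assms] by (simp add: powr_mult)
qed

lemma Lp_diff:
  fixes f g :: "real ^ 'd \<Rightarrow> 'b::euclidean_space"
  assumes "f \<in> Lp p" "g \<in> Lp p" "0 < p"
  shows "(\<lambda>x. f x - g x) \<in> Lp p"
  using Lp_add[OF assms(1) Lp_scaleR[OF assms(2), of "-1"] assms(3)] by simp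

lemma Lp_norm_nonneg: "0 \<le> Lp_norm p f"
  by (simp add: Lp_norm_def)

lemma Lp_norm_powr: "0 < p \<Longrightarrow> Lp_norm p f powr p = (\<integral>x. norm (f x) powr p \<partial>cube_measure)"
  by (simp add: Lp_norm_def powr_powr)

lemma Lp_norm_leI:
  assumes "0 < p" "0 \<le> C" "(\<integral>x. norm (f x) powr p \<partial>cube_measure) \<le> C powr p"
  shows "Lp_norm p f \<le> C"
proof -
  have "Lp_norm p f \<le> (C powr p) powr (1 / p)"
    unfolding Lp_norm_def using assms by (intro powr_mono2) auto
  then show ?thesis using assms by (simp add: powr_powr)
qed

lemma Lp_norm_minus_commute:
  "Lp_norm p (\<lambda>x. f x - g x) = Lp_norm p (\<lambda>x. g x - f x)"
  by (simp add: Lp_norm_def norm_minus_commute)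

lemma Lp_norm_cong_AE:
  fixes f g :: "real ^ 'd \<Rightarrow> 'b::euclidean_space"
  assumes "f \<in> borel_measurable cube_measure" "g \<in> borel_measurable cube_measure" "AE x in cube_measure. f x = g x"
  shows "Lp_norm p f = Lp_norm p g"
proof -
  note [measurable] = assms(1,2)
  have "(\<integral>x. norm (f x) powr p \<partial>cube_measure) = (\<integral>x. norm (g x) powr p \<partial>cube_measure)"
    by (rule integral_cong_AE) (use assms(3) in auto)
  then show ?thesis by (simp add: Lp_norm_def)
qed

lemma Lp_norm_cong: "(\<And>x. x \<in> cube \<Longrightarrow> norm (f x) = norm (g x)) \<Longrightarrow> Lp_norm p f = Lp_norm p g"
  unfolding Lp_norm_def by (intro arg_cong[where f = "\<lambda>a. a powr (1 / p)"] Bochner_Integration.integral_cong) auto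

lemma Lp_norm_zero_AE:
  fixes f :: "real ^ 'd \<Rightarrow> 'b::euclidean_space"
  assumes "f \<in> Lp p" "0 < p" "Lp_norm p f = 0"
  shows "AE x in cube_measure. f x = 0"
proof -
  have "(\<integral>x. norm (f x) powr p \<partial>cube_measure) = 0"
    using Lp_norm_powr[OF assms(2), of f] assms(2,3) by simp
  then have "AE x in cube_measure. norm (f x) powr p = 0"
    using Lp_integrable[OF assms(1)] by (simp add: integral_nonneg_eq_0_iff_AE)
  then show ?thesis by eventually_elim (simp add: powr_eq_0_iff)
qed

text \<open>Divided by \<open>(A + B)\<^sup>p\<close>, the integrand is bounded by convexity of \<open>t\<^sup>p\<close>.\<close>

lemma Lp_norm_triangle:
  fixes f g :: "real ^ 'd \<Rightarrow> 'b::euclidean_space"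
  assumes f: "f \<in> Lp p" and g: "g \<in> Lp p" and p: "1 \<le> p"
  shows "Lp_norm p (\<lambda>x. f x + g x) \<le> Lp_norm p f + Lp_norm p g"
proof -
  have p0: "0 < p" using p by simp
  have key: "Lp_norm p (\<lambda>x. f x + g x) \<le> A + B"
    if A: "Lp_norm p f \<le> A" "0 < A" and B: "Lp_norm p g \<le> B" "0 < B" for A B
  proof (rule Lp_norm_leI[OF p0])
    show "0 \<le> A + B" using A B by simp
    have conv: "norm (f x + g x) powr p \<le> (A + B) powr p * (A / (A + B) * (norm (f x) powr p / A powr p) + B / (A + B) * (norm (g x) powr p / B powr p))" for x
    proof -
      have "norm (f x + g x) / (A + B) \<le> A / (A + B) * (norm (f x) / A) + B / (A + B) * (norm (g x) / B)"
        using A B norm_triangle_ineq[of "f x" "g x"] by (simp add: add_divide_distrib[symmetric] divide_right_mono)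
      then have "(norm (f x + g x) / (A + B)) powr p \<le> (A / (A + B) * (norm (f x) / A) + B / (A + B) * (norm (g x) / B)) powr p"
        using A B p by (intro powr_mono2) auto
      also have "\<dots> \<le> A / (A + B) * (norm (f x) / A) powr p + B / (A + B) * (norm (g x) / B) powr p"
        using A B p by (intro powr_convex_combination) (auto simp: add_divide_distrib[symmetric])
      finally have "(norm (f x + g x) / (A + B)) powr p \<le> A / (A + B) * (norm (f x) powr p / A powr p) + B / (A + B) * (norm (g x) powr p / B powr p)"
        using A B by (simp add: powr_divide)
      then have "norm (f x + g x) powr p / (A + B) powr p \<le> A / (A + B) * (norm (f x) powr p / A powr p) + B / (A + B) * (norm (g x) powr p / B powr p)"
        using A B by (simp add: powr_divide)
      then show ?thesis using A B by (simp add: pos_divide_le_eq mult.commute)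
    qed
    have le1: "(\<integral>x. norm (f x) powr p \<partial>cube_measure) / A powr p \<le> 1" "(\<integral>x. norm (g x) powr p \<partial>cube_measure) / B powr p \<le> 1"
      using powr_mono2[OF _ Lp_norm_nonneg A(1), of p] powr_mono2[OF _ Lp_norm_nonneg B(1), of p] p0 A B
      by (simp_all add: Lp_norm_powr[OF p0])
    have "(\<integral>x. norm (f x + g x) powr p \<partial>cube_measure)
      \<le> (\<integral>x. (A + B) powr p * (A / (A + B) * (norm (f x) powr p / A powr p) + B / (A + B) * (norm (g x) powr p / B powr p)) \<partial>cube_measure)"
      using Lp_integrable[OF f] Lp_integrable[OF g] Lp_integrable[OF Lp_add[OF f g p0]]
      by (intro integral_mono conv) auto
    also have "\<dots> = (A + B) powr p * (A / (A + B) * ((\<integral>x. norm (f x) powr p \<partial>cube_measure) / A powr p)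
        + B / (A + B) * ((\<integral>x. norm (g x) powr p \<partial>cube_measure) / B powr p))"
      using Lp_integrable[OF f] Lp_integrable[OF g] by simp
    also have "\<dots> \<le> (A + B) powr p * (A / (A + B) * 1 + B / (A + B) * 1)"
      using le1 A B by (intro mult_left_mono add_mono) auto
    also have "\<dots> = (A + B) powr p" using A B by (simp add: add_divide_distrib[symmetric])
    finally show "(\<integral>x. norm (f x + g x) powr p \<partial>cube_measure) \<le> (A + B) powr p" .
  qed
  show ?thesis
  proof (rule field_le_epsilon)
    \<comment> \<open>The slack keeps A and B positive even when one of the seminorms is 0.\<close>
    fix e :: real assume e: "0 < e"
    from key[of "Lp_norm p f + e / 2" "Lp_norm p g + e / 2"] e
    show "Lp_norm p (\<lambda>x. f x + g x) \<le> Lp_norm p f + Lp_norm p g + e"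
      using Lp_norm_nonneg[of p f] Lp_norm_nonneg[of p g] by simp
  qed
qed

lemma Lp_norm_triangle_diff:
  fixes f g h :: "real ^ 'd \<Rightarrow> 'b::euclidean_space"
  assumes "f \<in> Lp p" "g \<in> Lp p" "h \<in> Lp p" "1 \<le> p"
  shows "Lp_norm p (\<lambda>x. f x - h x) \<le> Lp_norm p (\<lambda>x. f x - g x) + Lp_norm p (\<lambda>x. g x - h x)"
  using Lp_norm_triangle[OF Lp_diff[OF assms(1,2)] Lp_diff[OF assms(2,3)] assms(4)] assms(4) by simp

lemma Lp_norm_triangle2:
  fixes f g :: "real ^ 'd \<Rightarrow> 'b::euclidean_space"
  assumes "f \<in> Lp p" "g \<in> Lp p" "1 \<le> p"
  shows "Lp_norm p f \<le> Lp_norm p (\<lambda>x. f x - g x) + Lp_norm p g"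
  using Lp_norm_triangle[OF Lp_diff[OF assms(1,2)] assms(2) assms(3)] assms(3) by simp

text \<open>The summability of \<open>2\<^sup>p\<^sup>n |g\<^sub>n\<^sub>+\<^sub>1 - g\<^sub>n|\<^sup>p\<close> in \<open>L\<^sup>1\<close> makes almost every \<open>g\<^sub>n x\<close> a Cauchy sequence; Fatou's lemma
  identifies the pointwise limit.\<close>

lemma Lp_fast_Cauchy_limit:
  fixes g :: "nat \<Rightarrow> real ^ 'd \<Rightarrow> 'b::euclidean_space"
  assumes g: "\<And>n. g n \<in> Lp p" and p: "1 \<le> p" and C: "0 \<le> C"
    and fast: "\<And>n. Lp_norm p (\<lambda>x. g (Suc n) x - g n x) \<le> C * (1/4) ^ n"
  shows "\<exists>h\<in>Lp p. (\<lambda>n. Lp_norm p (\<lambda>x. g n x - h x)) \<longlonglongrightarrow> 0"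
proof -
  have p0: "0 < p" using p by simp
  note gm [measurable] = Lp_measurable[OF g]
  define D where "D n x = norm (g (Suc n) x - g n x)" for n x
  have Dm [measurable]: "D n \<in> borel_measurable cube_measure" for n unfolding D_def by measurable
  have Dint: "(\<integral>\<^sup>+x. ennreal (D n x powr p) \<partial>cube_measure) \<le> ennreal ((C * (1/4) ^ n) powr p)" for n
  proof -
    have "(\<integral>\<^sup>+x. ennreal (D n x powr p) \<partial>cube_measure) = ennreal (\<integral>x. D n x powr p \<partial>cube_measure)"
      unfolding D_def by (intro nn_integral_eq_integral Lp_integrable Lp_diff g p0) auto
    also have "(\<integral>x. D n x powr p \<partial>cube_measure) = Lp_norm p (\<lambda>x. g (Suc n) x - g n x) powr p"
      unfolding D_def by (simp add: Lp_norm_powr[OF p0])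
    also have "ennreal \<dots> \<le> ennreal ((C * (1/4) ^ n) powr p)"
      using fast[of n] p0 by (intro ennreal_leI powr_mono2 Lp_norm_nonneg) auto
    finally show ?thesis .
  qed
  have "(\<integral>\<^sup>+x. (\<Sum>n. ennreal ((2 ^ n * D n x) powr p)) \<partial>cube_measure)
      = (\<Sum>n. \<integral>\<^sup>+x. ennreal ((2 ^ n * D n x) powr p) \<partial>cube_measure)"
    by (rule nn_integral_suminf) measurable
  also have "\<dots> \<le> (\<Sum>n. ennreal (C powr p * ((1/2) powr p) ^ n))"
  proof (rule suminf_le)
    fix n
    have "(\<integral>\<^sup>+x. ennreal ((2 ^ n * D n x) powr p) \<partial>cube_measure) = (\<integral>\<^sup>+x. ennreal ((2 ^ n) powr p) * ennreal (D n x powr p) \<partial>cube_measure)"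
      by (simp add: D_def powr_mult ennreal_mult)
    also have "\<dots> = ennreal ((2 ^ n) powr p) * (\<integral>\<^sup>+x. ennreal (D n x powr p) \<partial>cube_measure)"
      by (rule nn_integral_cmult) measurable
    also have "\<dots> \<le> ennreal ((2 ^ n) powr p) * ennreal ((C * (1/4) ^ n) powr p)"
      by (intro mult_left_mono Dint) simp
    also have "\<dots> = ennreal ((2 ^ n * (C * (1/4) ^ n)) powr p)"
      using C by (simp add: ennreal_mult[symmetric] powr_mult)
    also have "2 ^ n * (C * (1/4) ^ n) = C * (1/2::real) ^ n"
      by (simp add: power_mult_distrib[symmetric])
    also have "(C * (1/2::real) ^ n) powr p = C powr p * ((1/2) powr p) ^ n"
      using C by (simp add: powr_mult powr_power powr_realpow[symmetric] powr_powr mult.commute)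
    finally show "(\<integral>\<^sup>+x. ennreal ((2 ^ n * D n x) powr p) \<partial>cube_measure) \<le> ennreal (C powr p * ((1/2) powr p) ^ n)" .
  qed auto
  also have "\<dots> < \<infinity>"
  proof -
    have "(1/2::real) powr p < 1" using powr_less_mono2[OF p0, of "1/2" 1] by simp
    then have "summable (\<lambda>n. C powr p * ((1/2::real) powr p) ^ n)" by (intro summable_mult summable_geometric) simp
    then show ?thesis by (subst suminf_ennreal2) auto
  qed
  finally have fin: "(\<integral>\<^sup>+x. (\<Sum>n. ennreal ((2 ^ n * D n x) powr p)) \<partial>cube_measure) < \<infinity>" .
  have "AE x in cube_measure. (\<Sum>n. ennreal ((2 ^ n * D n x) powr p)) \<noteq> \<infinity>"
    using fin by (intro nn_integral_PInf_AE) auto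
  then have ae: "AE x in cube_measure. convergent (\<lambda>n. g n x)"
  proof eventually_elim
    case (elim x)
    have "summable (\<lambda>n. (2 ^ n * D n x) powr p)"
      by (rule summable_suminf_not_top) (use elim in auto)
    then have "(\<lambda>n. (2 ^ n * D n x) powr p) \<longlonglongrightarrow> 0" by (rule summable_LIMSEQ_zero)
    then have "\<forall>\<^sub>F n in sequentially. (2 ^ n * D n x) powr p < 1" by (rule order_tendstoD) simp
    then have "\<forall>\<^sub>F n in sequentially. norm (g (Suc n) x - g n x) \<le> (1/2) ^ n"
    proof eventually_elim
      case (elim n)
      have "2 ^ n * D n x \<le> 1"
      proof (rule ccontr)
        assume "\<not> 2 ^ n * D n x \<le> 1"
        then have "1 \<le> (2 ^ n * D n x) powr p" using p0 by (intro ge_one_powr_ge_zero) auto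
        then show False using elim by simp
      qed
      then show ?case by (simp add: D_def power_divide field_simps)
    qed
    then have "summable (\<lambda>n. g (Suc n) x - g n x)"
      by (rule summable_comparison_test_ev) (simp add: summable_geometric)
    then have "convergent (\<lambda>n. g n x - g 0 x)"
      by (simp add: summable_iff_convergent sum_lessThan_telescope[of "\<lambda>n. g n x"])
    then show "convergent (\<lambda>n. g n x)"
      using convergent_add[OF _ convergent_const[of "g 0 x"]] by fastforce
  qed
  define h where "h x = lim (\<lambda>n. g n x)" for x
  have hm [measurable]: "h \<in> borel_measurable cube_measure"
    unfolding h_def by (rule borel_measurable_lim_metric) measurable
  have lim: "AE x in cube_measure. (\<lambda>n. g n x) \<longlonglongrightarrow> h x"
    using ae by eventually_elim (simp add: h_def convergent_LIMSEQ_iff)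
  define E where "E n = 2 * C * (1/4) ^ n" for n :: nat
  have E0: "0 \<le> E n" for n using C by (simp add: E_def)
  have dist: "Lp_norm p (\<lambda>x. g (n + k) x - g n x) \<le> E n" for n k
  proof -
    \<comment> \<open>The factor 1 - (1/4)^k strengthens the claim so that the induction closes; it
      is dropped right afterwards.\<close>
    have "Lp_norm p (\<lambda>x. g (n + k) x - g n x) \<le> 2 * C * (1/4) ^ n * (1 - (1/4) ^ k)"
    proof (induction k)
      case 0
      show ?case by (simp add: Lp_norm_def)
    next
      case (Suc k)
      have "Lp_norm p (\<lambda>x. g (n + Suc k) x - g n x)
        \<le> Lp_norm p (\<lambda>x. g (Suc (n + k)) x - g (n + k) x) + Lp_norm p (\<lambda>x. g (n + k) x - g n x)"
        using Lp_norm_triangle_diff[OF g g g p] by simp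
      also have "\<dots> \<le> C * (1/4) ^ (n + k) + 2 * C * (1/4) ^ n * (1 - (1/4) ^ k)"
        by (intro add_mono fast Suc)
      also have "\<dots> \<le> 2 * C * (1/4) ^ n * (1 - (1/4) ^ Suc k)"
        using C by (simp add: power_add algebra_simps)
      finally show ?case .
    qed
    also have "\<dots> \<le> E n" unfolding E_def using C by (intro mult_left_le) (auto simp: power_le_one)
    finally show ?thesis .
  qed
  have fatou: "(\<integral>\<^sup>+x. ennreal (norm (g n x - h x) powr p) \<partial>cube_measure) \<le> ennreal (E n powr p)" for n
  proof -
    have "(\<integral>\<^sup>+x. ennreal (norm (g n x - h x) powr p) \<partial>cube_measure)
      = (\<integral>\<^sup>+x. liminf (\<lambda>k. ennreal (norm (g (n + k) x - g n x) powr p)) \<partial>cube_measure)"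
    proof (rule nn_integral_cong_AE)
      from lim show "AE x in cube_measure. ennreal (norm (g n x - h x) powr p) = liminf (\<lambda>k. ennreal (norm (g (n + k) x - g n x) powr p))"
      proof eventually_elim
        case (elim x)
        have "(\<lambda>k. g (n + k) x) \<longlonglongrightarrow> h x" using LIMSEQ_ignore_initial_segment[OF elim, of n] by (simp add: add.commute)
        then have "(\<lambda>k. norm (g (n + k) x - g n x)) \<longlonglongrightarrow> norm (h x - g n x)" by (intro tendsto_intros)
        then have "(\<lambda>k. norm (g (n + k) x - g n x) powr p) \<longlonglongrightarrow> norm (h x - g n x) powr p"
          using p0 by (intro tendsto_powr2) (auto intro: tendsto_const)
        then have "(\<lambda>k. ennreal (norm (g (n + k) x - g n x) powr p)) \<longlonglongrightarrow> ennreal (norm (h x - g n x) powr p)"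
          by (rule tendsto_ennrealI)
        from lim_imp_Liminf[OF sequentially_bot this] show ?case
          by (simp only: norm_minus_commute[of "h x" "g n x"])
      qed
    qed
    also have "\<dots> \<le> liminf (\<lambda>k. \<integral>\<^sup>+x. ennreal (norm (g (n + k) x - g n x) powr p) \<partial>cube_measure)"
      by (rule nn_integral_liminf) measurable
    also have "\<dots> \<le> ennreal (E n powr p)"
    proof (rule Liminf_le)
      show "\<forall>\<^sub>F k in sequentially. (\<integral>\<^sup>+x. ennreal (norm (g (n + k) x - g n x) powr p) \<partial>cube_measure) \<le> ennreal (E n powr p)"
      proof (rule always_eventually, rule allI)
        fix k
        have "(\<integral>\<^sup>+x. ennreal (norm (g (n + k) x - g n x) powr p) \<partial>cube_measure)
          = ennreal (\<integral>x. norm (g (n + k) x - g n x) powr p \<partial>cube_measure)"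
          by (intro nn_integral_eq_integral Lp_integrable Lp_diff g p0) auto
        also have "\<dots> = ennreal (Lp_norm p (\<lambda>x. g (n + k) x - g n x) powr p)" by (simp add: Lp_norm_powr[OF p0])
        also have "\<dots> \<le> ennreal (E n powr p)"
          using p0 by (intro ennreal_leI powr_mono2 dist Lp_norm_nonneg) auto
        finally show "(\<integral>\<^sup>+x. ennreal (norm (g (n + k) x - g n x) powr p) \<partial>cube_measure) \<le> ennreal (E n powr p)" .
      qed
    qed simp
    finally show ?thesis .
  qed
  have ghLp: "(\<lambda>x. g n x - h x) \<in> Lp p" for n
  proof (rule Lp_I)
    show "integrable cube_measure (\<lambda>x. norm (g n x - h x) powr p)"
      using fatou[of n] by (intro integrableI_bounded) (auto intro: le_less_trans)
  qed measurable
  have bound: "Lp_norm p (\<lambda>x. g n x - h x) \<le> E n" for n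
  proof (rule Lp_norm_leI[OF p0 E0])
    have "ennreal (\<integral>x. norm (g n x - h x) powr p \<partial>cube_measure) \<le> ennreal (E n powr p)"
      using fatou[of n] by (subst nn_integral_eq_integral[symmetric]) (auto intro: Lp_integrable ghLp)
    then show "(\<integral>x. norm (g n x - h x) powr p \<partial>cube_measure) \<le> E n powr p" by simp
  qed
  have "h \<in> Lp p" using Lp_diff[OF g ghLp p0, of 0 0] by simp
  moreover have "(\<lambda>n. Lp_norm p (\<lambda>x. g n x - h x)) \<longlonglongrightarrow> 0"
  proof (rule tendsto_sandwich[OF _ _ tendsto_const])
    show "E \<longlonglongrightarrow> 0" unfolding E_def[abs_def] by (intro tendsto_mult_right_zero LIMSEQ_realpow_zero) auto
  qed (auto intro!: always_eventually Lp_norm_nonneg bound)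
  ultimately show ?thesis by blast
qed

section \<open>Density of the eigenfunctions\<close>

text \<open>\<open>cos_mult\<close> makes the span a module over the polynomials in cos x_1, ...,
  cos x_d, and \<open>base_nonzero\<close> provides an element without zeros in the open cube. The
  index is 1 after \<delta> because in the Jacobi case \<delta> annihilates the function of index
  0.\<close>

locale dense_ladder = ladder_system +
  assumes cos_mult: "\<And>i st n. \<exists>N r. \<forall>x\<in>{0..pi}. cos x * f i st n x = (\<Sum>m\<le>N. r m * f i st m x)"
    and base_nonzero: "\<And>i st x. 0 < x \<Longrightarrow> x < pi \<Longrightarrow> f i st (if st then 1 else 0) x \<noteq> 0"
begin

text \<open>Agreement is required on the closed cube, where \<open>cos_mult\<close> is
  assumed.\<close>

definition spn :: "'a set \<Rightarrow> (real ^ 'a \<Rightarrow> real) set" where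
  "spn S = {g. \<exists>K c. finite K \<and> (\<forall>x\<in>ccube. g x = (\<Sum>k\<in>K. c k * \<Psi> S k x))}"

lemma spn_\<Psi>: "\<Psi> S k \<in> spn S"
  unfolding spn_def by (auto intro!: exI[of _ "{k}"] exI[of _ "\<lambda>_. 1"])

lemma spn_cong: "g \<in> spn S \<Longrightarrow> (\<And>x. x \<in> ccube \<Longrightarrow> g' x = g x) \<Longrightarrow> g' \<in> spn S"
  unfolding spn_def by auto

lemma spn_cmult:
  assumes "g \<in> spn S"
  shows "(\<lambda>x. a * g x) \<in> spn S"
proof -
  obtain K c where "finite K" "\<forall>x\<in>ccube. g x = (\<Sum>k\<in>K. c k * \<Psi> S k x)" using assms unfolding spn_def by auto
  then show ?thesis
    unfolding spn_def by (auto intro!: exI[of _ K] exI[of _ "\<lambda>k. a * c k"] simp: sum_distrib_left mult.assoc)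
qed

lemma spn_add:
  assumes "g \<in> spn S" "h \<in> spn S"
  shows "(\<lambda>x. g x + h x) \<in> spn S"
proof -
  obtain K c where K: "finite K" "\<forall>x\<in>ccube. g x = (\<Sum>k\<in>K. c k * \<Psi> S k x)" using assms(1) unfolding spn_def by auto
  obtain L d where L: "finite L" "\<forall>x\<in>ccube. h x = (\<Sum>k\<in>L. d k * \<Psi> S k x)" using assms(2) unfolding spn_def by auto
  define c' where "c' k = (if k \<in> K then c k else 0) + (if k \<in> L then d k else 0)" for k
  have "g x + h x = (\<Sum>k\<in>K \<union> L. c' k * \<Psi> S k x)" if "x \<in> ccube" for x
  proof -
    have "(\<Sum>k\<in>K. c k * \<Psi> S k x) = (\<Sum>k\<in>K \<union> L. (if k \<in> K then c k else 0) * \<Psi> S k x)"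
      using K(1) L(1) by (intro sum.mono_neutral_cong_left) auto
    moreover have "(\<Sum>k\<in>L. d k * \<Psi> S k x) = (\<Sum>k\<in>K \<union> L. (if k \<in> L then d k else 0) * \<Psi> S k x)"
      using K(1) L(1) by (intro sum.mono_neutral_cong_left) auto
    ultimately show ?thesis using K(2) L(2) that by (simp add: c'_def sum.distrib distrib_right)
  qed
  then show ?thesis unfolding spn_def using K(1) L(1) by (auto intro!: exI[of _ "K \<union> L"] exI[of _ c'])
qed

lemma spn_sum: "(\<And>i. i \<in> I \<Longrightarrow> g i \<in> spn S) \<Longrightarrow> (\<lambda>x. \<Sum>i\<in>I. g i x) \<in> spn S"
proof (induction I rule: infinite_finite_induct)
  case (insert i I)
  then show ?case using spn_add[of "g i" S "\<lambda>x. \<Sum>i\<in>I. g i x"] by simp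
qed (auto intro!: exI[of _ "{}"] simp: spn_def)

lemma spn_cos_mult:
  assumes "g \<in> spn S"
  shows "(\<lambda>x. cos (x $ j) * g x) \<in> spn S"
proof -
  obtain K c where K: "\<forall>x\<in>ccube. g x = (\<Sum>k\<in>K. c k * \<Psi> S k x)" using assms unfolding spn_def by auto
  have "(\<lambda>x. cos (x $ j) * \<Psi> S k x) \<in> spn S" for k
  proof -
    obtain N r where r: "\<forall>x\<in>{0..pi}. cos x * f j (j \<in> S) (k $ j) x = (\<Sum>m\<le>N. r m * f j (j \<in> S) m x)"
      using cos_mult by blast
    define k' where "k' m = (\<chi> i. if i = j then m else k $ i)" for m
    have "\<Psi> S (k' m) x = f j (j \<in> S) m (x $ j) * (\<Prod>i\<in>UNIV - {j}. f i (i \<in> S) (k $ i) (x $ i))" for m x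
    proof -
      have "(\<Prod>i\<in>UNIV - {j}. f i (i \<in> S) (k' m $ i) (x $ i)) = (\<Prod>i\<in>UNIV - {j}. f i (i \<in> S) (k $ i) (x $ i))"
        by (rule prod.cong) (auto simp: k'_def)
      moreover have "k' m $ j = m" by (simp add: k'_def)
      ultimately show ?thesis unfolding \<Psi>_split[of S "k' m" x j] by (simp only:)
    qed
    then have "cos (x $ j) * \<Psi> S k x = (\<Sum>m\<le>N. r m * \<Psi> S (k' m) x)" if "x \<in> ccube" for x
    proof -
      have "cos (x $ j) * \<Psi> S k x
        = (cos (x $ j) * f j (j \<in> S) (k $ j) (x $ j)) * (\<Prod>i\<in>UNIV - {j}. f i (i \<in> S) (k $ i) (x $ i))"
        unfolding \<Psi>_split[of S k x j] by simp
      also have "\<dots> = (\<Sum>m\<le>N. r m * f j (j \<in> S) m (x $ j)) * (\<Prod>i\<in>UNIV - {j}. f i (i \<in> S) (k $ i) (x $ i))"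
        using r that by (simp add: mem_ccube)
      finally show ?thesis using \<open>\<And>x m. \<Psi> S (k' m) x = _\<close> by (simp add: sum_distrib_right mult.assoc)
    qed
    moreover have "(\<lambda>x. \<Sum>m\<le>N. r m * \<Psi> S (k' m) x) \<in> spn S"
      by (intro spn_sum spn_cmult spn_\<Psi>)
    ultimately show ?thesis by (auto intro: spn_cong)
  qed
  then have "(\<lambda>x. \<Sum>k\<in>K. c k * (cos (x $ j) * \<Psi> S k x)) \<in> spn S" by (intro spn_sum spn_cmult)
  then show ?thesis by (rule spn_cong) (use K in \<open>simp add: sum_distrib_left mult_ac\<close>)
qed

definition cosv :: "real ^ 'a \<Rightarrow> real ^ 'a" where "cosv x = (\<chi> i. cos (x $ i))"

text \<open>Induction over polynomial functions: a linear one is a combination of coordinates, and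
  the i-th coordinate acts as multiplication by cos x_i.\<close>

lemma spn_polynomial_mult:
  assumes "real_polynomial_function Q" "g \<in> spn S"
  shows "(\<lambda>x. Q (cosv x) * g x) \<in> spn S"
  using assms
proof (induction Q arbitrary: g rule: real_polynomial_function.induct)
  case (linear Q)
  have *: "Q y = (\<Sum>i\<in>UNIV. y $ i * Q (axis i 1))" for y
  proof -
    have "Q y = Q (\<Sum>i\<in>UNIV. y $ i *\<^sub>R axis i 1)"
      by (rule arg_cong[where f = Q]) (simp add: vec_eq_iff axis_def if_distrib cong: if_cong)
    then show ?thesis using linear(1) by (simp add: linear_sum[OF bounded_linear.linear] linear_scale[OF bounded_linear.linear])
  qed
  have "(\<lambda>x. \<Sum>i\<in>UNIV. Q (axis i 1) * (cos (x $ i) * g x)) \<in> spn S"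
    by (intro spn_sum spn_cmult spn_cos_mult linear(2))
  then show ?case
  proof (rule spn_cong)
    fix x
    show "Q (cosv x) * g x = (\<Sum>i\<in>UNIV. Q (axis i 1) * (cos (x $ i) * g x))"
      unfolding *[of "cosv x"] sum_distrib_right by (rule sum.cong) (auto simp: cosv_def)
  qed
next
  case (const c)
  then show ?case by (rule spn_cmult)
next
  case (add Q1 Q2)
  from spn_add[OF add.IH(1)[OF add.prems] add.IH(2)[OF add.prems]] show ?case by (simp add: distrib_right)
next
  case (mult Q1 Q2)
  from mult.IH(1)[OF mult.IH(2)[OF mult.prems]] show ?case by (simp add: mult.assoc)
qed

text \<open>Soft thresholding \<open>h\<close> at level \<open>e/2\<close> gives a function supported away from the boundary, which can be divided by
  the ground state \<open>\<omega>\<close>; the quotient is a continuous function of \<open>(cos x\<^sub>1, \<dots>, cos x\<^sub>d)\<close>.\<close>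

lemma span_uniformly_dense:
  fixes h :: "real ^ 'a \<Rightarrow> real"
  assumes h: "continuous_on ccube h" and h0: "\<And>x. x \<in> ccube \<Longrightarrow> x \<notin> cube \<Longrightarrow> h x = 0" and e: "0 < e"
  obtains K c where "finite K" "\<And>x. x \<in> ccube \<Longrightarrow> \<bar>h x - (\<Sum>k\<in>K. c k * \<Psi> S k x)\<bar> < e"
proof -
  define \<omega> where "\<omega> = \<Psi> S (\<chi> i. if i \<in> S then 1 else 0)"
  have \<omega>c: "continuous_on ccube \<omega>" unfolding \<omega>_def by (rule continuous_\<Psi>)
  have \<omega>nz: "\<omega> x \<noteq> 0" if "x \<in> cube" for x
    unfolding \<omega>_def \<Psi>_def using base_nonzero cube_nth[OF that] by simp
  define X where "X = {x \<in> ccube. e / 2 \<le> \<bar>h x\<bar>}"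
  have "compact X"
  proof -
    have "closedin (top_of_set ccube) (ccube \<inter> (\<lambda>x. \<bar>h x\<bar>) -` {e/2..})"
      by (rule continuous_closedin_preimage) (auto intro: continuous_intros h)
    then have "compact (ccube \<inter> (\<lambda>x. \<bar>h x\<bar>) -` {e/2..})" using compact_ccube closedin_compact by blast
    moreover have "X = ccube \<inter> (\<lambda>x. \<bar>h x\<bar>) -` {e/2..}" by (auto simp: X_def)
    ultimately show ?thesis by simp
  qed
  have Xcube: "x \<in> cube" if "x \<in> X" for x
    using that h0[of x] e by (cases "x \<in> cube") (auto simp: X_def)
  obtain m where m: "0 < m" "\<And>x. x \<in> X \<Longrightarrow> m \<le> (\<omega> x)\<^sup>2"
  proof (cases "X = {}")
    case True
    then show ?thesis using that[of 1] by simp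
  next
    case False
    have "continuous_on X (\<lambda>x. (\<omega> x)\<^sup>2)"
      using \<omega>c by (intro continuous_intros continuous_on_subset[OF \<omega>c]) (auto simp: X_def)
    from continuous_attains_inf[OF \<open>compact X\<close> False this] obtain y where y: "y \<in> X" "\<And>x. x \<in> X \<Longrightarrow> (\<omega> y)\<^sup>2 \<le> (\<omega> x)\<^sup>2" by auto
    then show ?thesis using that[of "(\<omega> y)\<^sup>2"] \<omega>nz[OF Xcube[OF y(1)]] by auto
  qed
  define ht where "ht x = max (h x - e / 2) 0 + min (h x + e / 2) 0" for x
  \<comment> \<open>The lower bound m for \<omega>^2 on X keeps the denominator positive everywhere
    and leaves it unchanged on X; off X the numerator is 0.\<close>
  define v where "v x = ht x * \<omega> x / max ((\<omega> x)\<^sup>2) m" for x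
  have htc: "continuous_on ccube ht" unfolding ht_def by (intro continuous_intros h)
  have vc: "continuous_on ccube v"
    unfolding v_def using m(1) by (intro continuous_intros htc \<omega>c) (auto simp: max_def)
  have v\<omega>: "v x * \<omega> x = ht x" if "x \<in> ccube" for x
  proof (cases "x \<in> X")
    case True
    have "max ((\<omega> x)\<^sup>2) m = (\<omega> x)\<^sup>2" by (rule max_absorb1[OF m(2)[OF True]])
    then show ?thesis unfolding v_def using \<omega>nz[OF Xcube[OF True]] by (simp add: power2_eq_square)
  next
    case False
    then have "ht x = 0" using that e by (auto simp: ht_def X_def max_def min_def)
    then show ?thesis by (simp add: v_def)
  qed
  obtain W where W: "0 < W" "\<And>x. x \<in> ccube \<Longrightarrow> \<bar>\<omega> x\<bar> \<le> W"
    using compact_imp_bounded[OF compact_continuous_image[OF \<omega>c compact_ccube]] by (force simp: bounded_pos)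
  define Y where "Y = cbox (\<chi> i. -1) (\<chi> i. (1 :: real)) \<inter> (UNIV :: (real ^ 'a) set)"
  define av where "av y = (\<chi> i. arccos (y $ i))" for y :: "real ^ 'a"
  have av: "av y \<in> ccube" if "y \<in> Y" for y
    using that by (auto simp: av_def Y_def mem_ccube mem_box_cart intro: arccos_lbound arccos_ubound)
  have cosvY: "cosv x \<in> Y" for x by (simp add: cosv_def Y_def mem_box_cart)
  have avcosv: "av (cosv x) = x" if "x \<in> ccube" for x
    using that by (simp add: av_def cosv_def vec_eq_iff mem_ccube arccos_cos)
  have avc: "continuous_on Y av"
    unfolding av_def
    by (intro continuous_on_vec_lambda continuous_on_arccos continuous_intros) (auto simp: Y_def mem_box_cart)
  have "continuous_on Y (\<lambda>y. v (av y))"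
    by (rule continuous_on_compose2[OF vc avc]) (use av in auto)
  moreover have "compact Y" by (simp add: Y_def)
  \<comment> \<open>The approximation of v is multiplied by \<omega>, which is at most W, and may
    use up e/2; soft thresholding takes the other e/2.\<close>
  moreover have "0 < e / (2 * W)" using e W by simp
  ultimately obtain Q where Q: "real_polynomial_function Q" "\<And>y. y \<in> Y \<Longrightarrow> \<bar>v (av y) - Q y\<bar> < e / (2 * W)"
    using Stone_Weierstrass_real_polynomial_function by blast
  have "(\<lambda>x. Q (cosv x) * \<omega> x) \<in> spn S"
    unfolding \<omega>_def by (intro spn_polynomial_mult Q spn_\<Psi>)
  then obtain K c where K: "finite K" "\<And>x. x \<in> ccube \<Longrightarrow> Q (cosv x) * \<omega> x = (\<Sum>k\<in>K. c k * \<Psi> S k x)"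
    unfolding spn_def by auto
  have "\<bar>h x - (\<Sum>k\<in>K. c k * \<Psi> S k x)\<bar> < e" if x: "x \<in> ccube" for x
  proof -
    have "\<bar>v x - Q (cosv x)\<bar> < e / (2 * W)" using Q(2)[OF cosvY, of x] avcosv[OF x] by simp
    then have "\<bar>v x - Q (cosv x)\<bar> * W < e / 2" using W(1) by (simp add: field_simps)
    moreover have "\<bar>v x - Q (cosv x)\<bar> * \<bar>\<omega> x\<bar> \<le> \<bar>v x - Q (cosv x)\<bar> * W" by (intro mult_left_mono W(2)[OF x]) simp
    moreover have "\<bar>ht x - Q (cosv x) * \<omega> x\<bar> = \<bar>v x - Q (cosv x)\<bar> * \<bar>\<omega> x\<bar>"
      unfolding v\<omega>[OF x, symmetric] abs_mult[symmetric] by (simp add: left_diff_distrib)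
    moreover have "\<bar>h x - ht x\<bar> \<le> e / 2" using e by (auto simp: ht_def max_def min_def)
    ultimately show ?thesis unfolding K(2)[OF x, symmetric] by linarith
  qed
  with K(1) show ?thesis by (rule that)
qed

end

section \<open>Riesz transforms of a ladder system\<close>

text \<open>The first argument of b always has exponent p: the large system serves p \<ge> 2, the
  small one p < 2, and P is the larger of p and q. With c = 4 gam and gam (P - 1) = 1/16 the factor
  (c/4) 17 (P - 1) equals 17/16, which dominates 1 + gam.\<close>

lemma bellman_system_exists:
  fixes p :: real
  assumes "1 < p"
  defines "q \<equiv> p / (p - 1)"
  obtains b b1 b2 b11 b12 b22 g g1 g2 T c where "bellman_system b b1 b2 b11 b12 b22 g g1 g2 T c"
    "\<And>m n. 0 < m \<Longrightarrow> 0 < n \<Longrightarrow> 0 \<le> b m n"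
    "\<And>m n. 0 < m \<Longrightarrow> 0 < n \<Longrightarrow> b m n \<le> c / 4 * (17 * (max p q - 1)) * (m powr (p / 2) + n powr (q / 2))"
proof -
  have const: "1 + 1 / (16 * (P - 1)) \<le> 4 * (1 / (16 * (P - 1))) / 4 * (17 * (P - 1))" if "2 \<le> P" for P :: real
  proof -
    have "4 * (1 / (16 * (P - 1))) / 4 * (17 * (P - 1)) = 17 / 16" using that by (simp add: field_simps)
    moreover have "1 / (16 * (P - 1)) \<le> 1 / 16" using that by (simp add: field_simps)
    ultimately show ?thesis by linarith
  qed
  show ?thesis
  proof (cases "2 \<le> p")
    case True
    interpret bellman_exponent p by unfold_locales (rule True)
    have "q \<le> p" using True by (simp add: q_def field_simps)
    then have mx: "max p q = p" by simp
    have Qq: "Q = q" by (simp add: Q_def q_def)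
    show ?thesis
    proof (rule that[OF bellman_system_large])
      fix m n :: real assume mn: "0 < m" "0 < n"
      show "0 \<le> B m n" using mn by (rule B_nonneg)
      have "B m n \<le> (1 + gam) * (m powr (p / 2) + n powr (q / 2))" using B_upper[OF mn] unfolding Qq .
      also have "\<dots> \<le> (4 * gam / 4 * (17 * (max p q - 1))) * (m powr (p / 2) + n powr (q / 2))"
        using const[OF True] unfolding mx gam_def by (intro mult_right_mono) auto
      finally show "B m n \<le> 4 * gam / 4 * (17 * (max p q - 1)) * (m powr (p / 2) + n powr (q / 2))" .
    qed
  next
    case False
    have q2: "2 \<le> q" using False assms(1) by (simp add: q_def field_simps)
    interpret bellman_exponent q by unfold_locales (rule q2)
    have mx: "max p q = q" using False q2 by simp
    have "q - 1 = 1 / (p - 1)" using assms(1) by (simp add: q_def field_simps)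
    then have Qp: "Q = p" using assms(1) by (simp add: Q_def) (simp add: q_def)
    show ?thesis
    proof (rule that[OF bellman_system_small])
      fix n m :: real assume mn: "0 < n" "0 < m"
      show "0 \<le> B m n" using mn by (intro B_nonneg)
      have "B m n \<le> (1 + gam) * (n powr (p / 2) + m powr (q / 2))" using B_upper[OF mn(2,1)] unfolding Qp by (simp add: add.commute)
      also have "\<dots> \<le> (4 * gam / 4 * (17 * (max p q - 1))) * (n powr (p / 2) + m powr (q / 2))"
        using const[OF q2] unfolding mx gam_def by (intro mult_right_mono) auto
      finally show "B m n \<le> 4 * gam / 4 * (17 * (max p q - 1)) * (n powr (p / 2) + m powr (q / 2))" .
    qed
  qed
qed

lemma powr_half_sq: "(a\<^sup>2) powr (r / 2) = \<bar>a\<bar> powr r" for a r :: real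
proof -
  have "\<bar>a\<bar> powr 2 = a\<^sup>2" using powr_realpow[of "\<bar>a\<bar>" 2] by (cases "a = 0") auto
  then have "(a\<^sup>2) powr (r / 2) = (\<bar>a\<bar> powr 2) powr (r / 2)" by simp
  also have "\<dots> = \<bar>a\<bar> powr r" unfolding powr_powr by simp
  finally show ?thesis .
qed

text \<open>Removes the regularization, with e = 1/(n + 1).\<close>

lemma integral_regularized_tendsto:
  fixes u :: "real ^ 'd \<Rightarrow> real"
  assumes u: "continuous_on ccube u" and u0: "\<And>x. 0 \<le> u x" and r: "0 < r"
  shows "(\<lambda>n. \<integral>x. (inverse (real (Suc n)) + u x) powr r \<partial>cube_measure) \<longlonglongrightarrow> (\<integral>x. u x powr r \<partial>cube_measure)"
proof -
  obtain C where C: "0 < C" "\<And>x. x \<in> ccube \<Longrightarrow> \<bar>u x\<bar> \<le> C"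
    using compact_imp_bounded[OF compact_continuous_image[OF u compact_ccube]] by (force simp: bounded_pos)
  have cont: "continuous_on ccube (\<lambda>x. (a + u x) powr r)" if "0 \<le> a" for a
    using that u0 r by (intro continuous_on_powr' continuous_intros u) auto
  have meas: "(\<lambda>x. (a + u x) powr r) \<in> borel_measurable cube_measure" if "0 \<le> a" for a
    by (rule borel_measurable_integrable[OF integral_ccube(1)[OF cont[OF that]]])
  show ?thesis
  proof (rule integral_dominated_convergence)
    show "(\<lambda>x. u x powr r) \<in> borel_measurable cube_measure" using meas[of 0] by simp
    show "(\<lambda>x. (inverse (real (Suc n)) + u x) powr r) \<in> borel_measurable cube_measure" for n by (rule meas) simp
    show "integrable cube_measure (\<lambda>x::real ^ 'd. (1 + C) powr r)" by (rule integrable_bounded_cube) auto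
    show "AE x in cube_measure. (\<lambda>n. (inverse (real (Suc n)) + u x) powr r) \<longlonglongrightarrow> u x powr r"
    proof (rule AE_I2)
      fix x
      have "(\<lambda>n. inverse (real (Suc n)) + u x) \<longlonglongrightarrow> 0 + u x" by (intro tendsto_intros LIMSEQ_inverse_real_of_nat)
      then show "(\<lambda>n. (inverse (real (Suc n)) + u x) powr r) \<longlonglongrightarrow> u x powr r"
        using r u0 by (intro tendsto_powr2) (auto intro: tendsto_const always_eventually add_nonneg_nonneg)
    qed
    show "AE x in cube_measure. norm ((inverse (real (Suc n)) + u x) powr r) \<le> (1 + C) powr r" for n
    proof (rule AE_I2)
      fix x :: "real ^ 'd" assume "x \<in> space cube_measure"
      then have "u x \<le> C" using C(2)[of x] cube_subset_ccube by auto
      moreover have "inverse (real (Suc n)) \<le> 1" by (simp add: field_simps)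
      ultimately have "inverse (real (Suc n)) + u x \<le> 1 + C" by linarith
      then show "norm ((inverse (real (Suc n)) + u x) powr r) \<le> (1 + C) powr r"
        using r u0[of x] by (auto intro!: powr_mono2 add_nonneg_nonneg)
    qed
  qed
qed

context dense_ladder
begin

text \<open>Division by \<open>mu k\<close> is L^(-1/2), and \<open>\<Psi> {i} k\<close> is
  \<delta>_i applied to the eigenfunction.\<close>

definition R :: "(nat ^ 'a) set \<Rightarrow> (nat ^ 'a \<Rightarrow> real) \<Rightarrow> real ^ 'a \<Rightarrow> real ^ 'a" where
  "R K c x = (\<chi> i. \<Sum>k\<in>K. c k / mu k * \<Psi> {i} k x)"

lemma comb_0: "comb S K c 0 x = (\<Sum>k\<in>K. c k * \<Psi> S k x)"
  by (simp add: comb_def)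

lemma continuous_R: "continuous_on ccube (R K c)"
  unfolding R_def[abs_def] by (intro continuous_on_vec_lambda continuous_intros continuous_\<Psi>)

lemma \<Psi>_boundary: "x \<in> ccube \<Longrightarrow> x \<notin> cube \<Longrightarrow> \<Psi> S k x = 0"
proof -
  assume x: "x \<in> ccube" "x \<notin> cube"
  then obtain j where "\<not> (0 < x $ j \<and> x $ j < pi)" unfolding cube_def mem_Collect_eq by blast
  with x(1) have "x $ j = 0 \<or> x $ j = pi" unfolding mem_ccube by (auto simp: not_less dest!: spec[of _ j])
  then have "sin (x $ j) = 0" by auto
  moreover obtain C where "\<forall>x\<in>ccube. \<bar>\<Psi> S k x\<bar> \<le> C * sin (x $ j)" using bound_\<Psi> by blast
  ultimately show ?thesis using x(1) by force
qed

lemma R_extend: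
  assumes "finite L" "K \<subseteq> L"
  shows "R K c = R L (\<lambda>k. if k \<in> K then c k else 0)"
proof -
  have "(\<Sum>k\<in>K. c k / mu k * \<Psi> {i} k x) = (\<Sum>k\<in>L. (if k \<in> K then c k else 0) / mu k * \<Psi> {i} k x)" for i x
    using assms by (intro sum.mono_neutral_cong_left) auto
  then show ?thesis by (simp add: R_def fun_eq_iff)
qed

lemma pairing_same_support:
  fixes p :: real
  assumes p: "1 < p" and K: "finite K"
  defines "r \<equiv> p / (p - 1)"
  shows "\<bar>\<integral>x. (\<Sum>i\<in>UNIV. R K c x $ i * comb {i} K (d i) 0 x) \<partial>cube_measure\<bar>
    \<le> 17 * (max p r - 1) * ((\<integral>x. \<bar>comb {} K c 0 x\<bar> powr p \<partial>cube_measure)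
        + (\<integral>x. norm (\<chi> i. comb {i} K (d i) 0 x) powr r \<partial>cube_measure))"
proof -
  define J where "J = (\<Sum>i\<in>UNIV. \<Sum>k\<in>K. c k * d i k / mu k * nu i k)"
  have r: "0 < r" using p by (simp add: r_def)
  obtain b b1 b2 b11 b12 b22 g g1 g2 T c' where bs: "bellman_system b b1 b2 b11 b12 b22 g g1 g2 T c'"
    and b0: "\<And>m n. 0 < m \<Longrightarrow> 0 < n \<Longrightarrow> 0 \<le> b m n"
    and bu: "\<And>m n. 0 < m \<Longrightarrow> 0 < n \<Longrightarrow> b m n \<le> c' / 4 * (17 * (max p r - 1)) * (m powr (p / 2) + n powr (r / 2))"
    by (rule bellman_system_exists[OF p, folded r_def]) (rule that)
  have c': "0 < c'" using bs by (simp add: bellman_system_def)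
  define K0 where "K0 = 17 * (max p r - 1)"
  define u where "u x = (comb {} K c 0 x)\<^sup>2" for x
  define w where "w x = (\<Sum>i\<in>UNIV. (comb {i} K (d i) 0 x)\<^sup>2)" for x
  have uc: "continuous_on ccube u" "continuous_on ccube w"
    unfolding u_def[abs_def] w_def[abs_def] by (intro continuous_intros continuous_comb)+
  have u0: "0 \<le> u x" "0 \<le> w x" for x by (auto simp: u_def w_def intro: sum_nonneg)
  have reg: "\<bar>J\<bar> \<le> K0 * ((\<integral>x. (e + u x) powr (p / 2) \<partial>cube_measure) + (\<integral>x. (e + w x) powr (r / 2) \<partial>cube_measure))"
    if e: "0 < e" for e
  proof -
    interpret bilinear A H q q' ev a0 b b1 b2 b11 b12 b22 g g1 g2 T c' K c d e
      by (intro bilinear.intro ladder_system_axioms bs bilinear_axioms.intro K e)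
    have cont: "continuous_on ccube (\<lambda>x. (e + u x) powr (p / 2))" "continuous_on ccube (\<lambda>x. (e + w x) powr (r / 2))"
    proof -
      have "0 < e + u x" "0 < e + w x" for x using e u0[of x] by auto
      then show "continuous_on ccube (\<lambda>x. (e + u x) powr (p / 2))" "continuous_on ccube (\<lambda>x. (e + w x) powr (r / 2))"
        by (intro continuous_on_powr continuous_intros uc; auto simp: less_imp_neq[symmetric])+
    qed
    have m: "m 0 x = e + u x" "n 0 x = e + w x" for x by (simp_all add: m_def n_def u_def w_def)
    have bb: "continuous_on ccube (\<lambda>x. b (e + u x) (e + w x))" using continuous_b(1)[of 0] by (simp add: m)
    have J4: "(\<Sum>i\<in>UNIV. \<Sum>k\<in>K. c k * d i k / (4 * mu k) * nu i k) = J / 4"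
      unfolding J_def sum_divide_distrib by (intro sum.cong refl) simp
    have "c' * \<bar>J / 4\<bar> \<le> (\<integral>x. b (e + u x) (e + w x) - b e e \<partial>cube_measure)"
      using bilinear_estimate unfolding m J4 by simp
    also have "\<dots> \<le> (\<integral>x. c' / 4 * K0 * ((e + u x) powr (p / 2) + (e + w x) powr (r / 2)) \<partial>cube_measure)"
    proof (rule integral_mono)
      show "integrable cube_measure (\<lambda>x. b (e + u x) (e + w x) - b e e)"
        by (intro integral_ccube continuous_intros bb)
      show "integrable cube_measure (\<lambda>x. c' / 4 * K0 * ((e + u x) powr (p / 2) + (e + w x) powr (r / 2)))"
        by (intro integral_ccube continuous_on_mult continuous_on_const continuous_on_add cont)
      fix x
      have "b (e + u x) (e + w x) \<le> c' / 4 * K0 * ((e + u x) powr (p / 2) + (e + w x) powr (r / 2))"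
        unfolding K0_def using e u0[of x] by (intro bu add_pos_nonneg)
      then show "b (e + u x) (e + w x) - b e e \<le> c' / 4 * K0 * ((e + u x) powr (p / 2) + (e + w x) powr (r / 2))"
        using b0[OF e e] by linarith
    qed
    also have "\<dots> = c' / 4 * K0 * ((\<integral>x. (e + u x) powr (p / 2) \<partial>cube_measure) + (\<integral>x. (e + w x) powr (r / 2) \<partial>cube_measure))"
      using integral_ccube(1)[OF cont(1)] integral_ccube(1)[OF cont(2)] by simp
    finally have "c' / 4 * \<bar>J\<bar> \<le> c' / 4 * (K0 * ((\<integral>x. (e + u x) powr (p / 2) \<partial>cube_measure) + (\<integral>x. (e + w x) powr (r / 2) \<partial>cube_measure)))"
      by (simp add: mult.assoc)
    then show ?thesis using c' by simp
  qed
  have "\<bar>J\<bar> \<le> K0 * ((\<integral>x. u x powr (p / 2) \<partial>cube_measure) + (\<integral>x. w x powr (r / 2) \<partial>cube_measure))"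
  proof (rule LIMSEQ_le_const)
    show "(\<lambda>n. K0 * ((\<integral>x. (inverse (real (Suc n)) + u x) powr (p / 2) \<partial>cube_measure)
          + (\<integral>x. (inverse (real (Suc n)) + w x) powr (r / 2) \<partial>cube_measure)))
      \<longlonglongrightarrow> K0 * ((\<integral>x. u x powr (p / 2) \<partial>cube_measure) + (\<integral>x. w x powr (r / 2) \<partial>cube_measure))"
      using p r by (intro tendsto_intros integral_regularized_tendsto uc u0) auto
    show "\<exists>N. \<forall>n\<ge>N. \<bar>J\<bar> \<le> K0 * ((\<integral>x. (inverse (real (Suc n)) + u x) powr (p / 2) \<partial>cube_measure)
          + (\<integral>x. (inverse (real (Suc n)) + w x) powr (r / 2) \<partial>cube_measure))"
      using reg by (intro exI[of _ 0] allI impI) (simp del: of_nat_Suc)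
  qed
  moreover have "u x powr (p / 2) = \<bar>comb {} K c 0 x\<bar> powr p" for x
    unfolding u_def by (rule powr_half_sq)
  moreover have "w x powr (r / 2) = norm (\<chi> i. comb {i} K (d i) 0 x) powr r" for x
  proof -
    have "w x = (norm (\<chi> i. comb {i} K (d i) 0 x))\<^sup>2"
      by (simp add: w_def norm_vec_def L2_set_def sum_nonneg)
    then show ?thesis by (simp add: powr_half_sq)
  qed
  moreover have "(\<integral>x. (\<Sum>i\<in>UNIV. R K c x $ i * comb {i} K (d i) 0 x) \<partial>cube_measure) = J"
  proof -
    have R: "R K c x $ i = comb {i} K (\<lambda>k. c k / mu k) 0 x" for i x by (simp add: R_def comb_0)
    have int: "integrable cube_measure (\<lambda>x. R K c x $ i * comb {i} K (d i) 0 x)" for i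
      unfolding R by (intro integral_ccube continuous_intros continuous_comb)
    have "(\<integral>x. (\<Sum>i\<in>UNIV. R K c x $ i * comb {i} K (d i) 0 x) \<partial>cube_measure)
      = (\<Sum>i\<in>UNIV. \<integral>x. R K c x $ i * comb {i} K (d i) 0 x \<partial>cube_measure)"
      using int by simp
    also have "\<dots> = J"
      unfolding R J_def integral_comb_single[OF K] nu_def by simp
    finally show ?thesis .
  qed
  ultimately show ?thesis unfolding K0_def by simp
qed

text \<open>Padding with zeros brings c and the expansions of all g_i to a common finite index
  set.\<close>

lemma pairing:
  fixes p :: real
  assumes p: "1 < p" and K: "finite K" and g: "\<And>i. g i \<in> spn {i}"
  defines "r \<equiv> p / (p - 1)"
  shows "\<bar>\<integral>x. (\<Sum>i\<in>UNIV. R K c x $ i * g i x) \<partial>cube_measure\<bar>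
    \<le> 17 * (max p r - 1) * ((\<integral>x. \<bar>\<Sum>k\<in>K. c k * \<Psi> {} k x\<bar> powr p \<partial>cube_measure)
        + (\<integral>x. norm (\<chi> i. g i x) powr r \<partial>cube_measure))"
proof -
  have "\<forall>i. \<exists>Ld. finite (fst Ld) \<and> (\<forall>x\<in>ccube. g i x = (\<Sum>k\<in>fst Ld. snd Ld k * \<Psi> {i} k x))"
    using g unfolding spn_def by auto
  from choice[OF this] obtain Ld where Ld: "\<And>i. finite (fst (Ld i))"
    "\<And>i x. x \<in> ccube \<Longrightarrow> g i x = (\<Sum>k\<in>fst (Ld i). snd (Ld i) k * \<Psi> {i} k x)" by blast
  define L where "L = K \<union> (\<Union>i. fst (Ld i))"
  have L: "finite L" "K \<subseteq> L" "fst (Ld i) \<subseteq> L" for i using K Ld(1) by (auto simp: L_def)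
  define c' where "c' k = (if k \<in> K then c k else 0)" for k
  define d where "d i k = (if k \<in> fst (Ld i) then snd (Ld i) k else 0)" for i k
  have 1: "R K c = R L c'" unfolding c'_def using R_extend[OF L(1,2)] by simp
  have 2: "g i x = comb {i} L (d i) 0 x" if "x \<in> cube" for i x
  proof -
    have "x \<in> ccube" using that cube_subset_ccube by auto
    then show ?thesis
      unfolding Ld(2)[OF \<open>x \<in> ccube\<close>] comb_0 d_def using L by (intro sum.mono_neutral_cong_left) auto
  qed
  have 3: "(\<Sum>k\<in>K. c k * \<Psi> {} k x) = comb {} L c' 0 x" for x
    unfolding comb_0 c'_def using L by (intro sum.mono_neutral_cong_left) auto
  have 4: "(\<integral>x. (\<Sum>i\<in>UNIV. R K c x $ i * g i x) \<partial>cube_measure) = (\<integral>x. (\<Sum>i\<in>UNIV. R L c' x $ i * comb {i} L (d i) 0 x) \<partial>cube_measure)"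
    unfolding 1 by (rule Bochner_Integration.integral_cong) (simp_all add: 2)
  have 5: "(\<integral>x. norm (\<chi> i. g i x) powr r \<partial>cube_measure) = (\<integral>x. norm (\<chi> i. comb {i} L (d i) 0 x) powr r \<partial>cube_measure)"
    by (rule Bochner_Integration.integral_cong) (simp_all add: 2)
  show ?thesis
    unfolding 4 5 3 unfolding r_def by (rule pairing_same_support[OF p L(1)])
qed

end

text \<open>For p < 2 the scalar factor is singular at 0, but the norm of the product is the power p
  - 1 of the norm, which tends to 0.\<close>

lemma continuous_on_powr_scaleR:
  fixes h :: "'a::topological_space \<Rightarrow> 'b::real_normed_vector"
  assumes h: "continuous_on X h" and p: "1 < p"
  shows "continuous_on X (\<lambda>x. norm (h x) powr (p - 2) *\<^sub>R h x)"
proof -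
  have "continuous_on UNIV (\<lambda>v::'b. norm v powr (p - 2) *\<^sub>R v)"
    unfolding continuous_on_eq_continuous_at[OF open_UNIV]
  proof
    fix v :: 'b
    show "isCont (\<lambda>v. norm v powr (p - 2) *\<^sub>R v) v"
    proof (cases "v = 0")
      case False
      then show ?thesis by (intro continuous_intros) auto
    next
      case True
      have "((\<lambda>v::'b. norm v powr (p - 1)) \<longlongrightarrow> 0) (at 0)"
      proof -
        have "((\<lambda>v::'b. norm v powr (p - 1)) \<longlongrightarrow> norm (0::'b) powr (p - 1)) (at 0)"
          using p by (intro tendsto_powr2 tendsto_norm tendsto_ident_at tendsto_const) auto
        then show ?thesis using p by simp
      qed
      moreover have "norm (norm v powr (p - 2) *\<^sub>R v) = norm v powr (p - 1)" for v :: 'b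
        using powr_mult_base[of "norm v" "p - 2"] by (simp add: mult.commute)
      ultimately have "((\<lambda>v::'b. norm v powr (p - 2) *\<^sub>R v) \<longlongrightarrow> 0) (at 0)"
        by (intro tendsto_norm_zero_cancel[where f = "\<lambda>v::'b. norm v powr (p - 2) *\<^sub>R v"]) simp
      then show ?thesis using True by (simp add: isCont_def)
    qed
  qed
  then show ?thesis
    using continuous_on_compose2[OF _ h, of UNIV "\<lambda>v. norm v powr (p - 2) *\<^sub>R v"] by simp
qed

context dense_ladder
begin

text \<open>The pairing is tested with \<open>g\<close> close to \<open>|h|\<^sup>p\<^sup>-\<^sup>2 h\<close> for \<open>h = R K c\<close>, and \<open>c\<close> is rescaled by \<open>\<lambda> = 2 K\<^sub>0\<close> so that the
  term coming from \<open>g\<close> is absorbed.\<close>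

lemma riesz_bound:
  fixes p :: real
  assumes p: "1 < p" and K: "finite K"
  shows "Lp_norm p (R K c) \<le> 34 * (max p (p / (p - 1)) - 1) * Lp_norm p (\<lambda>x. \<Sum>k\<in>K. c k * \<Psi> {} k x)"
proof -
  define r where "r = p / (p - 1)"
  define K0 where "K0 = 17 * (max p r - 1)"
  have r: "0 < r" using p by (simp add: r_def)
  have K0: "0 < K0" using p by (simp add: K0_def max_def)
  define h where "h = R K c"
  define G where "G x = norm (h x) powr (p - 2) *\<^sub>R h x" for x
  have hc: "continuous_on ccube h" unfolding h_def by (rule continuous_R)
  have Gc: "continuous_on ccube G" unfolding G_def[abs_def] by (rule continuous_on_powr_scaleR[OF hc p])
  \<comment> \<open>The approximation by \<open>span_uniformly_dense\<close> needs a function that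
    vanishes on the boundary of the cube.\<close>
  have G0: "G x = 0" if "x \<in> ccube" "x \<notin> cube" for x
    using \<Psi>_boundary[OF that] by (simp add: G_def h_def R_def vec_eq_iff)
  have normG: "norm (G x) = norm (h x) powr (p - 1)" for x
    unfolding G_def using powr_mult_base[of "norm (h x)" "p - 2"] by (simp add: mult.commute)
  have "\<forall>n i. \<exists>g. g \<in> spn {i} \<and> (\<forall>x\<in>ccube. \<bar>G x $ i - g x\<bar> < inverse (real (Suc n)))"
  proof (intro allI)
    fix n i
    have "continuous_on ccube (\<lambda>x. G x $ i)" by (intro continuous_intros Gc)
    from span_uniformly_dense[OF this, of "inverse (real (Suc n))" "{i}"] G0
    obtain L d where "finite L" "\<And>x. x \<in> ccube \<Longrightarrow> \<bar>G x $ i - (\<Sum>k\<in>L. d k * \<Psi> {i} k x)\<bar> < inverse (real (Suc n))"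
      by auto
    then show "\<exists>g. g \<in> spn {i} \<and> (\<forall>x\<in>ccube. \<bar>G x $ i - g x\<bar> < inverse (real (Suc n)))"
      by (intro exI[of _ "\<lambda>x. \<Sum>k\<in>L. d k * \<Psi> {i} k x"]) (auto intro!: spn_sum spn_cmult spn_\<Psi>)
  qed
  then have "\<exists>g. \<forall>n i. g n i \<in> spn {i} \<and> (\<forall>x\<in>ccube. \<bar>G x $ i - g n i x\<bar> < inverse (real (Suc n)))"
    by (subst choice_iff[symmetric] | rule allI | assumption)+
  then obtain g where g: "\<And>n i. g n i \<in> spn {i}"
    "\<And>n i x. x \<in> ccube \<Longrightarrow> \<bar>G x $ i - g n i x\<bar> < inverse (real (Suc n))" by blast
  obtain Cs where Cs: "0 < Cs" "\<And>x. x \<in> ccube \<Longrightarrow> norm (h x) \<le> Cs"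
    using compact_imp_bounded[OF compact_continuous_image[OF hc compact_ccube]] by (force simp: bounded_pos)
  obtain Cg where Cg: "0 < Cg" "\<And>x. x \<in> ccube \<Longrightarrow> norm (G x) \<le> Cg"
    using compact_imp_bounded[OF compact_continuous_image[OF Gc compact_ccube]] by (force simp: bounded_pos)
  have lim: "(\<lambda>n. g n i x) \<longlonglongrightarrow> G x $ i" if "x \<in> ccube" for x i
  proof (rule Lim_null_comparison[THEN LIM_zero_cancel])
    show "\<forall>\<^sub>F n in sequentially. norm (g n i x - G x $ i) \<le> inverse (real (Suc n))"
      using g(2)[OF that] by (auto intro!: always_eventually less_imp_le simp: abs_minus_commute)
  qed (rule LIMSEQ_inverse_real_of_nat)
  have gb: "\<bar>g n i x\<bar> \<le> Cg + 1" if "x \<in> ccube" for n i x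
  proof -
    have "inverse (real (Suc n)) \<le> 1" by (simp add: field_simps)
    moreover have "\<bar>G x $ i\<bar> \<le> Cg" using component_le_norm_cart[of "G x" i] Cg(2)[OF that] by linarith
    ultimately show ?thesis using g(2)[OF that, of i n] by linarith
  qed
  have gm: "g n i \<in> borel_measurable cube_measure" for n i
  proof -
    obtain L d where "\<forall>x\<in>ccube. g n i x = (\<Sum>k\<in>L. d k * \<Psi> {i} k x)" using g(1)[of n i] unfolding spn_def by auto
    moreover have "continuous_on ccube (\<lambda>x. \<Sum>k\<in>L. d k * \<Psi> {i} k x)" by (intro continuous_intros continuous_\<Psi>)
    ultimately have "continuous_on ccube (g n i)" by (metis (no_types, lifting) continuous_on_cong)
    then show ?thesis by (rule borel_measurable_integrable[OF integral_ccube(1)])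
  qed
  have hm: "(\<lambda>x. h x $ i) \<in> borel_measurable cube_measure" "(\<lambda>x. G x $ i) \<in> borel_measurable cube_measure" for i
    by (intro borel_measurable_integrable[OF integral_ccube(1)] continuous_intros hc Gc)+
  have vecm: "(\<lambda>x. norm (\<chi> i. f i x)) \<in> borel_measurable cube_measure"
    if [measurable]: "\<And>i. f i \<in> borel_measurable cube_measure" for f :: "'a \<Rightarrow> real ^ 'a \<Rightarrow> real"
    unfolding norm_vec_def L2_set_def by simp
  define Hh where "Hh = (\<integral>x. norm (h x) powr p \<partial>cube_measure)"
  have inner: "(\<Sum>i\<in>UNIV. h x $ i * G x $ i) = norm (h x) powr p" for x
  proof -
    have "(\<Sum>i\<in>UNIV. h x $ i * G x $ i) = norm (h x) powr (p - 2) * (norm (h x))\<^sup>2"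
    proof -
      have "(norm (h x))\<^sup>2 = (\<Sum>i\<in>UNIV. (h x $ i)\<^sup>2)" by (simp add: norm_vec_def L2_set_def sum_nonneg)
      then show ?thesis unfolding G_def sum_distrib_left by (simp only: sum_distrib_left) (simp add: power2_eq_square mult_ac)
    qed
    also have "\<dots> = norm (h x) powr p"
    proof (cases "h x = 0")
      case False
      then have "norm (h x) powr p = norm (h x) powr (p - 2) * norm (h x) powr 2" by (simp only: powr_add[symmetric]) simp
      also have "norm (h x) powr 2 = (norm (h x))\<^sup>2" using powr_realpow[of "norm (h x)" 2] False by simp
      finally show ?thesis ..
    qed (use p in simp)
    finally show ?thesis .
  qed
  have L1: "(\<lambda>n. \<integral>x. (\<Sum>i\<in>UNIV. h x $ i * g n i x) \<partial>cube_measure) \<longlonglongrightarrow> Hh"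
    unfolding Hh_def inner[symmetric]
  proof (rule integral_dominated_convergence)
    show "integrable cube_measure (\<lambda>x::real ^ 'a. \<Sum>i\<in>(UNIV::'a set). Cs * (Cg + 1))" by (rule integrable_bounded_cube) auto
    show "AE x in cube_measure. norm (\<Sum>i\<in>UNIV. h x $ i * g n i x) \<le> (\<Sum>i\<in>(UNIV::'a set). Cs * (Cg + 1))" for n
    proof (rule AE_I2)
      fix x :: "real ^ 'a" assume "x \<in> space cube_measure"
      then have x: "x \<in> ccube" using cube_subset_ccube by auto
      have "\<bar>h x $ i * g n i x\<bar> \<le> Cs * (Cg + 1)" for i
        unfolding abs_mult using gb[OF x] Cs(2)[OF x] component_le_norm_cart[of "h x" i] Cs(1) by (intro mult_mono) auto
      then show "norm (\<Sum>i\<in>UNIV. h x $ i * g n i x) \<le> (\<Sum>i\<in>(UNIV::'a set). Cs * (Cg + 1))"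
        by (intro order_trans[OF norm_sum] sum_mono) simp
    qed
    show "AE x in cube_measure. (\<lambda>n. \<Sum>i\<in>UNIV. h x $ i * g n i x) \<longlonglongrightarrow> (\<Sum>i\<in>UNIV. h x $ i * G x $ i)"
      using cube_subset_ccube by (intro AE_I2 tendsto_intros lim) auto
  qed (use hm gm in \<open>auto intro!: borel_measurable_sum borel_measurable_times\<close>)
  have GH: "norm (G x) powr r = norm (h x) powr p" for x
    unfolding normG powr_powr r_def using p by simp
  have L2: "(\<lambda>n. \<integral>x. norm (\<chi> i. g n i x) powr r \<partial>cube_measure) \<longlonglongrightarrow> Hh"
    unfolding Hh_def GH[symmetric]
  proof (rule integral_dominated_convergence)
    show "integrable cube_measure (\<lambda>x::real ^ 'a. (\<Sum>i\<in>(UNIV::'a set). Cg + 1) powr r)" by (rule integrable_bounded_cube) auto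
    show "AE x in cube_measure. norm (norm (\<chi> i. g n i x) powr r) \<le> (\<Sum>i\<in>(UNIV::'a set). Cg + 1) powr r" for n
    proof (rule AE_I2)
      fix x :: "real ^ 'a" assume "x \<in> space cube_measure"
      then have x: "x \<in> ccube" using cube_subset_ccube by auto
      have "norm (\<chi> i. g n i x) \<le> (\<Sum>i\<in>UNIV. \<bar>(\<chi> i. g n i x) $ i\<bar>)" by (rule norm_le_l1_cart)
      also have "\<dots> \<le> (\<Sum>i\<in>(UNIV::'a set). Cg + 1)" using gb[OF x] by (intro sum_mono) simp
      finally show "norm (norm (\<chi> i. g n i x) powr r) \<le> (\<Sum>i\<in>(UNIV::'a set). Cg + 1) powr r"
        using r by (simp add: powr_mono2)
    qed
    show "AE x in cube_measure. (\<lambda>n. norm (\<chi> i. g n i x) powr r) \<longlonglongrightarrow> norm (G x) powr r"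
    proof (rule AE_I2)
      fix x :: "real ^ 'a" assume "x \<in> space cube_measure"
      then have x: "x \<in> ccube" using cube_subset_ccube by auto
      have "(\<lambda>n. \<chi> i. g n i x) \<longlonglongrightarrow> G x" by (rule vec_tendstoI) (simp add: lim[OF x])
      then show "(\<lambda>n. norm (\<chi> i. g n i x) powr r) \<longlonglongrightarrow> norm (G x) powr r"
        using r by (intro tendsto_powr2 tendsto_norm tendsto_const) auto
    qed
    show "(\<lambda>x. norm (G x) powr r) \<in> borel_measurable cube_measure"
      using r by (intro borel_measurable_integrable[OF integral_ccube(1)] continuous_on_powr' continuous_intros Gc) auto
    show "(\<lambda>x. norm (\<chi> i. g n i x) powr r) \<in> borel_measurable cube_measure" for n
      using vecm[OF gm] by simp
  qed
  define F where "F = (\<integral>x. \<bar>\<Sum>k\<in>K. c k * \<Psi> {} k x\<bar> powr p \<partial>cube_measure)"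
  define l where "l = 2 * K0"
  have l: "0 < l" using K0 by (simp add: l_def)
  have Rl: "R K (\<lambda>k. l * c k) x = l *\<^sub>R h x" for x
    by (simp add: R_def h_def vec_eq_iff sum_distrib_left mult.assoc)
  have ul: "(\<Sum>k\<in>K. l * c k * \<Psi> {} k x) = l * (\<Sum>k\<in>K. c k * \<Psi> {} k x)" for x
    by (simp add: sum_distrib_left mult.assoc)
  have "l * \<bar>\<integral>x. (\<Sum>i\<in>UNIV. h x $ i * g n i x) \<partial>cube_measure\<bar>
      \<le> K0 * (l powr p * F + (\<integral>x. norm (\<chi> i. g n i x) powr r \<partial>cube_measure))" for n
  proof -
    have "\<bar>\<integral>x. (\<Sum>i\<in>UNIV. R K (\<lambda>k. l * c k) x $ i * g n i x) \<partial>cube_measure\<bar>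
      \<le> K0 * ((\<integral>x. \<bar>\<Sum>k\<in>K. l * c k * \<Psi> {} k x\<bar> powr p \<partial>cube_measure) + (\<integral>x. norm (\<chi> i. g n i x) powr r \<partial>cube_measure))"
      unfolding K0_def r_def by (rule pairing[OF p K g(1)])
    moreover have "(\<integral>x. (\<Sum>i\<in>UNIV. R K (\<lambda>k. l * c k) x $ i * g n i x) \<partial>cube_measure)
      = l * (\<integral>x. (\<Sum>i\<in>UNIV. h x $ i * g n i x) \<partial>cube_measure)"
    proof -
      have "(\<Sum>i\<in>UNIV. R K (\<lambda>k. l * c k) x $ i * g n i x) = l * (\<Sum>i\<in>UNIV. h x $ i * g n i x)" for x
        unfolding Rl by (simp add: sum_distrib_left mult.assoc)
      then show ?thesis by simp
    qed
    moreover have "(\<integral>x. \<bar>\<Sum>k\<in>K. l * c k * \<Psi> {} k x\<bar> powr p \<partial>cube_measure) = l powr p * F"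
      unfolding ul F_def using l by (simp add: abs_mult powr_mult)
    ultimately show ?thesis using l by (simp add: abs_mult)
  qed
  then have "l * \<bar>Hh\<bar> \<le> K0 * (l powr p * F + Hh)"
    by (intro LIMSEQ_le[OF tendsto_mult[OF tendsto_const tendsto_rabs[OF L1]] tendsto_mult[OF tendsto_const tendsto_add[OF tendsto_const L2]]]) auto
  moreover have "0 \<le> Hh" unfolding Hh_def by simp
  ultimately have "K0 * Hh \<le> K0 * (l powr p * F)" by (simp add: l_def algebra_simps)
  then have HF: "Hh \<le> l powr p * F" using K0 by simp
  have F: "F = Lp_norm p (\<lambda>x. \<Sum>k\<in>K. c k * \<Psi> {} k x) powr p"
    using p by (simp add: Lp_norm_powr F_def)
  have "Lp_norm p h \<le> l * Lp_norm p (\<lambda>x. \<Sum>k\<in>K. c k * \<Psi> {} k x)"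
    using HF l p unfolding Hh_def F by (intro Lp_norm_leI) (auto simp: powr_mult Lp_norm_nonneg)
  then show ?thesis by (simp add: h_def l_def K0_def r_def)
qed

end

lemma Lp_norm_dominated_convergence:
  fixes s :: "nat \<Rightarrow> real ^ 'd \<Rightarrow> real"
  assumes "\<And>n. s n \<in> borel_measurable cube_measure" "integrable cube_measure w" "0 < p"
    "AE x in cube_measure. (\<lambda>n. s n x) \<longlonglongrightarrow> 0" "\<And>n x. x \<in> cube \<Longrightarrow> \<bar>s n x\<bar> powr p \<le> w x"
  shows "(\<lambda>n. Lp_norm p (s n)) \<longlonglongrightarrow> 0"
proof -
  note [measurable] = assms(1)
  have "(\<lambda>n. \<integral>x. \<bar>s n x\<bar> powr p \<partial>cube_measure) \<longlonglongrightarrow> (\<integral>x. 0 \<partial>(cube_measure :: (real ^ 'd) measure))"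
  proof (rule integral_dominated_convergence[OF _ _ assms(2)])
    show "AE x in cube_measure. (\<lambda>n. \<bar>s n x\<bar> powr p) \<longlonglongrightarrow> 0"
      using assms(4)
    proof eventually_elim
      case (elim x)
      then have "(\<lambda>n. \<bar>s n x\<bar> powr p) \<longlonglongrightarrow> \<bar>0\<bar> powr p"
        using assms(3) by (intro tendsto_powr2 tendsto_rabs tendsto_const) auto
      then show ?case using assms(3) by simp
    qed
    show "AE x in cube_measure. norm (\<bar>s n x\<bar> powr p) \<le> w x" for n
      using assms(5) by (intro AE_I2) auto
    show "(\<lambda>x. \<bar>s n x\<bar> powr p) \<in> borel_measurable cube_measure" for n by measurable
  qed simp
  then have "(\<lambda>n. (\<integral>x. \<bar>s n x\<bar> powr p \<partial>cube_measure) powr (1 / p)) \<longlonglongrightarrow> 0 powr (1 / p)"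
    using assms(3) by (intro tendsto_powr2 tendsto_const) auto
  then show ?thesis using assms(3) by (simp add: Lp_norm_def)
qed

text \<open>Bounded functions are dense, and bounded functions are pointwise limits of continuous ones, which
  can be cut off near the boundary of the cube.\<close>

lemma continuous_dense_Lp:
  fixes f :: "real ^ 'd \<Rightarrow> real"
  assumes f: "f \<in> Lp p" and p: "1 \<le> p" and e: "0 < e"
  obtains h where "continuous_on ccube h" "\<And>x. x \<in> ccube \<Longrightarrow> x \<notin> cube \<Longrightarrow> h x = 0" "Lp_norm p (\<lambda>x. f x - h x) < e"
proof -
  have p0: "0 < p" using p by simp
  note [measurable] = Lp_measurable[OF f]
  define cl where "cl M t = max (- M) (min M t)" for M t :: real
  have cl_bound: "\<bar>cl M t\<bar> \<le> M" if "0 \<le> M" for M t using that by (auto simp: cl_def max_def min_def)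
  have "(\<lambda>n. Lp_norm p (\<lambda>x. f x - cl (real n) (f x))) \<longlonglongrightarrow> 0"
  proof (rule Lp_norm_dominated_convergence)
    show "integrable cube_measure (\<lambda>x. norm (f x) powr p)" by (rule Lp_integrable[OF f])
    show "(\<lambda>x. f x - cl (real n) (f x)) \<in> borel_measurable cube_measure" for n unfolding cl_def by measurable
    show "\<bar>f x - cl (real n) (f x)\<bar> powr p \<le> norm (f x) powr p" for n x
      using p0 by (intro powr_mono2) (auto simp: cl_def max_def min_def)
    show "AE x in cube_measure. (\<lambda>n. f x - cl (real n) (f x)) \<longlonglongrightarrow> 0"
    proof (rule AE_I2)
      fix x
      obtain N :: nat where "\<bar>f x\<bar> \<le> real N" using real_arch_simple by blast
      then have "\<forall>\<^sub>F n in sequentially. f x - cl (real n) (f x) = 0"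
        by (intro eventually_sequentiallyI[of N]) (auto simp: cl_def max_def min_def)
      then show "(\<lambda>n. f x - cl (real n) (f x)) \<longlonglongrightarrow> 0" by (rule tendsto_eventually)
    qed
  qed (rule p0)
  then have "\<forall>\<^sub>F n in sequentially. Lp_norm p (\<lambda>x. f x - cl (real n) (f x)) < e / 2"
    using e by (intro order_tendstoD) auto
  then obtain M where M: "Lp_norm p (\<lambda>x. f x - cl (real M) (f x)) < e / 2"
    by (auto simp: eventually_sequentially)
  define f1 where "f1 x = cl (real M) (f x)" for x
  have f1m [measurable]: "f1 \<in> borel_measurable cube_measure" unfolding f1_def cl_def by measurable
  have f1b: "\<bar>f1 x\<bar> \<le> real M" for x unfolding f1_def by (rule cl_bound) simp
  have "f1 measurable_on cube" using f1m by (simp add: measurable_on_iff_borel_measurable)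
  then obtain N gs where N: "negligible N" and gs: "\<And>n. continuous_on UNIV (gs n)"
    "\<And>x. x \<notin> N \<Longrightarrow> (\<lambda>n. gs n x) \<longlonglongrightarrow> (if x \<in> cube then f1 x else 0)"
    unfolding measurable_on_def by blast
  \<comment> \<open>A cutoff that vanishes on the boundary and, at each point of the open cube,
    equals 1 for all large n.\<close>
  define cut where "cut n x = min 1 (real n * (\<Prod>i\<in>UNIV. sin (x $ i)))" for n :: nat and x :: "real ^ 'd"
  define hs where "hs n x = cut n x * cl (real M) (gs n x)" for n x
  have cut: "0 \<le> cut n x" "cut n x \<le> 1" if "x \<in> ccube" for n x
    using that by (auto simp: cut_def mem_ccube intro!: mult_nonneg_nonneg prod_nonneg sin_ge_zero)
  have hc: "continuous_on ccube (hs n)" for n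
    unfolding hs_def cut_def cl_def by (intro continuous_intros continuous_on_subset[OF gs(1)]) auto
  have h0: "hs n x = 0" if "x \<in> ccube" "x \<notin> cube" for n x
  proof -
    have "x \<notin> cube" by (rule that(2))
    then obtain j where "\<not> (0 < x $ j \<and> x $ j < pi)" unfolding cube_def mem_Collect_eq by blast
    with that(1) have "x $ j = 0 \<or> x $ j = pi" unfolding mem_ccube by (auto simp: not_less dest!: spec[of _ j])
    then have "sin (x $ j) = 0" by auto
    then have "(\<Prod>i\<in>UNIV. sin (x $ i)) = 0" by (intro prod_zero) auto
    then show ?thesis unfolding hs_def cut_def by (simp only: mult_zero_right)
  qed
  have hb: "\<bar>hs n x\<bar> \<le> real M" if "x \<in> ccube" for n x
    unfolding hs_def abs_mult using cut[OF that, of n] cl_bound[of "real M" "gs n x"] mult_mono[of "cut n x" 1 "\<bar>cl (real M) (gs n x)\<bar>" "real M"] by simp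
  have "(\<lambda>n. Lp_norm p (\<lambda>x. f1 x - hs n x)) \<longlonglongrightarrow> 0"
  proof (rule Lp_norm_dominated_convergence)
    have [measurable]: "hs n \<in> borel_measurable cube_measure" for n
      by (rule borel_measurable_integrable[OF integral_ccube(1)[OF hc]])
    show "(\<lambda>x. f1 x - hs n x) \<in> borel_measurable cube_measure" for n by measurable
    show "integrable cube_measure (\<lambda>x::real ^ 'd. (2 * real M) powr p)" by (rule integrable_bounded_cube) auto
    show "\<bar>f1 x - hs n x\<bar> powr p \<le> (2 * real M) powr p" if "x \<in> cube" for n x
      using f1b[of x] hb[of x n] that cube_subset_ccube p0 by (intro powr_mono2) auto
    have "AE x in lebesgue. x \<notin> N"
      using N by (simp add: negligible_iff_null_sets AE_not_in)
    then have "AE x in cube_measure. x \<notin> N"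
      by (auto simp: AE_restrict_space_iff elim: eventually_mono)
    then show "AE x in cube_measure. (\<lambda>n. f1 x - hs n x) \<longlonglongrightarrow> 0"
    proof (rule AE_mp, intro AE_I2 impI)
      fix x :: "real ^ 'd" assume "x \<in> space cube_measure" and xN: "x \<notin> N"
      then have x: "x \<in> cube" by simp
      have pr: "0 < (\<Prod>i\<in>UNIV. sin (x $ i))" using sin_pos_cube[OF x] by (intro prod_pos) auto
      obtain n0 :: nat where "1 / (\<Prod>i\<in>UNIV. sin (x $ i)) \<le> real n0" using real_arch_simple by blast
      then have "\<forall>\<^sub>F n in sequentially. cut n x = 1"
      proof (intro eventually_sequentiallyI[of n0])
        fix n assume "n0 \<le> n"
        then have "1 / (\<Prod>i\<in>UNIV. sin (x $ i)) \<le> real n"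
          using \<open>1 / _ \<le> real n0\<close> by (meson of_nat_le_iff order_trans)
        then show "cut n x = 1" using pr by (simp add: cut_def pos_divide_le_eq)
      qed
      then have c: "(\<lambda>n. cut n x) \<longlonglongrightarrow> 1" by (rule tendsto_eventually)
      have "(\<lambda>n. gs n x) \<longlonglongrightarrow> f1 x" using gs(2)[OF xN] x by simp
      then have "(\<lambda>n. cl (real M) (gs n x)) \<longlonglongrightarrow> cl (real M) (f1 x)"
        unfolding cl_def by (intro tendsto_intros)
      moreover have "cl (real M) (f1 x) = f1 x" using f1b[of x] by (auto simp: cl_def max_def min_def abs_le_iff)
      ultimately have "(\<lambda>n. f1 x - hs n x) \<longlonglongrightarrow> f1 x - 1 * f1 x"
        unfolding hs_def using c by (intro tendsto_intros) auto
      then show "(\<lambda>n. f1 x - hs n x) \<longlonglongrightarrow> 0" by simp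
    qed
  qed (rule p0)
  then have "\<forall>\<^sub>F n in sequentially. Lp_norm p (\<lambda>x. f1 x - hs n x) < e / 2"
    using e by (intro order_tendstoD) auto
  then obtain n where n: "Lp_norm p (\<lambda>x. f1 x - hs n x) < e / 2"
    by (auto simp: eventually_sequentially)
  have "f1 \<in> Lp p" using f1b p0 by (intro Lp_bounded[where C = "real M"]) auto
  moreover have "hs n \<in> Lp p"
    using hb cube_subset_ccube p0 by (intro Lp_bounded[where C = "real M"] borel_measurable_integrable[OF integral_ccube(1)[OF hc]]) auto
  ultimately have "Lp_norm p (\<lambda>x. f x - hs n x) \<le> Lp_norm p (\<lambda>x. f x - f1 x) + Lp_norm p (\<lambda>x. f1 x - hs n x)"
    using f p by (intro Lp_norm_triangle_diff)
  also have "\<dots> < e" using M n unfolding f1_def by simp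
  finally show ?thesis using that[of "hs n"] hc h0 by blast
qed

section \<open>Extension of the Riesz transforms from the span to L^p\<close>

locale normalized_ladder = dense_ladder +
  assumes normalized: "\<And>k. (\<integral>x. (\<Psi> {} k x)\<^sup>2 \<partial>cube_measure) = 1"
begin

definition lincomb :: "(nat ^ 'a) set \<Rightarrow> (nat ^ 'a \<Rightarrow> real) \<Rightarrow> real ^ 'a \<Rightarrow> real" where
  "lincomb K c x = (\<Sum>k\<in>K. c k * \<Psi> {} k x)"

definition coef :: "(real ^ 'a \<Rightarrow> real) \<Rightarrow> nat ^ 'a \<Rightarrow> real" where
  "coef v k = L2_inner v (\<Psi> {} k)"

text \<open>On the span the support of the coefficients is finite. If it is infinite, the sum takes
  the default value 0, so that \<open>riesz v\<close> lies in every \<open>Lp p\<close> for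
  arbitrary v.\<close>

definition riesz :: "(real ^ 'a \<Rightarrow> real) \<Rightarrow> real ^ 'a \<Rightarrow> real ^ 'a" where
  "riesz v = R {k. coef v k \<noteq> 0} (coef v)"

definition poly_span :: "(real ^ 'a \<Rightarrow> real) set" where
  "poly_span = {v. \<exists>K c. finite K \<and> v = lincomb K c}"

lemma coef_lincomb:
  assumes "finite K"
  shows "coef (lincomb K c) k = (if k \<in> K then c k else 0)"
proof -
  have orth: "(\<integral>x. \<Psi> {} l x * \<Psi> {} k x \<partial>cube_measure) = (if l = k then 1 else 0)" for l
    using orthogonal[of l k] normalized[of k] by (auto simp: power2_eq_square)
  have "coef (lincomb K c) k = (\<integral>x. (\<Sum>l\<in>K. c l * (\<Psi> {} l x * \<Psi> {} k x)) \<partial>cube_measure)"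
    unfolding coef_def L2_inner_def lincomb_def by (simp add: sum_distrib_right mult.assoc)
  also have "\<dots> = (\<Sum>l\<in>K. c l * (\<integral>x. \<Psi> {} l x * \<Psi> {} k x \<partial>cube_measure))"
    using integrable_\<Psi>_mult by simp
  also have "\<dots> = (\<Sum>l\<in>K. if l = k then c l else 0)" unfolding orth by (intro sum.cong) auto
  finally show ?thesis using assms by simp
qed

lemma R_subset:
  assumes "finite L" "{k. coef v k \<noteq> 0} \<subseteq> L"
  shows "R L (coef v) = riesz v"
proof -
  have "(\<lambda>k. if k \<in> {k. coef v k \<noteq> 0} then coef v k else 0) = coef v" by auto
  then show ?thesis unfolding riesz_def using R_extend[OF assms, of "coef v"] by simp
qed

lemma riesz_lincomb:
  assumes "finite K"
  shows "riesz (lincomb K c) = R K c"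
proof -
  have "{k. coef (lincomb K c) k \<noteq> 0} \<subseteq> K" by (auto simp: coef_lincomb[OF assms])
  from R_subset[OF assms this] have "riesz (lincomb K c) = R K (coef (lincomb K c))" ..
  also have "\<dots> = R K c" by (auto simp: R_def coef_lincomb[OF assms] fun_eq_iff vec_eq_iff intro!: sum.cong)
  finally show ?thesis .
qed

lemma finite_coef_support: "v \<in> poly_span \<Longrightarrow> finite {k. coef v k \<noteq> 0}"
proof -
  assume "v \<in> poly_span"
  then obtain K c where K: "finite K" "v = lincomb K c" by (auto simp: poly_span_def)
  then show ?thesis by (intro finite_subset[OF _ K(1)]) (auto simp: coef_lincomb)
qed

lemma lincomb_extend:
  assumes "finite L" "K \<subseteq> L"
  shows "lincomb K c = lincomb L (\<lambda>k. if k \<in> K then c k else 0)"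
  unfolding lincomb_def fun_eq_iff using assms by (intro allI sum.mono_neutral_cong_left) auto

lemma poly_span_diff:
  assumes "v \<in> poly_span" "g \<in> poly_span"
  shows "(\<lambda>x. v x - g x) \<in> poly_span" "riesz (\<lambda>x. v x - g x) = (\<lambda>x. riesz v x - riesz g x)"
proof -
  obtain K c where K: "finite K" "v = lincomb K c" using assms(1) by (auto simp: poly_span_def)
  obtain L d where L: "finite L" "g = lincomb L d" using assms(2) by (auto simp: poly_span_def)
  define c' where "c' k = (if k \<in> K then c k else 0)" for k
  define d' where "d' k = (if k \<in> L then d k else 0)" for k
  have U: "finite (K \<union> L)" using K L by simp
  have v: "v = lincomb (K \<union> L) c'" and g: "g = lincomb (K \<union> L) d'"
    using lincomb_extend[OF U, of K c] lincomb_extend[OF U, of L d] K L by (auto simp: c'_def[abs_def] d'_def[abs_def])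
  have fg: "(\<lambda>x. v x - g x) = lincomb (K \<union> L) (\<lambda>k. c' k - d' k)"
    unfolding v g by (simp add: lincomb_def fun_eq_iff sum_subtractf left_diff_distrib)
  then show "(\<lambda>x. v x - g x) \<in> poly_span" unfolding poly_span_def using U by blast
  show "riesz (\<lambda>x. v x - g x) = (\<lambda>x. riesz v x - riesz g x)"
    unfolding fg unfolding v g riesz_lincomb[OF U]
    by (simp add: R_def fun_eq_iff vec_eq_iff sum_subtractf left_diff_distrib diff_divide_distrib)
qed

lemma poly_span_Lp:
  assumes "v \<in> poly_span" "0 < p"
  shows "v \<in> Lp p"
proof -
  obtain K c where v: "v = lincomb K c" using assms(1) by (auto simp: poly_span_def)
  have c: "continuous_on ccube v" unfolding v lincomb_def[abs_def] by (intro continuous_intros continuous_\<Psi>)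
  obtain C where "\<And>x. x \<in> ccube \<Longrightarrow> norm (v x) \<le> C"
    using compact_imp_bounded[OF compact_continuous_image[OF c compact_ccube]] by (force simp: bounded_iff)
  then show ?thesis
    using cube_subset_ccube assms(2)
    by (intro Lp_bounded[where C = C] measurable_continuous_cube continuous_on_subset[OF c cube_subset_ccube]) auto
qed

lemma riesz_Lp:
  assumes "0 < p"
  shows "riesz v \<in> Lp p"
proof -
  have c: "continuous_on ccube (riesz v)" unfolding riesz_def by (rule continuous_R)
  obtain C where "\<And>x. x \<in> ccube \<Longrightarrow> norm (riesz v x) \<le> C"
    using compact_imp_bounded[OF compact_continuous_image[OF c compact_ccube]] by (force simp: bounded_iff)
  then show ?thesis
    using cube_subset_ccube assms
    by (intro Lp_bounded[where C = C] measurable_continuous_cube continuous_on_subset[OF c cube_subset_ccube]) auto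
qed

lemma poly_span_dense:
  fixes v :: "real ^ 'a \<Rightarrow> real"
  assumes v: "v \<in> Lp p" and p: "1 \<le> p" and e: "0 < e"
  shows "\<exists>g\<in>poly_span. Lp_norm p (\<lambda>x. v x - g x) < e"
proof -
  have p0: "0 < p" using p by simp
  have e2: "0 < e / 2" using e by simp
  obtain h where h: "continuous_on ccube h" "\<And>x. x \<in> ccube \<Longrightarrow> x \<notin> cube \<Longrightarrow> h x = 0" "Lp_norm p (\<lambda>x. v x - h x) < e / 2"
    using continuous_dense_Lp[OF v p e2] by blast
  define W where "W = Lp_norm p (\<lambda>x :: real ^ 'a. 1 :: real)"
  have W: "0 \<le> W" unfolding W_def by (rule Lp_norm_nonneg)
  \<comment> \<open>A uniform error d costs at most d W in the seminorm, where W is the seminorm of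
    the constant 1; with W + 1 in the denominator this stays below e/4, also for W = 0.\<close>
  define d where "d = e / (4 * (W + 1))"
  have d: "0 < d" using e W by (simp add: d_def)
  obtain K c where K: "finite K" "\<And>x. x \<in> ccube \<Longrightarrow> \<bar>h x - (\<Sum>k\<in>K. c k * \<Psi> {} k x)\<bar> < d"
    using span_uniformly_dense[OF h(1,2) d, of "{}"] by blast
  define g where "g = lincomb K c"
  have gs: "g \<in> poly_span" using K(1) by (auto simp: poly_span_def g_def)
  have gL: "g \<in> Lp p" by (rule poly_span_Lp[OF gs p0])
  obtain C where "\<And>x. x \<in> ccube \<Longrightarrow> norm (h x) \<le> C"
    using compact_imp_bounded[OF compact_continuous_image[OF h(1) compact_ccube]] by (force simp: bounded_iff)
  then have hL: "h \<in> Lp p"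
    using cube_subset_ccube p0
    by (intro Lp_bounded[where C = C] measurable_continuous_cube continuous_on_subset[OF h(1) cube_subset_ccube]) auto
  have "Lp_norm p (\<lambda>x. h x - g x) \<le> d * W"
  proof (rule Lp_norm_leI[OF p0])
    have "(\<integral>x. norm (h x - g x) powr p \<partial>cube_measure) \<le> (\<integral>x. d powr p * norm (1::real) powr p \<partial>(cube_measure :: (real ^ 'a) measure))"
    proof (rule integral_mono)
      show "integrable cube_measure (\<lambda>x. norm (h x - g x) powr p)" by (intro Lp_integrable Lp_diff hL gL p0)
      show "integrable cube_measure (\<lambda>x::real ^ 'a. d powr p * norm (1::real) powr p)" by (rule integrable_bounded_cube) auto
      fix x :: "real ^ 'a" assume "x \<in> space cube_measure"
      then have "x \<in> ccube" using cube_subset_ccube by auto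
      from K(2)[OF this] show "norm (h x - g x) powr p \<le> d powr p * norm (1::real) powr p"
        using p0 by (simp add: g_def lincomb_def powr_mono2)
    qed
    also have "\<dots> = d powr p * W powr p" unfolding W_def Lp_norm_powr[OF p0] by simp
    finally show "(\<integral>x. norm (h x - g x) powr p \<partial>cube_measure) \<le> (d * W) powr p"
      using d W by (simp add: powr_mult)
  qed (use d W in simp)
  also have "d * W < e / 2"
  proof -
    have "d * W \<le> d * (W + 1)" using d by simp
    also have "\<dots> = e / 4" using W by (simp add: d_def field_simps)
    finally show ?thesis using e by simp
  qed
  finally have "Lp_norm p (\<lambda>x. v x - g x) < e"
    using Lp_norm_triangle_diff[OF v hL gL p] h(3) by simp
  then show ?thesis using gs by blast
qed

definition riesz_const :: "real \<Rightarrow> real" where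
  "riesz_const p = 34 * (max p (p / (p - 1)) - 1)"

lemma riesz_const_nonneg: "1 < p \<Longrightarrow> 0 \<le> riesz_const p"
  by (simp add: riesz_const_def max_def)

lemma riesz_bound_span:
  assumes "1 < p" "v \<in> poly_span"
  shows "Lp_norm p (riesz v) \<le> riesz_const p * Lp_norm p v"
proof -
  obtain K c where K: "finite K" "v = lincomb K c" using assms(2) by (auto simp: poly_span_def)
  show ?thesis
    using riesz_bound[OF assms(1) K(1), of c] unfolding K(2) riesz_lincomb[OF K(1)] riesz_const_def unfolding lincomb_def[abs_def] .
qed

lemma riesz_lipschitz_span:
  assumes "1 < p" "v \<in> poly_span" "g \<in> poly_span"
  shows "Lp_norm p (\<lambda>x. riesz v x - riesz g x) \<le> riesz_const p * Lp_norm p (\<lambda>x. v x - g x)"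
  using riesz_bound_span[OF assms(1) poly_span_diff(1)[OF assms(2,3)]] unfolding poly_span_diff(2)[OF assms(2,3)] .

lemma riesz_extension_exists:
  assumes p: "1 < p"
  obtains T :: "(real ^ 'a \<Rightarrow> real) \<Rightarrow> real ^ 'a \<Rightarrow> real ^ 'a" where "\<And>v. v \<in> Lp p \<Longrightarrow> T v \<in> Lp p"
    "\<And>v. v \<in> poly_span \<Longrightarrow> T v = riesz v"
    "\<And>v g. v \<in> Lp p \<Longrightarrow> g \<in> Lp p \<Longrightarrow> Lp_norm p (\<lambda>x. T v x - T g x) \<le> riesz_const p * Lp_norm p (\<lambda>x. v x - g x)"
proof -
  have p0: "0 < p" and p1: "1 \<le> p" using p by auto
  note C0 = riesz_const_nonneg[OF p]
  define approx where "approx v s h \<longleftrightarrow> (\<forall>n::nat. s n \<in> poly_span) \<and> (\<lambda>n. Lp_norm p (\<lambda>x. v x - s n x)) \<longlonglongrightarrow> 0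
      \<and> h \<in> Lp p \<and> (\<lambda>n. Lp_norm p (\<lambda>x. riesz (s n) x - h x)) \<longlonglongrightarrow> 0" for v s h
  \<comment> \<open>On the span the limit is fixed to be \<open>riesz v\<close> itself: limits in
    L^p are unique only almost everywhere, and an arbitrary choice could differ from it on a null
    set.\<close>
  have ex: "\<exists>h s. approx v s h \<and> (v \<in> poly_span \<longrightarrow> h = riesz v)" if v: "v \<in> Lp p" for v
  proof (cases "v \<in> poly_span")
    case True
    have "approx v (\<lambda>_. v) (riesz v)"
      unfolding approx_def using True p0 riesz_Lp[OF p0] by (simp add: Lp_norm_def)
    then show ?thesis by blast
  next
    case False
    have "\<forall>n. \<exists>g. g \<in> poly_span \<and> Lp_norm p (\<lambda>x. v x - g x) < (1/4) ^ n"
      using poly_span_dense[OF v p1] by (meson zero_less_divide_1_iff zero_less_numeral zero_less_power)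
    from choice[OF this] obtain s where s: "\<And>n. s n \<in> poly_span" "\<And>n. Lp_norm p (\<lambda>x. v x - s n x) < (1/4) ^ n" by blast
    have sL: "s n \<in> Lp p" for n by (rule poly_span_Lp[OF s(1) p0])
    have "\<exists>h\<in>Lp p. (\<lambda>n. Lp_norm p (\<lambda>x. riesz (s n) x - h x)) \<longlonglongrightarrow> 0"
    proof (rule Lp_fast_Cauchy_limit[OF riesz_Lp[OF p0] p1])
      show "0 \<le> riesz_const p * 2" using C0 by simp
      fix n
      have "Lp_norm p (\<lambda>x. s (Suc n) x - s n x) \<le> Lp_norm p (\<lambda>x. s (Suc n) x - v x) + Lp_norm p (\<lambda>x. v x - s n x)"
        by (rule Lp_norm_triangle_diff[OF sL v sL p1])
      also have "\<dots> \<le> (1/4) ^ Suc n + (1/4) ^ n"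
        using s(2)[of n] s(2)[of "Suc n"] unfolding Lp_norm_minus_commute[of p "s (Suc n)" v] by linarith
      also have "\<dots> \<le> 2 * (1/4) ^ n" by simp
      finally have "riesz_const p * Lp_norm p (\<lambda>x. s (Suc n) x - s n x) \<le> riesz_const p * (2 * (1/4) ^ n)"
        using C0 by (rule mult_left_mono)
      then show "Lp_norm p (\<lambda>x. riesz (s (Suc n)) x - riesz (s n) x) \<le> riesz_const p * 2 * (1/4) ^ n"
        using riesz_lipschitz_span[OF p s(1) s(1), of "Suc n" n] by simp
    qed
    moreover have "(\<lambda>n. Lp_norm p (\<lambda>x. v x - s n x)) \<longlonglongrightarrow> 0"
    proof (rule tendsto_sandwich[OF _ _ tendsto_const])
      show "(\<lambda>n. (1/4 :: real) ^ n) \<longlonglongrightarrow> 0" by (rule LIMSEQ_realpow_zero) auto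
    qed (auto intro!: always_eventually Lp_norm_nonneg less_imp_le s(2))
    ultimately show ?thesis using s(1) False unfolding approx_def by blast
  qed
  have "\<forall>v. \<exists>h. v \<in> Lp p \<longrightarrow> (\<exists>s. approx v s h) \<and> (v \<in> poly_span \<longrightarrow> h = riesz v)"
    using ex by blast
  from choice[OF this] obtain T where T: "\<And>v. v \<in> Lp p \<Longrightarrow> \<exists>s. approx v s (T v)"
    "\<And>v. v \<in> Lp p \<Longrightarrow> v \<in> poly_span \<Longrightarrow> T v = riesz v" by blast
  have "Lp_norm p (\<lambda>x. T v x - T g x) \<le> riesz_const p * Lp_norm p (\<lambda>x. v x - g x)" if v: "v \<in> Lp p" and g: "g \<in> Lp p" for v g
  proof -
    obtain s where s: "\<And>n. s n \<in> poly_span" "(\<lambda>n. Lp_norm p (\<lambda>x. v x - s n x)) \<longlonglongrightarrow> 0"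
      "T v \<in> Lp p" "(\<lambda>n. Lp_norm p (\<lambda>x. riesz (s n) x - T v x)) \<longlonglongrightarrow> 0"
      using T(1)[OF v] unfolding approx_def by blast
    obtain t where t: "\<And>n. t n \<in> poly_span" "(\<lambda>n. Lp_norm p (\<lambda>x. g x - t n x)) \<longlonglongrightarrow> 0"
      "T g \<in> Lp p" "(\<lambda>n. Lp_norm p (\<lambda>x. riesz (t n) x - T g x)) \<longlonglongrightarrow> 0"
      using T(1)[OF g] unfolding approx_def by blast
    have sL: "s n \<in> Lp p" "t n \<in> Lp p" for n using s(1) t(1) poly_span_Lp[OF _ p0] by auto
    have le: "Lp_norm p (\<lambda>x. T v x - T g x) \<le> Lp_norm p (\<lambda>x. riesz (s n) x - T v x)
        + riesz_const p * (Lp_norm p (\<lambda>x. v x - s n x) + Lp_norm p (\<lambda>x. v x - g x) + Lp_norm p (\<lambda>x. g x - t n x))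
        + Lp_norm p (\<lambda>x. riesz (t n) x - T g x)" for n
    proof -
      have "Lp_norm p (\<lambda>x. T v x - T g x) \<le> Lp_norm p (\<lambda>x. T v x - riesz (s n) x) + Lp_norm p (\<lambda>x. riesz (s n) x - T g x)"
        by (rule Lp_norm_triangle_diff[OF s(3) riesz_Lp[OF p0] t(3) p1])
      moreover have "Lp_norm p (\<lambda>x. riesz (s n) x - T g x)
         \<le> Lp_norm p (\<lambda>x. riesz (s n) x - riesz (t n) x) + Lp_norm p (\<lambda>x. riesz (t n) x - T g x)"
        by (rule Lp_norm_triangle_diff[OF riesz_Lp[OF p0] riesz_Lp[OF p0] t(3) p1])
      moreover have "Lp_norm p (\<lambda>x. riesz (s n) x - riesz (t n) x) \<le> riesz_const p * Lp_norm p (\<lambda>x. s n x - t n x)"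
        by (rule riesz_lipschitz_span[OF p s(1) t(1)])
      moreover have "Lp_norm p (\<lambda>x. s n x - t n x) \<le> Lp_norm p (\<lambda>x. v x - s n x) + Lp_norm p (\<lambda>x. v x - g x) + Lp_norm p (\<lambda>x. g x - t n x)"
        using Lp_norm_triangle_diff[OF sL(1) v sL(2) p1, of n n] Lp_norm_triangle_diff[OF v g sL(2) p1, of n]
        unfolding Lp_norm_minus_commute[of p "s n" v] by linarith
      then have "riesz_const p * Lp_norm p (\<lambda>x. s n x - t n x)
         \<le> riesz_const p * (Lp_norm p (\<lambda>x. v x - s n x) + Lp_norm p (\<lambda>x. v x - g x) + Lp_norm p (\<lambda>x. g x - t n x))"
        using C0 by (rule mult_left_mono)
      ultimately show ?thesis unfolding Lp_norm_minus_commute[of p "T v"] by linarith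
    qed
    have "(\<lambda>n. Lp_norm p (\<lambda>x. riesz (s n) x - T v x)
        + riesz_const p * (Lp_norm p (\<lambda>x. v x - s n x) + Lp_norm p (\<lambda>x. v x - g x) + Lp_norm p (\<lambda>x. g x - t n x))
        + Lp_norm p (\<lambda>x. riesz (t n) x - T g x))
      \<longlonglongrightarrow> 0 + riesz_const p * (0 + Lp_norm p (\<lambda>x. v x - g x) + 0) + 0"
      by (intro tendsto_intros s t)
    from LIMSEQ_le_const[OF this] le show ?thesis by simp
  qed
  then show ?thesis
    using T poly_span_Lp[OF _ p0] by (intro that[of T]) (auto simp: approx_def)
qed



text \<open>An extension is prescribed on the span only up to null sets, hence the almost everywhere
  hypothesis; density and continuity carry the bound over to every extension.\<close>

lemma extension_bound:
  fixes S :: "(real ^ 'a \<Rightarrow> real) \<Rightarrow> real ^ 'a \<Rightarrow> real ^ 'a"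
  assumes p: "1 < p" and S: "\<And>v. v \<in> Lp p \<Longrightarrow> S v \<in> Lp p"
    and cont: "\<And>F v. v \<in> Lp p \<Longrightarrow> (\<And>n::nat. F n \<in> Lp p) \<Longrightarrow> (\<lambda>n. Lp_norm p (\<lambda>x. F n x - v x)) \<longlonglongrightarrow> 0 \<Longrightarrow>
      (\<lambda>n. Lp_norm p (\<lambda>x. S (F n) x - S v x)) \<longlonglongrightarrow> 0"
    and eq: "\<And>v. v \<in> poly_span \<Longrightarrow> AE x in cube_measure. S v x = riesz v x"
    and v: "v \<in> Lp p"
  shows "Lp_norm p (S v) \<le> riesz_const p * Lp_norm p v"
proof -
  have p0: "0 < p" and p1: "1 \<le> p" using p by auto
  note C0 = riesz_const_nonneg[OF p]
  have "\<forall>n. \<exists>g. g \<in> poly_span \<and> Lp_norm p (\<lambda>x. v x - g x) < inverse (real (Suc n))"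
    using poly_span_dense[OF v p1] by (meson inverse_positive_iff_positive of_nat_0_less_iff zero_less_Suc)
  from choice[OF this] obtain s where s: "\<And>n. s n \<in> poly_span" "\<And>n. Lp_norm p (\<lambda>x. v x - s n x) < inverse (real (Suc n))" by blast
  have sL: "s n \<in> Lp p" for n by (rule poly_span_Lp[OF s(1) p0])
  have lim: "(\<lambda>n. Lp_norm p (\<lambda>x. s n x - v x)) \<longlonglongrightarrow> 0"
  proof (rule tendsto_sandwich[OF _ _ tendsto_const LIMSEQ_inverse_real_of_nat])
    show "\<forall>\<^sub>F n in sequentially. Lp_norm p (\<lambda>x. s n x - v x) \<le> inverse (real (Suc n))"
      using s(2) by (subst Lp_norm_minus_commute) (auto intro!: always_eventually less_imp_le)
  qed (auto intro!: always_eventually Lp_norm_nonneg)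
  have lim2: "(\<lambda>n. Lp_norm p (\<lambda>x. S (s n) x - S v x)) \<longlonglongrightarrow> 0" by (rule cont[OF v sL lim])
  have le: "Lp_norm p (S v) \<le> Lp_norm p (\<lambda>x. S (s n) x - S v x) + riesz_const p * (Lp_norm p (\<lambda>x. s n x - v x) + Lp_norm p v)" for n
  proof -
    have "Lp_norm p (S v) \<le> Lp_norm p (\<lambda>x. S v x - S (s n) x) + Lp_norm p (S (s n))"
      by (rule Lp_norm_triangle2[OF S[OF v] S[OF sL] p1])
    moreover have "Lp_norm p (S (s n)) = Lp_norm p (riesz (s n))"
      using Lp_measurable[OF S[OF sL]] Lp_measurable[OF riesz_Lp[OF p0]] eq[OF s(1)] by (rule Lp_norm_cong_AE)
    moreover have "Lp_norm p (riesz (s n)) \<le> riesz_const p * Lp_norm p (s n)" by (rule riesz_bound_span[OF p s(1)])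
    moreover have "riesz_const p * Lp_norm p (s n) \<le> riesz_const p * (Lp_norm p (\<lambda>x. s n x - v x) + Lp_norm p v)"
      by (intro mult_left_mono Lp_norm_triangle2 sL v p1 C0)
    ultimately show ?thesis unfolding Lp_norm_minus_commute[of p "S v"] by linarith
  qed
  have "(\<lambda>n. Lp_norm p (\<lambda>x. S (s n) x - S v x) + riesz_const p * (Lp_norm p (\<lambda>x. s n x - v x) + Lp_norm p v))
     \<longlonglongrightarrow> 0 + riesz_const p * (0 + Lp_norm p v)"
    by (intro tendsto_intros lim lim2)
  from LIMSEQ_le_const[OF this] le show ?thesis by simp
qed

end

section \<open>Jacobi functions\<close>

definition jacobi_coeff :: "real \<Rightarrow> real \<Rightarrow> nat \<Rightarrow> nat \<Rightarrow> real" where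
  "jacobi_coeff a b n s = ((real n + a) gchoose (n - s)) * ((real n + b) gchoose s)"

lemma pderiv_sum: "pderiv (sum f I) = (\<Sum>i\<in>I. pderiv (f i))"
  by (induction I rule: infinite_finite_induct) (simp_all add: pderiv_add)

definition jpoly :: "real \<Rightarrow> real \<Rightarrow> nat \<Rightarrow> real poly" where
  "jpoly a b n = (\<Sum>s\<le>n. smult (jacobi_coeff a b n s) ([:-1/2, 1/2:] ^ s * [:1/2, 1/2:] ^ (n - s)))"

lemma poly_jpoly: "poly (jpoly a b n) t = jacobi_poly a b n t"
proof -
  have 1: "poly [:-1/2, 1/2:] t = (t - 1) / 2" "poly [:1/2, 1/2:] t = (t + 1) / 2" by (simp_all add: field_simps)
  show ?thesis
    unfolding jpoly_def jacobi_poly_def jacobi_coeff_def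
    by (simp only: poly_sum poly_smult poly_mult poly_power 1 mult.assoc)
qed

lemma gchoose_pos:
  assumes "real k \<le> x + 1" "0 < x + 1 - real k"
  shows "0 < x gchoose k"
  unfolding gbinomial_prod_rev using assms by (intro divide_pos_pos prod_pos) auto

lemma jacobi_coeff_pos: "-1 < a \<Longrightarrow> -1 < b \<Longrightarrow> s \<le> n \<Longrightarrow> 0 < jacobi_coeff a b n s"
  unfolding jacobi_coeff_def by (intro mult_pos_pos gchoose_pos) auto

lemma degree_jpoly: "degree (jpoly a b n) \<le> n"
  unfolding jpoly_def
proof (rule degree_sum_le)
  fix s assume "s \<in> {..n}"
  have "degree ([:-1/2, 1/2 :: real:] ^ s * [:1/2, 1/2:] ^ (n - s)) \<le> 1 * s + 1 * (n - s)"
    by (intro order_trans[OF degree_mult_le] add_mono order_trans[OF degree_power_le]) auto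
  then show "degree (smult (jacobi_coeff a b n s) ([:-1/2, 1/2:] ^ s * [:1/2, 1/2:] ^ (n - s))) \<le> n"
    using \<open>s \<in> {..n}\<close> by (intro order_trans[OF degree_smult_le]) auto
qed simp

text \<open>Every summand contributes (1/2)^n times a positive coefficient, so nothing cancels in
  the top degree.\<close>

lemma coeff_jpoly_pos:
  assumes "-1 < a" "-1 < b"
  shows "0 < coeff (jpoly a b n) n"
proof -
  have c: "coeff ([:-1/2, 1/2 :: real:] ^ s * [:1/2, 1/2:] ^ (n - s)) n = (1/2) ^ n" if "s \<le> n" for s
  proof -
    let ?p = "[:-1/2, 1/2 :: real:] ^ s * [:1/2, 1/2:] ^ (n - s)"
    have "degree ?p = n" using that by (simp add: degree_mult_eq degree_power_eq)
    then have "coeff ?p n = lead_coeff ?p" by simp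
    also have "\<dots> = (1/2) ^ s * (1/2) ^ (n - s)" by (simp add: lead_coeff_mult lead_coeff_power)
    also have "\<dots> = (1/2) ^ n" using that by (simp add: power_add[symmetric])
    finally show ?thesis .
  qed
  have "coeff (jpoly a b n) n = (\<Sum>s\<le>n. jacobi_coeff a b n s * (1/2) ^ n)"
    unfolding jpoly_def coeff_sum coeff_smult by (intro sum.cong refl) (simp only: c atMost_iff)
  also have "0 < \<dots>" using jacobi_coeff_pos[OF assms] by (intro sum_pos) auto
  finally show ?thesis .
qed

lemma jpoly_nonzero: "-1 < a \<Longrightarrow> -1 < b \<Longrightarrow> jpoly a b n \<noteq> 0"
  using coeff_jpoly_pos[of a b n] by auto

lemma gchoose_Suc: "real (Suc k) * (x gchoose Suc k) = (x - real k) * (x gchoose k)"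
  using gbinomial_mult_1[of x k] by (simp add: algebra_simps)

text \<open>Apply (k+1) binom(x, k+1) = (x - k) binom(x, k) to both binomial coefficients. In
  \<open>jacobi_ode\<close> this recursion lets the off-diagonal terms be collected on the
  diagonal.\<close>

lemma jacobi_coeff_rec:
  assumes "s < n"
  shows "jacobi_coeff a b n (Suc s) * (real (Suc s) * (real (Suc s) + a))
    = jacobi_coeff a b n s * (real (n - s) * (real (n - s) + b))"
proof -
  obtain k where k: "n - s = Suc k" "n - Suc s = k" using assms by (metis Suc_diff_Suc)
  have nk: "real n = real s + real k + 1" using k assms by linarith
  have 1: "real (Suc k) * ((real n + a) gchoose Suc k) = (real (Suc s) + a) * ((real n + a) gchoose k)"
    unfolding gchoose_Suc using nk by simp
  have 2: "real (Suc s) * ((real n + b) gchoose Suc s) = (real (Suc k) + b) * ((real n + b) gchoose s)"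
    unfolding gchoose_Suc using nk by simp
  have "jacobi_coeff a b n (Suc s) * (real (Suc s) * (real (Suc s) + a))
    = ((real (Suc s) + a) * ((real n + a) gchoose k)) * (real (Suc s) * ((real n + b) gchoose Suc s))"
    unfolding jacobi_coeff_def k by (simp only: mult_ac)
  also have "\<dots> = jacobi_coeff a b n s * (real (n - s) * (real (n - s) + b))"
    unfolding jacobi_coeff_def k 1[symmetric] 2 by (simp only: mult_ac)
  finally show ?thesis .
qed

text \<open>In the basis \<open>A\<^sup>s B\<^sup>n\<^sup>-\<^sup>s\<close> with \<open>A = (t - 1)/2\<close> and \<open>B = (t + 1)/2\<close> the Jacobi operator is tridiagonal, and
  the recursion of the coefficients collapses it to a multiple of the identity.\<close>

lemma jacobi_ode:
  fixes a b t :: real and n :: nat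
  defines "p \<equiv> jpoly a b n"
  shows "(1 - t\<^sup>2) * poly (pderiv (pderiv p)) t + (b - a - (a + b + 2) * t) * poly (pderiv p) t
     + real n * (real n + a + b + 1) * poly p t = 0"
proof -
  define A where "A = (t - 1) / 2"
  define B where "B = (t + 1) / 2"
  define c where "c = jacobi_coeff a b n"
  define E where "E s = A ^ s * B ^ (n - s)" for s
  define T1 where "T1 s = real s * A ^ (s - 1) * B ^ (n - s) + real (n - s) * A ^ s * B ^ (n - s - 1)" for s
  define T2 where "T2 s = real s * real (s - 1) * A ^ (s - 2) * B ^ (n - s) + 2 * real s * real (n - s) * A ^ (s - 1) * B ^ (n - s - 1)
     + real (n - s) * real (n - s - 1) * A ^ s * B ^ (n - s - 2)" for s
  have AB: "poly [:-1/2, 1/2:] t = A" "poly [:1/2, 1/2:] t = B" by (simp_all add: A_def B_def field_simps)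
  have dA: "pderiv ([:-1/2, 1/2 :: real:] ^ k) = smult (real k / 2) ([:-1/2, 1/2:] ^ (k - 1))"
    and dB: "pderiv ([:1/2, 1/2 :: real:] ^ k) = smult (real k / 2) ([:1/2, 1/2:] ^ (k - 1))" for k
    by (simp_all add: pderiv_power pderiv_pCons)
  have p0: "poly p t = (\<Sum>s\<le>n. c s * E s)"
    unfolding p_def jpoly_def c_def E_def by (simp only: poly_sum poly_smult poly_mult poly_power AB)
  have p1: "poly (pderiv p) t = (\<Sum>s\<le>n. c s * T1 s) / 2"
    unfolding p_def jpoly_def c_def T1_def sum_divide_distrib
    by (simp only: pderiv_sum pderiv_smult pderiv_mult dA dB poly_sum poly_smult poly_mult poly_add poly_power AB)
       (intro sum.cong refl, simp add: field_simps)
  have p2: "poly (pderiv (pderiv p)) t = (\<Sum>s\<le>n. c s * T2 s) / 4"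
    unfolding p_def jpoly_def c_def T2_def sum_divide_distrib
    by (simp only: pderiv_sum pderiv_smult pderiv_mult pderiv_add dA dB poly_sum poly_smult poly_mult poly_add poly_power AB)
       (intro sum.cong refl, simp add: field_simps numeral_2_eq_2)
  define al where "al s = real s * (real s + a)" for s
  define ga where "ga s = real (n - s) * (real (n - s) + b)" for s
  define be where "be s = 2 * real s * real (n - s) + (b + 1) * real s + (a + 1) * real (n - s)" for s
  have tri: "A * B * T2 s + ((b + 1) * A + (a + 1) * B) * T1 s
     = (if s = 0 then 0 else al s * E (s - 1)) + be s * E s + (if s = n then 0 else ga s * E (Suc s))" if "s \<le> n" for s
  proof -
    have "s \<le> n" by (rule that)
    then obtain k where n: "n = s + k" using le_Suc_ex by blast
    \<comment> \<open>The truncated exponents s - 1, s - 2 and their analogues for n - s are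
      resolved by separating 0, 1 and larger values.\<close>
    have s: "s = 0 \<or> s = Suc 0 \<or> (\<exists>i. s = Suc (Suc i))" and k: "k = 0 \<or> k = Suc 0 \<or> (\<exists>i. k = Suc (Suc i))"
      by presburger+
    show ?thesis
      unfolding T2_def T1_def al_def be_def ga_def E_def n using s k
      by (elim disjE exE; simp add: algebra_simps power2_eq_square power_add power3_eq_cube)
  qed
  have "(\<Sum>s\<le>n. c s * (A * B * T2 s + ((b + 1) * A + (a + 1) * B) * T1 s))
    = (\<Sum>s\<le>n. c s * (if s = 0 then 0 else al s * E (s - 1))) + (\<Sum>s\<le>n. c s * be s * E s)
      + (\<Sum>s\<le>n. c s * (if s = n then 0 else ga s * E (Suc s)))"
    unfolding sum.distrib[symmetric]
  proof (intro sum.cong refl)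
    fix s assume "s \<in> {..n}"
    then have s: "s \<le> n" by simp
    show "c s * (A * B * T2 s + ((b + 1) * A + (a + 1) * B) * T1 s) = c s * (if s = 0 then 0 else al s * E (s - 1))
      + c s * be s * E s + c s * (if s = n then 0 else ga s * E (Suc s))"
      unfolding tri[OF s] by (simp only: distrib_left mult.assoc)
  qed
  also have "(\<Sum>s\<le>n. c s * (if s = 0 then 0 else al s * E (s - 1))) = (\<Sum>s\<le>n. c s * ga s * E s)"
  proof -
    have "(\<Sum>s\<le>n. c s * (if s = 0 then 0 else al s * E (s - 1))) = (\<Sum>s<n. c (Suc s) * al (Suc s) * E s)"
      by (subst sum.atMost_shift) (simp add: mult.assoc)
    also have "\<dots> = (\<Sum>s<n. c s * ga s * E s)"
      by (intro sum.cong refl) (simp only: c_def al_def ga_def jacobi_coeff_rec lessThan_iff)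
    also have "\<dots> = (\<Sum>s\<le>n. c s * ga s * E s)"
      by (simp add: lessThan_Suc_atMost[symmetric] ga_def)
    finally show ?thesis .
  qed
  also have "(\<Sum>s\<le>n. c s * (if s = n then 0 else ga s * E (Suc s))) = (\<Sum>s\<le>n. c s * al s * E s)"
  proof -
    have "(\<Sum>s\<le>n. c s * (if s = n then 0 else ga s * E (Suc s))) = (\<Sum>s<n. c s * ga s * E (Suc s))"
      by (simp add: lessThan_Suc_atMost[symmetric] mult.assoc)
    also have "\<dots> = (\<Sum>s<n. c (Suc s) * al (Suc s) * E (Suc s))"
      by (intro sum.cong refl) (simp only: c_def al_def ga_def jacobi_coeff_rec lessThan_iff)
    also have "\<dots> = (\<Sum>s\<le>n. c s * al s * E s)"
    proof -
      have "al 0 = 0" by (simp add: al_def)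
      then show ?thesis unfolding sum.atMost_shift[of "\<lambda>s. c s * al s * E s"] by simp
    qed
    finally show ?thesis .
  qed
  finally have "(\<Sum>s\<le>n. c s * (A * B * T2 s + ((b + 1) * A + (a + 1) * B) * T1 s))
    = (\<Sum>s\<le>n. c s * (ga s + be s + al s) * E s)"
    by (simp add: sum.distrib[symmetric] algebra_simps)
  also have "\<dots> = (\<Sum>s\<le>n. real n * (real n + a + b + 1) * (c s * E s))"
  proof (intro sum.cong refl)
    fix s assume "s \<in> {..n}"
    then have "real (n - s) = real n - real s" by simp
    then have "ga s + be s + al s = real n * (real n + a + b + 1)"
      unfolding ga_def be_def al_def by (simp add: algebra_simps)
    then show "c s * (ga s + be s + al s) * E s = real n * (real n + a + b + 1) * (c s * E s)" by simp
  qed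
  also have "\<dots> = real n * (real n + a + b + 1) * poly p t" unfolding p0 by (simp add: sum_distrib_left)
  finally have main: "A * B * (\<Sum>s\<le>n. c s * T2 s) + ((b + 1) * A + (a + 1) * B) * (\<Sum>s\<le>n. c s * T1 s)
    = real n * (real n + a + b + 1) * poly p t"
    by (simp add: sum_distrib_left sum.distrib[symmetric] algebra_simps)
  have "1 - t\<^sup>2 = - (4 * A * B)" "b - a - (a + b + 2) * t = - 2 * ((b + 1) * A + (a + 1) * B)"
    by (simp_all add: A_def B_def field_simps power2_eq_square)
  then have "(1 - t\<^sup>2) * ((\<Sum>s\<le>n. c s * T2 s) / 4) + (b - a - (a + b + 2) * t) * ((\<Sum>s\<le>n. c s * T1 s) / 2)
    = - (A * B * (\<Sum>s\<le>n. c s * T2 s) + ((b + 1) * A + (a + 1) * B) * (\<Sum>s\<le>n. c s * T1 s))"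
    by (simp only:) (simp add: field_simps)
  then show ?thesis unfolding p1 p2 main by simp
qed

text \<open>Eliminate the top coefficient, which is possible by \<open>coeff_jpoly_pos\<close>, and
  lower the degree.\<close>

lemma span_jpoly:
  assumes "-1 < a" "-1 < b" "degree Q \<le> N"
  shows "\<exists>r. Q = (\<Sum>m\<le>N. smult (r m) (jpoly a b m))"
  using assms(3)
proof (induction N arbitrary: Q)
  case 0
  define r where "r = coeff Q 0 / coeff (jpoly a b 0) 0"
  have "Q = [:coeff Q 0:]" "jpoly a b 0 = [:coeff (jpoly a b 0) 0:]"
    using 0 degree_jpoly[of a b 0] by (auto intro: degree_eq_zeroE)
  then have "Q = smult r (jpoly a b 0)"
    using coeff_jpoly_pos[OF assms(1,2), of 0]
    by (metis less_irrefl mult.commute nonzero_mult_div_cancel_left r_def smult_pCons smult_0_right times_divide_eq_right)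
  then show ?case by (intro exI[of _ "\<lambda>_. r"]) simp
next
  case (Suc N)
  define r where "r = coeff Q (Suc N) / coeff (jpoly a b (Suc N)) (Suc N)"
  define Q' where "Q' = Q - smult r (jpoly a b (Suc N))"
  have "degree Q' \<le> Suc N" unfolding Q'_def
    by (intro degree_diff_le Suc.prems order_trans[OF degree_smult_le degree_jpoly])
  moreover have "coeff Q' (Suc N) = 0"
    using coeff_jpoly_pos[OF assms(1,2), of "Suc N"] by (simp add: Q'_def r_def)
  ultimately have "degree Q' \<le> N"
    by (metis coeff_0 le_SucE leading_coeff_0_iff order_refl zero_le degree_0)
  from Suc.IH[OF this] obtain r' where r': "Q' = (\<Sum>m\<le>N. smult (r' m) (jpoly a b m))" by blast
  have "Q = (\<Sum>m\<le>Suc N. smult ((r'(Suc N := r)) m) (jpoly a b m))"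
  proof -
    have "(\<Sum>m\<le>N. smult ((r'(Suc N := r)) m) (jpoly a b m)) = Q'"
      unfolding r' by (intro sum.cong) auto
    then show ?thesis by (simp add: Q'_def)
  qed
  then show ?case by blast
qed

lemma poly_antiderivative:
  fixes p :: "real poly"
  shows "\<exists>Q. pderiv Q = p \<and> degree Q \<le> Suc (degree p)"
proof -
  define Q where "Q = (\<Sum>i\<le>degree p. monom (coeff p i / real (Suc i)) (Suc i))"
  have "pderiv Q = (\<Sum>i\<le>degree p. monom (coeff p i) i)"
    unfolding Q_def pderiv_sum by (simp add: pderiv_monom del: of_nat_Suc)
  also have "\<dots> = p" by (simp add: poly_as_sum_of_monoms)
  finally have "pderiv Q = p" .
  moreover have "degree Q \<le> Suc (degree p)"
    unfolding Q_def by (intro degree_sum_le) (auto intro: order_trans[OF degree_monom_le])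
  ultimately show ?thesis by blast
qed

text \<open>For the derivatives, t times the derivative of \<open>jpoly a b n\<close> has degree at
  most n and thus an antiderivative of degree at most n + 1; expand the antiderivative in Jacobi
  polynomials and differentiate.\<close>

lemma cos_mult_jpoly:
  assumes "-1 < a" "-1 < b"
  shows "\<exists>r. \<forall>t. t * poly (jpoly a b n) t = (\<Sum>m\<le>Suc n. r m * poly (jpoly a b m) t)"
    "\<exists>r. \<forall>t. t * poly (pderiv (jpoly a b n)) t = (\<Sum>m\<le>Suc n. r m * poly (pderiv (jpoly a b m)) t)"
proof -
  have "degree ([:0, 1:] * jpoly a b n) \<le> Suc n"
    using degree_jpoly[of a b n] degree_mult_le[of "[:0, 1:]" "jpoly a b n"] by simp
  from span_jpoly[OF assms this] obtain r where r: "[:0, 1:] * jpoly a b n = (\<Sum>m\<le>Suc n. smult (r m) (jpoly a b m))" by blast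
  have "t * poly (jpoly a b n) t = (\<Sum>m\<le>Suc n. r m * poly (jpoly a b m) t)" for t
    using arg_cong[OF r, of "\<lambda>p. poly p t"] by (simp add: poly_sum)
  then show "\<exists>r. \<forall>t. t * poly (jpoly a b n) t = (\<Sum>m\<le>Suc n. r m * poly (jpoly a b m) t)" by blast
  define D where "D = [:0, 1:] * pderiv (jpoly a b n)"
  have D: "degree D \<le> n"
  proof (cases "degree (jpoly a b n) = 0")
    case True
    then have "pderiv (jpoly a b n) = 0" by (simp add: pderiv_eq_0_iff)
    then show ?thesis by (simp add: D_def)
  next
    case False
    have "degree D \<le> 1 + degree (pderiv (jpoly a b n))" unfolding D_def
      by (rule order_trans[OF degree_mult_le]) simp
    then show ?thesis using False degree_jpoly[of a b n] by (simp add: degree_pderiv)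
  qed
  obtain Q where Q: "pderiv Q = D" "degree Q \<le> Suc (degree D)" using poly_antiderivative by blast
  have "degree Q \<le> Suc n" using Q(2) D by simp
  from span_jpoly[OF assms this] obtain s where s: "Q = (\<Sum>m\<le>Suc n. smult (s m) (jpoly a b m))" by blast
  have Deq: "D = (\<Sum>m\<le>Suc n. smult (s m) (pderiv (jpoly a b m)))"
    unfolding Q(1)[symmetric] s by (simp only: pderiv_sum pderiv_smult)
  have "t * poly (pderiv (jpoly a b n)) t = (\<Sum>m\<le>Suc n. s m * poly (pderiv (jpoly a b m)) t)" for t
  proof -
    have "t * poly (pderiv (jpoly a b n)) t = poly D t" by (simp add: D_def)
    then show ?thesis unfolding Deq by (simp only: poly_sum poly_smult)
  qed
  then show "\<exists>r. \<forall>t. t * poly (pderiv (jpoly a b n)) t = (\<Sum>m\<le>Suc n. r m * poly (pderiv (jpoly a b m)) t)" by blast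
qed

section \<open>The one-dimensional Jacobi functions form a ladder system\<close>

definition jweight :: "real \<Rightarrow> real \<Rightarrow> real \<Rightarrow> real" where
  "jweight a b x = sin (x / 2) powr (a + 1/2) * cos (x / 2) powr (b + 1/2)"

text \<open>The operator d/dx + q annihilates \<open>jweight\<close>, so that only the derivative of
  the polynomial factor survives.\<close>

definition jdelta :: "real \<Rightarrow> real \<Rightarrow> nat \<Rightarrow> real \<Rightarrow> real" where
  "jdelta a b n x = jacobi_const a b n * (- sin x * poly (pderiv (jpoly a b n)) (cos x)) * jweight a b x"

definition jq :: "real \<Rightarrow> real \<Rightarrow> real \<Rightarrow> real" where
  "jq a b x = - ((2 * a + 1) / 4 * cot (x / 2)) + (2 * b + 1) / 4 * tan (x / 2)"

definition jq' :: "real \<Rightarrow> real \<Rightarrow> real \<Rightarrow> real" where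
  "jq' a b x = (2 * a + 1) / 8 / (sin (x / 2))\<^sup>2 + (2 * b + 1) / 8 / (cos (x / 2))\<^sup>2"

lemma jacobi_fun1_eq:
  "jacobi_fun1 a b n x = jacobi_const a b n * poly (jpoly a b n) (cos x) * jweight a b x"
  by (simp add: jacobi_fun1_def jacobi_unnormalized_def jweight_def poly_jpoly)

lemma half_angle_pos:
  assumes "0 < x" "x < pi"
  shows "0 < sin (x / 2)" "0 < cos (x / 2)"
  using assms by (auto intro: sin_gt_zero cos_gt_zero)

lemma sin_half: "sin x = 2 * sin (x / 2) * cos (x / 2)" and cos_half1: "1 + cos x = 2 * (cos (x / 2))\<^sup>2"
  and cos_half2: "1 - cos x = 2 * (sin (x / 2))\<^sup>2" for x :: real
  using sin_double[of "x / 2"] cos_double_cos[of "x / 2"] cos_double_sin[of "x / 2"] by simp_all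

context
  fixes a b :: real
  assumes a: "1/2 \<le> a" and b: "1/2 \<le> b"
begin

lemma jq_sin:
  assumes "0 < x" "x < pi"
  shows "2 * jq a b x * sin x = (b - a) - (a + b + 1) * cos x"
proof -
  note h = half_angle_pos[OF assms]
  have "2 * jq a b x * sin x = - ((2 * a + 1) / 2 * (2 * (cos (x / 2))\<^sup>2)) + (2 * b + 1) / 2 * (2 * (sin (x / 2))\<^sup>2)"
    unfolding jq_def sin_half[of x] cot_def tan_def using h by (simp add: field_simps power2_eq_square)
  also have "\<dots> = (b - a) - (a + b + 1) * cos x"
    unfolding cos_half1[symmetric] cos_half2[symmetric] by (simp add: field_simps)
  finally show ?thesis .
qed

lemma deriv_jweight:
  assumes "0 < x" "x < pi"
  shows "(jweight a b has_real_derivative - (jq a b x * jweight a b x)) (at x)"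
proof -
  note h = half_angle_pos[OF assms]
  have s: "((\<lambda>x. sin (x / 2)) has_real_derivative cos (x / 2) / 2) (at x)"
    and c: "((\<lambda>x. cos (x / 2)) has_real_derivative - sin (x / 2) / 2) (at x)"
    by (auto intro!: derivative_eq_intros)
  have p: "sin (x / 2) powr (a + 1/2 - 1) = sin (x / 2) powr (a + 1/2) / sin (x / 2)"
    "cos (x / 2) powr (b + 1/2 - 1) = cos (x / 2) powr (b + 1/2) / cos (x / 2)"
    using h powr_diff[of "sin (x / 2)" "a + 1/2" 1] powr_diff[of "cos (x / 2)" "b + 1/2" 1] by auto
  show ?thesis
    unfolding jweight_def[abs_def]
    by (rule DERIV_cong[OF DERIV_mult[OF has_real_derivative_powr_chain[OF s h(1)] has_real_derivative_powr_chain[OF c h(2)]]])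
       (unfold p jq_def cot_def tan_def, use h in \<open>simp add: field_simps\<close>)
qed

lemma deriv_poly_cos:
  "((\<lambda>x. poly p (cos x)) has_real_derivative - sin x * poly (pderiv p) (cos x)) (at x)"
  by (rule DERIV_cong[OF DERIV_chain2[OF poly_DERIV DERIV_cos]]) simp

lemma deriv_jacobi_fun1:
  assumes "0 < x" "x < pi"
  shows "(jacobi_fun1 a b n has_real_derivative jdelta a b n x - jq a b x * jacobi_fun1 a b n x) (at x)"
  unfolding jacobi_fun1_eq[abs_def] jdelta_def
  by (rule DERIV_cong[OF DERIV_mult[OF DERIV_cmult[OF deriv_poly_cos] deriv_jweight[OF assms]]])
     (simp add: algebra_simps)

text \<open>This is the Jacobi differential equation at t = cos x, whose first-order coefficient is
  2 q sin x - cos x by \<open>jq_sin\<close>.\<close>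

lemma deriv_jdelta:
  assumes "0 < x" "x < pi"
  shows "(jdelta a b n has_real_derivative jq a b x * jdelta a b n x - (real n * (real n + a + b + 1)) * jacobi_fun1 a b n x) (at x)"
proof -
  let ?p = "jpoly a b n"
  have "((\<lambda>x. - sin x * poly (pderiv ?p) (cos x)) has_real_derivative
      - cos x * poly (pderiv ?p) (cos x) + (sin x)\<^sup>2 * poly (pderiv (pderiv ?p)) (cos x)) (at x)"
    by (rule DERIV_cong[OF DERIV_mult[OF DERIV_minus[OF DERIV_sin] deriv_poly_cos]]) (simp add: power2_eq_square)
  note * = DERIV_mult[OF DERIV_cmult[OF this] deriv_jweight[OF assms]]
  have ode: "(sin x)\<^sup>2 * poly (pderiv (pderiv ?p)) (cos x)
     = - ((2 * jq a b x * sin x - cos x) * poly (pderiv ?p) (cos x)) - real n * (real n + a + b + 1) * poly ?p (cos x)"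
    using jacobi_ode[of "cos x" a b n] unfolding jq_sin[OF assms] by (simp add: sin_squared_eq algebra_simps)
  show ?thesis
    unfolding jdelta_def[abs_def] jacobi_fun1_eq
    by (rule DERIV_cong[OF *]) (unfold ode, simp add: algebra_simps)
qed

lemma deriv_jq:
  assumes "0 < x" "x < pi"
  shows "(jq a b has_real_derivative jq' a b x) (at x)"
proof -
  note h = half_angle_pos[OF assms]
  have half: "((\<lambda>x. x / 2) has_real_derivative 1 / 2) (at x)" by (auto intro!: derivative_eq_intros)
  have "sin (x / 2) \<noteq> 0" "cos (x / 2) \<noteq> 0" using h by auto
  note d = DERIV_chain2[OF DERIV_cot[OF this(1)] half] DERIV_chain2[OF DERIV_tan[OF this(2)] half]
  show ?thesis
    unfolding jq_def[abs_def] jq'_def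
    by (rule DERIV_cong[OF DERIV_add[OF DERIV_minus[OF DERIV_cmult[OF d(1)]] DERIV_cmult[OF d(2)]]])
       (simp only: divide_inverse, simp)
qed

lemma jq'_nonneg: "0 \<le> jq' a b x"
  unfolding jq'_def using a b by simp

text \<open>The expression is the potential of L in one variable, (4 a^2 - 1)/(16 sin^2(x/2)) + (4
  b^2 - 1)/(16 cos^2(x/2)), and a, b \<ge> 1/2 makes both terms nonnegative.\<close>

lemma jV_nonneg:
  assumes "0 < x" "x < pi"
  shows "0 \<le> (jq a b x)\<^sup>2 - jq' a b x + ((a + b + 1) / 2)\<^sup>2"
proof -
  note h = half_angle_pos[OF assms]
  define S where "S = 1 / (sin (x / 2))\<^sup>2"
  define C where "C = 1 / (cos (x / 2))\<^sup>2"
  have sc: "(sin (x / 2))\<^sup>2 + (cos (x / 2))\<^sup>2 = 1" by simp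
  have cot: "(cot (x / 2))\<^sup>2 = S - 1" unfolding S_def cot_def using h sc by (simp add: field_simps)
  have tan: "(tan (x / 2))\<^sup>2 = C - 1" unfolding C_def tan_def using h sc by (simp add: field_simps)
  have ct: "cot (x / 2) * tan (x / 2) = 1" using h by (simp add: cot_def tan_def)
  have q': "jq' a b x = (2 * a + 1) / 8 * S + (2 * b + 1) / 8 * C" by (simp add: jq'_def S_def C_def)
  have q2: "(jq a b x)\<^sup>2 = ((2 * a + 1) / 4)\<^sup>2 * (cot (x / 2))\<^sup>2 - 2 * ((2 * a + 1) / 4) * ((2 * b + 1) / 4) * (cot (x / 2) * tan (x / 2))
      + ((2 * b + 1) / 4)\<^sup>2 * (tan (x / 2))\<^sup>2"
    unfolding jq_def power2_eq_square by (simp add: field_simps)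
  have "(jq a b x)\<^sup>2 - jq' a b x + ((a + b + 1) / 2)\<^sup>2 = (2 * a - 1) * (2 * a + 1) / 16 * S + (2 * b - 1) * (2 * b + 1) / 16 * C"
    unfolding q2 q' cot tan ct by (simp add: power2_eq_square field_simps)
  moreover have "0 \<le> S" "0 \<le> C" by (auto simp: S_def C_def)
  ultimately show ?thesis using a b by simp
qed

lemma continuous_jweight: "continuous_on {0..pi} (jweight a b)"
proof -
  have "0 \<le> sin (x / 2)" "0 \<le> cos (x / 2)" if "x \<in> {0..pi}" for x
    using that by (auto intro: sin_ge_zero cos_ge_zero)
  then show ?thesis
    unfolding jweight_def[abs_def] using a b by (intro continuous_intros continuous_on_powr') auto
qed

text \<open>Both exponents are at least 1, so the weight is at most sin(x/2) cos(x/2) = (sin x)/2.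
  This is the source of the boundary decay required of a ladder system.\<close>

lemma jweight_bound:
  assumes "x \<in> {0..pi}"
  shows "0 \<le> jweight a b x" "jweight a b x \<le> sin x"
proof -
  have h: "0 \<le> sin (x / 2)" "0 \<le> cos (x / 2)" using assms by (auto intro: sin_ge_zero cos_ge_zero)
  have le: "t powr r \<le> t" if "0 \<le> t" "t \<le> 1" "1 \<le> r" for t r :: real
    using powr_mono'[of 1 r t] that by (cases "t = 0") auto
  show "0 \<le> jweight a b x" by (simp add: jweight_def)
  have "jweight a b x \<le> sin (x / 2) * cos (x / 2)"
    unfolding jweight_def using h a b by (intro mult_mono le) auto
  also have "\<dots> \<le> sin x" using h unfolding sin_half[of x] by simp
  finally show "jweight a b x \<le> sin x" .
qed

lemma continuous_jacobi_fun1: "continuous_on {0..pi} (jacobi_fun1 a b n)"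
  and continuous_jdelta: "continuous_on {0..pi} (jdelta a b n)"
  unfolding jacobi_fun1_eq[abs_def] jdelta_def[abs_def]
  by (intro continuous_intros continuous_jweight)+

lemma bound_weighted:
  assumes "continuous_on {0..pi} g" "\<And>x. f x = g x * jweight a b x"
  shows "\<exists>C. \<forall>x\<in>{0..pi}. \<bar>f x\<bar> \<le> C * sin x"
proof -
  obtain C where C: "0 < C" "\<And>x. x \<in> {0..pi} \<Longrightarrow> \<bar>g x\<bar> \<le> C"
    using compact_imp_bounded[OF compact_continuous_image[OF assms(1) compact_Icc]] by (force simp: bounded_pos)
  have "\<bar>f x\<bar> \<le> C * sin x" if "x \<in> {0..pi}" for x
    unfolding assms(2) abs_mult using C jweight_bound[OF that] that by (intro mult_mono) auto
  then show ?thesis by blast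
qed

lemma bound_jacobi_fun1: "\<exists>C. \<forall>x\<in>{0..pi}. \<bar>jacobi_fun1 a b n x\<bar> \<le> C * sin x"
  by (rule bound_weighted[where g = "\<lambda>x. jacobi_const a b n * poly (jpoly a b n) (cos x)"])
     (auto intro!: continuous_intros simp: jacobi_fun1_eq)

lemma bound_jdelta: "\<exists>C. \<forall>x\<in>{0..pi}. \<bar>jdelta a b n x\<bar> \<le> C * sin x"
  by (rule bound_weighted[where g = "\<lambda>x. jacobi_const a b n * (- sin x * poly (pderiv (jpoly a b n)) (cos x))"])
     (auto intro!: continuous_intros simp: jdelta_def)

lemma bound_jq: "\<exists>C. \<forall>x\<in>{0<..<pi}. \<bar>jq a b x\<bar> * sin x \<le> C"
proof -
  have "\<bar>jq a b x\<bar> * sin x \<le> (\<bar>b - a\<bar> + \<bar>a + b + 1\<bar>) / 2" if "x \<in> {0<..<pi}" for x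
  proof -
    have "\<bar>jq a b x\<bar> * sin x = \<bar>jq a b x * sin x\<bar>" using that by (simp add: abs_mult sin_ge_zero)
    also have "jq a b x * sin x = ((b - a) - (a + b + 1) * cos x) / 2" using jq_sin[of x] that by simp
    also have "\<bar>\<dots>\<bar> \<le> (\<bar>b - a\<bar> + \<bar>(a + b + 1) * cos x\<bar>) / 2" by simp
    also have "\<bar>(a + b + 1) * cos x\<bar> \<le> \<bar>a + b + 1\<bar>" unfolding abs_mult by (intro mult_left_le) auto
    finally show ?thesis by simp
  qed
  then show ?thesis by blast
qed

lemma bound_jq': "\<exists>C. \<forall>x\<in>{0<..<pi}. \<bar>jq' a b x\<bar> * (sin x)\<^sup>2 \<le> C"
proof -
  have "\<bar>jq' a b x\<bar> * (sin x)\<^sup>2 \<le> (2 * a + 1) / 2 + (2 * b + 1) / 2" if x: "x \<in> {0<..<pi}" for x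
  proof -
    have h: "0 < sin (x / 2)" "0 < cos (x / 2)" using half_angle_pos[of x] x by auto
    have "\<bar>jq' a b x\<bar> * (sin x)\<^sup>2 = (2 * a + 1) / 2 * (cos (x / 2))\<^sup>2 + (2 * b + 1) / 2 * (sin (x / 2))\<^sup>2"
      unfolding abs_of_nonneg[OF jq'_nonneg] unfolding jq'_def sin_half[of x] using h by (simp add: field_simps power2_eq_square)
    also have "\<dots> \<le> (2 * a + 1) / 2 + (2 * b + 1) / 2"
      using a b by (intro add_mono mult_left_le) (auto simp: abs_square_le_1)
    finally show ?thesis .
  qed
  then show ?thesis by blast
qed

text \<open>A nonzero polynomial has finitely many roots and cos is injective on (0, pi), so the
  integrand vanishes at finitely many points only and the normalizing integral is positive.\<close>

lemma jacobi_normalized: "0 < jacobi_const a b n" "(\<integral>x. (jacobi_fun1 a b n x)\<^sup>2 \<partial>lebesgue_on {0<..<pi}) = 1"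
proof -
  let ?u = "jacobi_unnormalized a b n"
  let ?M = "lebesgue_on {0<..<pi}"
  have u: "?u x = poly (jpoly a b n) (cos x) * jweight a b x" for x
    by (simp add: jacobi_unnormalized_def jweight_def poly_jpoly)
  have "continuous_on {0..pi} (\<lambda>x. (?u x)\<^sup>2)" unfolding u by (intro continuous_intros continuous_jweight)
  then have "set_integrable lborel {0..pi} (\<lambda>x. (?u x)\<^sup>2)"
    by (rule borel_integrable_atLeastAtMost')
  then have "set_integrable lebesgue {0..pi} (\<lambda>x. (?u x)\<^sup>2)"
    unfolding set_integrable_def by (subst integrable_completion) (auto dest: borel_measurable_integrable)
  then have "set_integrable lebesgue {0<..<pi} (\<lambda>x. (?u x)\<^sup>2)"
    by (rule set_integrable_subset) auto
  then have int: "integrable ?M (\<lambda>x. (?u x)\<^sup>2)"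
    by (simp add: integrable_restrict_space set_integrable_def)
  have "(\<integral>x. (?u x)\<^sup>2 \<partial>?M) \<noteq> 0"
  proof
    assume "(\<integral>x. (?u x)\<^sup>2 \<partial>?M) = 0"
    then have ae: "AE x in ?M. (?u x)\<^sup>2 = 0" using int by (simp add: integral_nonneg_eq_0_iff_AE)
    define Z where "Z = {x \<in> {0<..<pi}. poly (jpoly a b n) (cos x) = 0}"
    have "finite {t. poly (jpoly a b n) t = 0}" using jpoly_nonzero[of a b n] a b by (intro poly_roots_finite) auto
    then have "finite (cos ` Z)" by (rule finite_subset[rotated]) (auto simp: Z_def)
    moreover have "inj_on cos Z" by (rule inj_onI, rule cos_inj_pi) (auto simp: Z_def)
    ultimately have "finite Z" by (rule finite_imageD)
    have nz: "(?u x)\<^sup>2 \<noteq> 0" if "x \<in> {0<..<pi}" "x \<notin> Z" for x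
      using that half_angle_pos[of x] by (auto simp: u Z_def jweight_def)
    have "AE x in lebesgue. x \<notin> Z" using negligible_finite[OF \<open>finite Z\<close>] by (simp add: negligible_iff_null_sets AE_not_in)
    then have "AE x in ?M. x \<notin> Z" by (auto simp: AE_restrict_space_iff elim: eventually_mono)
    with ae AE_space have "AE x in ?M. False"
      by eventually_elim (use nz in auto)
    then have "emeasure ?M {0<..<pi} = 0"
      by (subst (asm) AE_iff_measurable[of "{0<..<pi}"]) auto
    then show False by (simp add: emeasure_restrict_space)
  qed
  moreover have "0 \<le> (\<integral>x. (?u x)\<^sup>2 \<partial>?M)" by simp
  ultimately have pos: "0 < (\<integral>x. (?u x)\<^sup>2 \<partial>?M)" by linarith
  then show "0 < jacobi_const a b n" by (simp add: jacobi_const_def)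
  have "(\<integral>x. (jacobi_fun1 a b n x)\<^sup>2 \<partial>?M) = (jacobi_const a b n)\<^sup>2 * (\<integral>x. (?u x)\<^sup>2 \<partial>?M)"
    unfolding jacobi_fun1_def power_mult_distrib by simp
  then show "(\<integral>x. (jacobi_fun1 a b n x)\<^sup>2 \<partial>?M) = 1"
    using pos by (simp add: jacobi_const_def power_divide)
qed

lemma cos_mult_jacobi:
  "\<exists>N r. \<forall>x\<in>{0..pi}. cos x * jacobi_fun1 a b n x = (\<Sum>m\<le>N. r m * jacobi_fun1 a b m x)"
  "\<exists>N r. \<forall>x\<in>{0..pi}. cos x * jdelta a b n x = (\<Sum>m\<le>N. r m * jdelta a b m x)"
proof -
  have c: "jacobi_const a b m \<noteq> 0" for m using jacobi_normalized(1)[of m] by simp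
  have ab: "-1 < a" "-1 < b" using a b by auto
  obtain r where r: "\<And>t. t * poly (jpoly a b n) t = (\<Sum>m\<le>Suc n. r m * poly (jpoly a b m) t)"
    using cos_mult_jpoly(1)[OF ab] by blast
  have "cos x * jacobi_fun1 a b n x = (\<Sum>m\<le>Suc n. (jacobi_const a b n * r m / jacobi_const a b m) * jacobi_fun1 a b m x)" for x
  proof -
    have "cos x * jacobi_fun1 a b n x = jacobi_const a b n * (cos x * poly (jpoly a b n) (cos x)) * jweight a b x"
      by (simp add: jacobi_fun1_eq)
    then show ?thesis unfolding r sum_distrib_left sum_distrib_right
      by (simp only:) (intro sum.cong refl, simp add: jacobi_fun1_eq c)
  qed
  then show "\<exists>N r. \<forall>x\<in>{0..pi}. cos x * jacobi_fun1 a b n x = (\<Sum>m\<le>N. r m * jacobi_fun1 a b m x)" by (intro exI ballI)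
  obtain s where s: "\<And>t. t * poly (pderiv (jpoly a b n)) t = (\<Sum>m\<le>Suc n. s m * poly (pderiv (jpoly a b m)) t)"
    using cos_mult_jpoly(2)[OF ab] by blast
  have "cos x * jdelta a b n x = (\<Sum>m\<le>Suc n. (jacobi_const a b n * s m / jacobi_const a b m) * jdelta a b m x)" for x
  proof -
    have "cos x * jdelta a b n x = jacobi_const a b n * (- sin x) * (cos x * poly (pderiv (jpoly a b n)) (cos x)) * jweight a b x"
      by (simp add: jdelta_def)
    then show ?thesis unfolding s sum_distrib_left sum_distrib_right
      by (simp only:) (intro sum.cong refl, simp add: jdelta_def c)
  qed
  then show "\<exists>N r. \<forall>x\<in>{0..pi}. cos x * jdelta a b n x = (\<Sum>m\<le>N. r m * jdelta a b m x)" by (intro exI ballI)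
qed

text \<open>The polynomial of degree 0 is constant, and the derivative of the polynomial of degree 1
  is a nonzero constant; weight and sine have no zeros in (0, pi).\<close>

lemma jacobi_base_nonzero:
  assumes "0 < x" "x < pi"
  shows "jacobi_fun1 a b 0 x \<noteq> 0" "jdelta a b 1 x \<noteq> 0"
proof -
  have ab: "-1 < a" "-1 < b" using a b by auto
  have w: "jweight a b x \<noteq> 0" using half_angle_pos[OF assms] by (simp add: jweight_def)
  have c: "jacobi_const a b m \<noteq> 0" for m using jacobi_normalized(1)[of m] by simp
  have "jacobi_poly a b 0 t = 1" for t by (simp add: jacobi_poly_def)
  then show "jacobi_fun1 a b 0 x \<noteq> 0" using w c by (simp add: jacobi_fun1_eq poly_jpoly)
  have "degree (pderiv (jpoly a b 1)) = 0" using degree_jpoly[of a b 1] by (simp add: degree_pderiv)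
  then obtain k where k: "pderiv (jpoly a b 1) = [:k:]" by (rule degree_eq_zeroE)
  have "coeff (pderiv (jpoly a b 1)) 0 = coeff (jpoly a b 1) 1" by (simp add: coeff_pderiv)
  then have "k \<noteq> 0" using coeff_jpoly_pos[OF ab, of 1] unfolding k by simp
  then show "jdelta a b 1 x \<noteq> 0" using w c sin_gt_zero[OF assms] by (simp add: jdelta_def k[unfolded One_nat_def])
qed

end

lemma integral_cube_prod:
  fixes g :: "'d::finite \<Rightarrow> real \<Rightarrow> real"
  assumes g: "\<And>i. continuous_on {0<..<pi} (g i)" and nn: "\<And>i x. 0 \<le> g i x"
    and one: "\<And>i. (\<integral>x. g i x \<partial>lebesgue_on {0<..<pi}) = 1"
  shows "(\<integral>x. (\<Prod>i\<in>UNIV. g i (x $ i)) \<partial>(cube_measure :: (real ^ 'd) measure)) = 1"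
proof -
  define h where "h i t = indicator {0<..<pi} t * g i t" for i t
  have hm [measurable]: "h i \<in> borel_measurable borel" for i
    using borel_measurable_continuous_on_indicator[OF _ g] unfolding h_def by simp
  have h0: "0 \<le> h i t" for i t by (simp add: h_def nn)
  have h1: "(\<integral>\<^sup>+t. ennreal (h i t) \<partial>lborel) = 1" for i
  proof -
    have "(\<integral>t. h i t \<partial>lborel) = 1"
      using one[of i] unfolding h_def[abs_def]
      by (subst (asm) integral_restrict_space) (use hm[of i, unfolded h_def[abs_def]] in \<open>auto simp: integral_completion\<close>)
    moreover from this have "integrable lborel (h i)" by (metis not_integrable_integral_eq zero_neq_one)
    ultimately show ?thesis using h0 by (simp add: nn_integral_eq_integral)
  qed
  have H: "(if x \<in> cube then \<Prod>i\<in>UNIV. g i (x $ i) else 0) = (\<Prod>i\<in>UNIV. h i (x $ i))" for x :: "real ^ 'd"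
  proof (cases "x \<in> cube")
    case True
    then show ?thesis by (auto simp: h_def cube_def intro!: prod.cong)
  next
    case False
    then obtain i where "\<not> (0 < x $ i \<and> x $ i < pi)" unfolding cube_def mem_Collect_eq by blast
    then have "h i (x $ i) = 0" by (auto simp: h_def)
    then have "(\<Prod>i\<in>UNIV. h i (x $ i)) = 0" by (intro prod_zero) auto
    with False show ?thesis by (simp only: if_False)
  qed
  have Hm: "(\<lambda>x :: real ^ 'd. \<Prod>i\<in>UNIV. h i (x $ i)) \<in> borel_measurable borel" by measurable
  \<comment> \<open>The product formula for \<open>lborel\<close> is indexed by
    \<open>Basis\<close>; \<open>ix\<close> recovers the coordinate from a basis vector.\<close>
  define ix :: "real ^ 'd \<Rightarrow> 'd" where "ix = inv (\<lambda>i. axis i 1)"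
  have inj: "inj (\<lambda>i. axis i 1 :: real ^ 'd)" by (auto simp: inj_on_def axis_eq_axis)
  have Basis: "Basis = range (\<lambda>i. axis i 1 :: real ^ 'd)" by (auto simp: Basis_vec_def)
  have "(\<integral>\<^sup>+x. ennreal (\<Prod>i\<in>UNIV. h i (x $ i)) \<partial>(lborel :: (real ^ 'd) measure))
    = (\<integral>\<^sup>+x. (\<Prod>b\<in>Basis. ennreal (h (ix b) (x \<bullet> b))) \<partial>(lborel :: (real ^ 'd) measure))"
    unfolding Basis using h0
    by (simp add: prod.reindex[OF inj] prod_ennreal inner_axis ix_def inv_f_f[OF inj] o_def)
  also have "\<dots> = (\<Prod>b\<in>(Basis :: (real ^ 'd) set). \<integral>\<^sup>+t. ennreal (h (ix b) t) \<partial>lborel)"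
    by (rule nn_integral_lborel_prod) auto
  also have "\<dots> = 1" by (simp add: h1)
  finally have "(\<integral>x. (\<Prod>i\<in>UNIV. h i (x $ i)) \<partial>(lborel :: (real ^ 'd) measure)) = 1"
    using h0 Hm by (subst integral_eq_nn_integral) (auto intro: prod_nonneg)
  then show ?thesis
    using integral_cube_lborel(2)[of "\<lambda>x. \<Prod>i\<in>UNIV. g i (x $ i)"] Hm unfolding H by simp
qed

section \<open>The Riesz transforms for Jacobi function expansions\<close>

lemma jacobi_ladder:
  fixes \<alpha> \<beta> :: "real ^ 'd"
  assumes \<alpha>: "\<And>i. 1/2 \<le> \<alpha> $ i" and \<beta>: "\<And>i. 1/2 \<le> \<beta> $ i"
  shows "normalized_ladder (\<lambda>i. jacobi_fun1 (\<alpha> $ i) (\<beta> $ i)) (\<lambda>i. jdelta (\<alpha> $ i) (\<beta> $ i))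
    (\<lambda>i. jq (\<alpha> $ i) (\<beta> $ i)) (\<lambda>i. jq' (\<alpha> $ i) (\<beta> $ i))
    (\<lambda>i n. real n * (real n + \<alpha> $ i + \<beta> $ i + 1)) (\<lambda>i. ((\<alpha> $ i + \<beta> $ i + 1) / 2)\<^sup>2)"
proof -
  have pos: "0 < \<alpha> $ i + \<beta> $ i" for i using \<alpha>[of i] \<beta>[of i] by linarith
  interpret ladder_system "\<lambda>i. jacobi_fun1 (\<alpha> $ i) (\<beta> $ i)" "\<lambda>i. jdelta (\<alpha> $ i) (\<beta> $ i)"
    "\<lambda>i. jq (\<alpha> $ i) (\<beta> $ i)" "\<lambda>i. jq' (\<alpha> $ i) (\<beta> $ i)"
    "\<lambda>i n. real n * (real n + \<alpha> $ i + \<beta> $ i + 1)" "\<lambda>i. ((\<alpha> $ i + \<beta> $ i + 1) / 2)\<^sup>2"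
  proof
    fix i
    show "inj (\<lambda>n. real n * (real n + \<alpha> $ i + \<beta> $ i + 1))"
    proof (rule strict_mono_imp_inj_on, rule strict_monoI)
      fix m n :: nat assume "m < n"
      then have "real m < real n" by simp
      then show "real m * (real m + \<alpha> $ i + \<beta> $ i + 1) < real n * (real n + \<alpha> $ i + \<beta> $ i + 1)"
        using pos[of i] by (intro mult_strict_mono) auto
    qed
    show "0 \<le> real n * (real n + \<alpha> $ i + \<beta> $ i + 1)" for n using pos[of i] by simp
    show "0 < ((\<alpha> $ i + \<beta> $ i + 1) / 2)\<^sup>2" using pos[of i] by simp
  qed (rule deriv_jacobi_fun1 deriv_jdelta deriv_jq jq'_nonneg jV_nonneg continuous_jacobi_fun1 continuous_jdelta
        bound_jacobi_fun1 bound_jdelta bound_jq bound_jq' \<alpha> \<beta>; (assumption | rule \<alpha> \<beta>)?)+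
  show ?thesis
  proof
    show "\<exists>N r. \<forall>x\<in>{0..pi}. cos x * f i st n x = (\<Sum>m\<le>N. r m * f i st m x)" for i st n
      using cos_mult_jacobi[OF \<alpha>[of i] \<beta>[of i], of n] by (cases st) (simp_all add: f_def)
    show "f i st (if st then 1 else 0) x \<noteq> 0" if "0 < x" "x < pi" for i st x
      using jacobi_base_nonzero[OF \<alpha>[of i] \<beta>[of i] that] by (cases st) (simp_all add: f_def)
    show "(\<integral>x. (\<Psi> {} k x)\<^sup>2 \<partial>cube_measure) = 1" for k
    proof -
      have "(\<Psi> {} k x)\<^sup>2 = (\<Prod>i\<in>UNIV. (jacobi_fun1 (\<alpha> $ i) (\<beta> $ i) (k $ i) (x $ i))\<^sup>2)" for x
        by (simp add: \<Psi>_def f_def prod_power_distrib)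
      moreover have "(\<integral>x. (\<Prod>i\<in>UNIV. (jacobi_fun1 (\<alpha> $ i) (\<beta> $ i) (k $ i) (x $ i))\<^sup>2) \<partial>cube_measure) = 1"
      proof (rule integral_cube_prod)
        show "continuous_on {0<..<pi} (\<lambda>t. (jacobi_fun1 (\<alpha> $ i) (\<beta> $ i) (k $ i) t)\<^sup>2)" for i
          by (intro continuous_intros continuous_on_subset[OF continuous_jacobi_fun1[OF \<alpha> \<beta>]]) auto
        show "(\<integral>t. (jacobi_fun1 (\<alpha> $ i) (\<beta> $ i) (k $ i) t)\<^sup>2 \<partial>lebesgue_on {0<..<pi}) = 1" for i
          by (rule jacobi_normalized(2)[OF \<alpha> \<beta>])
      qed simp
      ultimately show ?thesis by simp
    qed
  qed
qed

theorem theorem13: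
  fixes \<alpha> \<beta> :: "real ^ 'd" and p :: real
  assumes "\<And>i. 1/2 \<le> \<alpha> $ i" and "\<And>i. 1/2 \<le> \<beta> $ i" and "1 < p"
  shows "(\<exists>R. riesz_extension \<alpha> \<beta> p R) \<and>
         (\<forall>R. riesz_extension \<alpha> \<beta> p R \<longrightarrow>
            (\<forall>f \<in> Lp p. Lp_norm p (R f) \<le> 48 * (max p (p / (p - 1)) - 1) * Lp_norm p f))"
proof -
  interpret J: normalized_ladder "\<lambda>i. jacobi_fun1 (\<alpha> $ i) (\<beta> $ i)" "\<lambda>i. jdelta (\<alpha> $ i) (\<beta> $ i)"
    "\<lambda>i. jq (\<alpha> $ i) (\<beta> $ i)" "\<lambda>i. jq' (\<alpha> $ i) (\<beta> $ i)"
    "\<lambda>i n. real n * (real n + \<alpha> $ i + \<beta> $ i + 1)" "\<lambda>i. ((\<alpha> $ i + \<beta> $ i + 1) / 2)\<^sup>2"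
    by (rule jacobi_ladder[OF assms(1,2)])
  have fn: "jacobi_fun \<alpha> \<beta> k = J.\<Psi> {} k" for k
    by (simp add: jacobi_fun_def J.\<Psi>_def J.f_def fun_eq_iff)
  have span: "jacobi_span \<alpha> \<beta> = J.poly_span"
    unfolding jacobi_span_def J.poly_span_def J.lincomb_def[abs_def] fn ..
  have ev: "jacobi_eigenvalue \<alpha> \<beta> k = J.lam k" for k
    unfolding jacobi_eigenvalue_def J.lam_def by (intro sum.cong refl) (simp add: power2_eq_square field_simps)
  have evp: "jacobi_eigenvalue \<alpha> \<beta> k powr (- 1/2) = 1 / J.mu k" for k
    unfolding ev J.mu_def using J.lam_pos[of k] by (simp add: powr_minus powr_half_sqrt inverse_eq_divide)
  have delta: "jacobi_delta \<alpha> \<beta> i (jacobi_fun \<alpha> \<beta> k) x = J.\<Psi> {i} k x" if x: "x \<in> cube" for i k x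
  proof -
    have "partial_deriv i (J.\<Psi> {} k) x = J.\<Psi>' i {} k x"
      using DERIV_imp_deriv[OF J.deriv_\<Psi>[OF x]] unfolding partial_deriv_def upd_def .
    then show ?thesis
      unfolding jacobi_delta_def fn J.\<Psi>'_empty jq_def by (simp add: algebra_simps)
  qed
  have sums: "(\<Sum>k\<in>K. jacobi_eigenvalue \<alpha> \<beta> k powr (- 1/2) * L2_inner h (jacobi_fun \<alpha> \<beta> k) * jacobi_delta \<alpha> \<beta> i (jacobi_fun \<alpha> \<beta> k) x)
      = J.riesz h x $ i" if "finite K" "{k. J.coef h k \<noteq> 0} \<subseteq> K" "x \<in> cube" for K h i x
  proof -
    have "J.riesz h x $ i = (\<Sum>k\<in>K. J.coef h k / J.mu k * J.\<Psi> {i} k x)"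
      unfolding J.R_subset[OF that(1,2), symmetric] by (simp add: J.R_def)
    then show ?thesis unfolding evp delta[OF that(3)] unfolding fn J.coef_def[symmetric] by simp
  qed
  \<comment> \<open>For a function in the span only finitely many coefficients are nonzero, so the
    net of partial sums is eventually constant.\<close>
  have limit: "((\<lambda>K. Lp_norm 2 (\<lambda>x. G x - (\<Sum>k\<in>K. jacobi_eigenvalue \<alpha> \<beta> k powr (- 1/2) * L2_inner h (jacobi_fun \<alpha> \<beta> k)
        * jacobi_delta \<alpha> \<beta> i (jacobi_fun \<alpha> \<beta> k) x))) \<longlongrightarrow> Lp_norm 2 (\<lambda>x. G x - J.riesz h x $ i)) (finite_subsets_at_top UNIV)"
    if h: "h \<in> J.poly_span" for h i and G :: "real ^ 'd \<Rightarrow> real"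
  proof (rule tendsto_eventually)
    show "\<forall>\<^sub>F K in finite_subsets_at_top UNIV. Lp_norm 2 (\<lambda>x. G x - (\<Sum>k\<in>K. jacobi_eigenvalue \<alpha> \<beta> k powr (- 1/2)
        * L2_inner h (jacobi_fun \<alpha> \<beta> k) * jacobi_delta \<alpha> \<beta> i (jacobi_fun \<alpha> \<beta> k) x)) = Lp_norm 2 (\<lambda>x. G x - J.riesz h x $ i)"
      unfolding eventually_finite_subsets_at_top
    proof (intro exI[of _ "{k. J.coef h k \<noteq> 0}"] conjI allI impI J.finite_coef_support[OF h] subset_UNIV)
      fix K assume K: "finite K \<and> {k. J.coef h k \<noteq> 0} \<subseteq> K \<and> K \<subseteq> UNIV"
      show "Lp_norm 2 (\<lambda>x. G x - (\<Sum>k\<in>K. jacobi_eigenvalue \<alpha> \<beta> k powr (- 1/2)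
        * L2_inner h (jacobi_fun \<alpha> \<beta> k) * jacobi_delta \<alpha> \<beta> i (jacobi_fun \<alpha> \<beta> k) x)) = Lp_norm 2 (\<lambda>x. G x - J.riesz h x $ i)"
      proof (rule Lp_norm_cong)
        fix x :: "real ^ 'd" assume x: "x \<in> cube"
        from K have "finite K" "{k. J.coef h k \<noteq> 0} \<subseteq> K" by auto
        from sums[OF this x] show "norm (G x - (\<Sum>k\<in>K. jacobi_eigenvalue \<alpha> \<beta> k powr (- 1/2)
          * L2_inner h (jacobi_fun \<alpha> \<beta> k) * jacobi_delta \<alpha> \<beta> i (jacobi_fun \<alpha> \<beta> k) x)) = norm (G x - J.riesz h x $ i)"
          by (simp only:)
      qed
    qed
  qed
  have comp_Lp: "(\<lambda>x. J.riesz h x $ i) \<in> Lp 2" for h i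
  proof (rule Lp_I)
    have r: "J.riesz h \<in> Lp 2" by (rule J.riesz_Lp) simp
    have c: "continuous_on ccube (\<lambda>x. J.riesz h x $ i)" unfolding J.riesz_def by (intro continuous_intros J.continuous_R)
    show m: "(\<lambda>x. J.riesz h x $ i) \<in> borel_measurable cube_measure"
      by (rule borel_measurable_integrable[OF integral_ccube(1)[OF c]])
    show "integrable cube_measure (\<lambda>x. norm (J.riesz h x $ i) powr 2)"
      by (rule Bochner_Integration.integrable_bound[OF Lp_integrable[OF r]])
         (use m in \<open>auto intro!: AE_I2 simp: abs_le_square_iff[symmetric] component_le_norm_cart\<close>)
  qed
  have p0: "0 < p" using assms(3) by simp
  obtain T where T: "\<And>h. h \<in> Lp p \<Longrightarrow> T h \<in> Lp p" "\<And>h. h \<in> J.poly_span \<Longrightarrow> T h = J.riesz h"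
    "\<And>g h. g \<in> Lp p \<Longrightarrow> h \<in> Lp p \<Longrightarrow> Lp_norm p (\<lambda>x. T g x - T h x) \<le> J.riesz_const p * Lp_norm p (\<lambda>x. g x - h x)"
    using J.riesz_extension_exists[OF assms(3)] by blast
  have "riesz_extension \<alpha> \<beta> p T"
    unfolding riesz_extension_def
  proof (intro conjI ballI allI impI)
    show "T h \<in> Lp p" if "h \<in> Lp p" for h by (rule T(1)[OF that])
    fix F and h :: "real ^ 'd \<Rightarrow> real"
    assume h: "h \<in> Lp p" and F: "(\<forall>n::nat. F n \<in> Lp p) \<and> (\<lambda>n. Lp_norm p (\<lambda>x. F n x - h x)) \<longlonglongrightarrow> 0"
    show "(\<lambda>n. Lp_norm p (\<lambda>x. T (F n) x - T h x)) \<longlonglongrightarrow> 0"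
    proof (rule tendsto_sandwich[OF _ _ tendsto_const])
      show "(\<lambda>n. J.riesz_const p * Lp_norm p (\<lambda>x. F n x - h x)) \<longlonglongrightarrow> 0"
        using tendsto_mult_right_zero[of "\<lambda>n. Lp_norm p (\<lambda>x. F n x - h x)"] F by blast
    qed (use F h in \<open>auto intro!: always_eventually Lp_norm_nonneg T(3)\<close>)
  next
    fix h i assume "h \<in> jacobi_span \<alpha> \<beta>"
    then have h: "h \<in> J.poly_span" unfolding span .
    have z: "Lp_norm 2 (\<lambda>x. J.riesz h x $ i - J.riesz h x $ i) = 0" by (simp add: Lp_norm_def)
    show "has_riesz_transform \<alpha> \<beta> i h (\<lambda>x. T h x $ i)"
      unfolding has_riesz_transform_def T(2)[OF h]
      using limit[OF h, of "\<lambda>x. J.riesz h x $ i" i] comp_Lp J.poly_span_Lp[OF h, of 2] unfolding z by simp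
  qed
  moreover have "Lp_norm p (R h) \<le> 48 * (max p (p / (p - 1)) - 1) * Lp_norm p h"
    if R: "riesz_extension \<alpha> \<beta> p R" and h: "h \<in> Lp p" for R h
  proof -
    have "Lp_norm p (R h) \<le> J.riesz_const p * Lp_norm p h"
    proof (rule J.extension_bound[OF assms(3) _ _ _ h])
      show "R g \<in> Lp p" if "g \<in> Lp p" for g using R that unfolding riesz_extension_def by blast
      show "(\<lambda>n. Lp_norm p (\<lambda>x. R (F n) x - R g x)) \<longlonglongrightarrow> 0"
        if "g \<in> Lp p" "\<And>n. F n \<in> Lp p" "(\<lambda>n. Lp_norm p (\<lambda>x. F n x - g x)) \<longlonglongrightarrow> 0" for F g
        using R that unfolding riesz_extension_def by blast
      show "AE x in cube_measure. R g x = J.riesz g x" if g: "g \<in> J.poly_span" for g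
      proof -
        have "AE x in cube_measure. R g x $ i = J.riesz g x $ i" for i
        proof -
          have ht: "has_riesz_transform \<alpha> \<beta> i g (\<lambda>x. R g x $ i)"
            using R g unfolding riesz_extension_def span by blast
          \<comment> \<open>The same net converges to 0 because R extends the Riesz transforms, and
            to this seminorm by \<open>limit\<close>.\<close>
          have "Lp_norm 2 (\<lambda>x. R g x $ i - J.riesz g x $ i) = 0"
            using tendsto_unique[OF _ limit[OF g, of "\<lambda>x. R g x $ i" i]] ht unfolding has_riesz_transform_def by simp
          moreover have "(\<lambda>x. R g x $ i - J.riesz g x $ i) \<in> Lp 2"
            using ht comp_Lp unfolding has_riesz_transform_def by (intro Lp_diff) auto
          ultimately have "AE x in cube_measure. R g x $ i - J.riesz g x $ i = 0" by (intro Lp_norm_zero_AE) auto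
          then show ?thesis by eventually_elim simp
        qed
        then have "AE x in cube_measure. \<forall>i. R g x $ i = J.riesz g x $ i" by (simp add: AE_all_countable)
        then show ?thesis by eventually_elim (simp add: vec_eq_iff)
      qed
    qed
    \<comment> \<open>The argument gives the constant 34, and p^* - 1 is nonnegative.\<close>
    also have "\<dots> \<le> 48 * (max p (p / (p - 1)) - 1) * Lp_norm p h"
      unfolding J.riesz_const_def using assms(3) by (intro mult_right_mono Lp_norm_nonneg) (auto simp: max_def)
    finally show ?thesis .
  qed
  ultimately show ?thesis by blast
qed

end
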